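(* Let $s\in(-2,0)$ be arbitrary. Amongst all $5$-point configurations on the unit sphere $S^2$, the triangular bi-pyramid (TBP) is the unique global minimizer with respect to $R_s$ (uniqueness being up to isometry).
   Context: $S^2$ is the unit sphere in $\mathbb{R}^3$. A $5$-point configuration is a set $P=\{P_1,\dots,P_5\}$ of $5$ distinct points of $S^2$; two configurations are considered the same if they are isometric. For $f:(0,2]\to\mathbb{R}$ the $f$-energy of $P$ is $\mathcal{E}_f(P)=\sum_{i<j}f(\|P_i-P_j\|)$, with Euclidean distance in $\mathbb{R}^3$. A minimizer with respect to $f$ is a $5$-point configuration of minimal $\mathcal{E}_f$. The function $R_s$ is $R_s(r)=\mathrm{sign}(s)\,r^{-s}$. The TBP is the configuration with one point at the north pole, one at the south pole, and three forming an equilateral triangle on the equator. *)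

theory Defs
  imports "HOL-Analysis.Analysis"
begin

definition five_point_configuration :: "(real^3) set \<Rightarrow> bool" where
  "five_point_configuration P \<longleftrightarrow> P \<subseteq> sphere 0 1 \<and> card P = 5"

text \<open>Every unordered pair of distinct points occurs as two ordered pairs below, hence the
  factor 1/2; \<open>energy_enumeration\<close> recovers the sum over \<open>i < j\<close>. Only the values of
  \<open>f\<close> on the interval \<open>(0, 2]\<close> matter for configurations on the unit sphere.\<close>

definition energy :: "(real \<Rightarrow> real) \<Rightarrow> (real^3) set \<Rightarrow> real" where
  "energy f P = (\<Sum>p\<in>P. \<Sum>q\<in>P - {p}. f (dist p q)) / 2"

lemma energy_enumeration:
  fixes p :: "nat \<Rightarrow> real^3"
  assumes "inj_on p {..<n}"
  shows "energy f (p ` {..<n}) = (\<Sum>j<n. \<Sum>i<j. f (dist (p i) (p j)))"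
  using assms
proof (induction n)
  case 0
  then show ?case by (simp add: energy_def)
next
  case (Suc n)
  let ?P = "p ` {..<n}"
  have inj: "inj_on p {..<n}" and notin: "p n \<notin> ?P"
    using Suc.prems by (auto simp: lessThan_Suc)
  have inner: "(\<Sum>q\<in>insert (p n) ?P - {x}. f (dist x q))
      = f (dist x (p n)) + (\<Sum>q\<in>?P - {x}. f (dist x q))" if "x \<in> ?P" for x
  proof -
    have "insert (p n) ?P - {x} = insert (p n) (?P - {x})"
      using that notin by auto
    then show ?thesis using notin by simp
  qed
  have "2 * energy f (insert (p n) ?P)
      = (\<Sum>q\<in>?P. f (dist (p n) q))
        + (\<Sum>x\<in>?P. f (dist x (p n)) + (\<Sum>q\<in>?P - {x}. f (dist x q)))"
    unfolding energy_def using notin by (simp add: inner)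
  also have "\<dots> = 2 * (\<Sum>x\<in>?P. f (dist x (p n))) + 2 * energy f ?P"
    by (simp add: energy_def sum.distrib dist_commute)
  also have "(\<Sum>x\<in>?P. f (dist x (p n))) = (\<Sum>i<n. f (dist (p i) (p n)))"
    using inj by (simp add: sum.reindex)
  finally show ?case
    using Suc.IH[OF inj] by (simp add: lessThan_Suc)
qed

definition is_minimizer :: "(real \<Rightarrow> real) \<Rightarrow> (real^3) set \<Rightarrow> bool" where
  "is_minimizer f P \<longleftrightarrow> five_point_configuration P \<and>
     (\<forall>Q. five_point_configuration Q \<longrightarrow> energy f P \<le> energy f Q)"

text \<open>Isometry is realised by a distance-preserving map of the ambient space. For subsets of
  the sphere this amounts to a distance-preserving bijection between the two sets.\<close>

definition isometric :: "(real^3) set \<Rightarrow> (real^3) set \<Rightarrow> bool" where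
  "isometric P Q \<longleftrightarrow>
     (\<exists>h :: real^3 \<Rightarrow> real^3. (\<forall>x y. dist (h x) (h y) = dist x y) \<and> h ` P = Q)"

definition R :: "real \<Rightarrow> real \<Rightarrow> real" where
  "R s r = sgn s * r powr (- s)"

definition TBP :: "(real^3) set" where
  "TBP = {vector [0, 0, 1], vector [0, 0, -1],
          vector [1, 0, 0], vector [-1/2, sqrt 3 / 2, 0], vector [-1/2, - sqrt 3 / 2, 0]}"

end

theory Submission
  imports Defs "HOL-Analysis.Cross3"
begin

text \<open>
  Put \<open>q = - s/2\<close>, so \<open>0 < q < 1\<close>, and let \<open>x\<^sub>i\<^sub>j\<close> be the scalar product of \<open>P\<^sub>i\<close> and \<open>P\<^sub>j\<close>. Up to a
  positive factor and an additive constant the energy is the sum of \<open>phi q x\<^sub>i\<^sub>j\<close> over the ten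
  pairs, where \<open>phi q v = (1 - (1 - v)\<^sup>q)/q\<close>, and the bi-pyramid has the value
  \<open>3 * phi q (- 1/2) + phi q (- 1)\<close>. For \<open>q = 1\<close> the sum is half of the squared length of the
  sum of the points, up to a constant, and every balanced configuration is optimal. Hence all
  estimates have to be exact at \<open>q = 1\<close>; what decides is the coefficient of \<open>1 - q\<close>.

  Let \<open>P4\<close>, \<open>P5\<close> be a farthest pair, \<open>m\<close> its midpoint and \<open>\<mu>\<close> the length of \<open>m\<close>. The other three
  points are called the triangle. No scalar product is smaller than \<open>2 * \<mu>\<^sup>2 - 1\<close>.

  If \<open>\<mu> \<le> 1/3\<close>, the farthest pair is nearly antipodal and the configuration can be compared with the
  bi-pyramid pair by pair: \<open>phi q\<close> is expanded at \<open>0\<close> for the six pairs between the triangle and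
  the farthest pair, at \<open>- 1/2\<close> for the three pairs of the triangle and at \<open>- 1\<close> for the farthest
  pair. The cubic bound \<open>phi_cubic_minorant\<close> and quadratic bounds for \<open>(2/3)\<^bsup>1 - q\<^esup>\<close> and
  \<open>(1/2)\<^bsup>1 - q\<^esup>\<close> remove the transcendental dependence on \<open>q\<close>. A lower bound by two polynomials
  without \<open>q\<close> is left, mixed with the nonnegative weights \<open>q * (1 - q)\<close> and
  \<open>(1 - q)\<^sup>2\<close>; \<open>antipodal_bound\<close> says that both are positive away from the bi-pyramid.

  If \<open>\<mu> > 1/3\<close>, all scalar products are at least some \<open>- u\<close> with \<open>u < 1\<close>, and the linear programming
  bound \<open>x + c * x\<^sup>2 \<le> phi q x\<close> on \<open>[- u, 1]\<close>, with equality at \<open>0\<close> and \<open>- u\<close>, is good enough. It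
  remains to bound the sum of the squares \<open>x\<^sub>i\<^sub>j\<^sup>2\<close> from below (\<open>product_squares_gt\<close>) and to compare
  the resulting constant with the bi-pyramid for all \<open>q\<close> at once
  (\<open>quadratic_coefficient_bounds\<close>).

  Both polynomial problems live in coordinates in which \<open>m\<close> points along the first axis and
  \<open>P4 - P5\<close> along the third. The geometric core is \<open>second_moment_bound\<close>. It eliminates all
  coordinates of the triangle in favour of two numbers: the length \<open>w\<close> of the horizontal part of its
  sum, and the sum \<open>zeta\<close> of the squared heights. Horizontal parts are read as complex numbers
  \<open>a\<close>, \<open>b\<close>, \<open>c\<close> of modulus close to one, so that \<open>a * b + a * c + b * c\<close> is close to
  \<open>a * b * c * cnj (a + b + c)\<close>, and this controls the sum of the squares of \<open>a\<close>, \<open>b\<close>, \<open>c\<close> by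
  their sum. The remaining inequalities in \<open>\<mu>\<close>, \<open>w\<close>, \<open>zeta\<close> are made linear in \<open>zeta\<close> between a few
  nodes and quadratic in \<open>w\<close> by tangents at the expected optimum \<open>w = 2 * \<mu>\<close>; the discriminants are
  polynomials in \<open>\<mu>\<close> with positive Bernstein coefficients.

  The bounds have slack \<open>(\<mu>\<^sup>2 + w\<^sup>2 + zeta)/1000\<close> in the first case and are strict in the second.
  So equality forces \<open>P5 = - P4\<close>, a triangle in the plane orthogonal to \<open>P4\<close>, and sum zero. These
  scalar products are those of the bi-pyramid, and \<open>isometric_TBP\<close> turns this into an isometry.
\<close>

section \<open>Estimates for power functions\<close>

lemma powr_le_chord:
  fixes y e :: real
  assumes "0 \<le> e" "e \<le> 1" "0 < y"
  shows "y powr e \<le> 1 + e * (y - 1)"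
  using Youngs_inequality_0[of e "1 - e" y 1] assms by (simp add: algebra_simps)

lemma ln_one_minus_cubic:
  fixes v :: real
  assumes "0 \<le> v" "v < 1"
  shows "v + v\<^sup>2/2 + v^3/3 \<le> - ln (1 - v)"
proof -
  let ?f = "\<lambda>v::real. - ln (1 - v) - v - v\<^sup>2/2 - v^3/3"
  have "?f 0 \<le> ?f v"
  proof (rule DERIV_nonneg_imp_nondecreasing[OF assms(1)])
    fix x assume x: "0 \<le> x" "x \<le> v"
    have d: "DERIV ?f x :> 1/(1-x) - 1 - x - x\<^sup>2"
      using x assms by (auto intro!: derivative_eq_intros simp: field_simps power2_eq_square)
    have "1/(1-x) - 1 - x - x\<^sup>2 = x^3/(1-x)"
      using x assms by (simp add: field_simps power2_eq_square power3_eq_cube)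
    then show "\<exists>y. DERIV ?f x :> y \<and> 0 \<le> y"
      using d x assms by (intro exI[of _ "1/(1-x) - 1 - x - x\<^sup>2"]) simp
  qed
  then show ?thesis by simp
qed

lemma ln_one_plus_cubic:
  fixes y :: real
  assumes "- 1 < y"
  shows "ln (1 + y) \<le> y - y\<^sup>2/2 + y^3/3"
proof -
  let ?f = "\<lambda>y::real. y - y\<^sup>2/2 + y^3/3 - ln (1 + y)"
  have d: "DERIV ?f x :> x^3/(1+x)" if "-1 < x" for x
    using that by (auto intro!: derivative_eq_intros simp: field_simps power2_eq_square power3_eq_cube)
  have "?f 0 \<le> ?f y"
  proof (cases "0 \<le> y")
    case True
    show ?thesis
    proof (rule DERIV_nonneg_imp_nondecreasing[OF True])
      fix x assume x: "0 \<le> x" "x \<le> y"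
      show "\<exists>z. DERIV ?f x :> z \<and> 0 \<le> z"
        using d[of x] x by (intro exI[of _ "x^3/(1+x)"]) simp
    qed
  next
    case False
    then have "y \<le> 0" by simp
    then show ?thesis
    proof (rule DERIV_nonpos_imp_nonincreasing)
      fix x assume x: "y \<le> x" "x \<le> 0"
      have "x^3 \<le> 0" using x by (simp add: power3_eq_cube mult_nonneg_nonpos mult_nonpos_nonpos zero_le_mult_iff mult_le_0_iff)
      then have "x^3/(1+x) \<le> 0" using x assms by (simp add: divide_le_0_iff)
      then show "\<exists>z. DERIV ?f x :> z \<and> z \<le> 0"
        using d[of x] x assms by (intro exI[of _ "x^3/(1+x)"]) simp
    qed
  qed
  then show ?thesis by simp
qed

text \<open>The precision is dictated by \<open>quadratic_coefficient_bounds_pieces\<close>, where the tightest margins are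
  a few units in the fifth decimal.\<close>

lemma ln_bounds:
  shows "ln (2::real) \<in> {69314/100000..69315/100000}" "ln (3/2::real) \<in> {40546/100000..40547/100000}"
    "ln (4/3::real) \<in> {28768/100000..28769/100000}"
    "ln (16/9::real) \<in> {57536/100000..57537/100000}" "ln (7/4::real) \<in> {55961/100000..55962/100000}"
    "ln (5/3::real) \<in> {51082/100000..51083/100000}" "ln (8/5::real) \<in> {47000/100000..47001/100000}"
    "ln (14/9::real) \<in> {44183/100000..44184/100000}"
  using ln_approx_bounds[of 2 5] ln_approx_bounds[of "3/2" 3] ln_approx_bounds[of "4/3" 3]
    ln_approx_bounds[of "16/9" 4] ln_approx_bounds[of "7/4" 4] ln_approx_bounds[of "5/3" 4]
    ln_approx_bounds[of "8/5" 4] ln_approx_bounds[of "14/9" 4]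
  by (simp_all add: eval_nat_numeral)

text \<open>The Box--Cox transform of \<open>1 - v\<close> with reversed sign; it is normalised by
  \<open>phi q 0 = 0\<close> and derivative one at \<open>0\<close>, and tends to \<open>v\<close> for \<open>q\<close> tending to one.\<close>

definition phi :: "real \<Rightarrow> real \<Rightarrow> real" where
  "phi q v = (1 - (1 - v) powr q) / q"

text \<open>The derivative of the difference is bounded below by \<open>exp t \<ge> 1 + t\<close>, which makes it a multiple of
  \<open>1 - q\<close>. What is left is a comparison of \<open>- ln (1 - x)\<close> with a quadratic polynomial,
  independent of \<open>q\<close>.\<close>

lemma phi_cubic_nonneg:
  fixes q v :: real
  assumes q: "0 < q" "q < 1" and v: "0 \<le> v" "v \<le> 1"
  shows "v + (1 - q) * (12/25 * v\<^sup>2 + 21/100 * v^3) \<le> phi q v"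
proof (cases "v = 1")
  case True
  have "q * (1 + (1 - q) * (12/25 + 21/100)) \<le> q * (1 + (1 - q))"
    using q by (intro mult_left_mono) (auto simp: field_simps)
  also have "\<dots> \<le> 1"
    using zero_le_power2[of "1 - q"] by (simp add: power2_eq_square algebra_simps)
  finally show ?thesis using q True by (simp add: phi_def field_simps)
next
  case False
  with v have v1: "v < 1" by simp
  let ?f = "\<lambda>v. phi q v - v - (1 - q) * (12/25 * v\<^sup>2 + 21/100 * v^3)"
  have "?f 0 \<le> ?f v"
  proof (rule DERIV_nonneg_imp_nondecreasing[OF v(1)])
    fix x assume x: "0 \<le> x" "x \<le> v"
    define D where "D = (1 - x) powr (q - 1) - 1 - (1 - q) * (24/25 * x + 63/100 * x\<^sup>2)"
    have "DERIV ?f x :> D"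
      unfolding phi_def D_def using q x v1
      by (auto intro!: derivative_eq_intros simp: field_simps power2_eq_square)
    moreover have "0 \<le> D"
    proof -
      have "1 + (1 - q) * (- ln (1 - x)) \<le> (1 - x) powr (q - 1)"
        using exp_ge_add_one_self[of "(q - 1) * ln (1 - x)"] x v1
        by (simp add: powr_def algebra_simps)
      moreover have "(1 - q) * (24/25 * x + 63/100 * x\<^sup>2) \<le> (1 - q) * (- ln (1 - x))"
      proof (intro mult_left_mono)
        have "0 \<le> x * (1/25 - 13/100 * x + x\<^sup>2/3)"
        proof (intro mult_nonneg_nonneg x)
          have "1/25 - 13/100 * x + x\<^sup>2/3 = (x - 39/200)\<^sup>2/3 + (1/25 - (39/200)^2/3)"
            by (simp add: power2_eq_square field_simps)
          then show "0 \<le> 1/25 - 13/100 * x + x\<^sup>2/3"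
            by (simp add: power2_eq_square)
        qed
        then have "24/25 * x + 63/100 * x\<^sup>2 \<le> x + x\<^sup>2/2 + x^3/3"
          by (simp add: power2_eq_square power3_eq_cube algebra_simps)
        also have "\<dots> \<le> - ln (1 - x)" using ln_one_minus_cubic[of x] x v1 by simp
        finally show "24/25 * x + 63/100 * x\<^sup>2 \<le> - ln (1 - x)" .
      qed (use q in simp)
      ultimately show ?thesis unfolding D_def by linarith
    qed
    ultimately show "\<exists>y. DERIV ?f x :> y \<and> 0 \<le> y" by blast
  qed
  then show ?thesis by (simp add: phi_def)
qed

text \<open>The case of negative arguments for \<open>q = 0\<close>. The constants \<open>12/25\<close> and \<open>21/100\<close> are almost best
  possible: the difference is of order \<open>1/10000\<close> near \<open>7/20\<close>, so that the logarithm has to be expanded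
  at \<open>4/3\<close> there.\<close>

lemma ln_minorant:
  fixes u :: real
  assumes "0 \<le> u" "u \<le> 1"
  shows "12/25 * u\<^sup>2 - 21/100 * u^3 \<le> u - ln (1 + u)"
proof (cases "u \<le> 4/25")
  case True
  have "0 \<le> u\<^sup>2 * (1/50 - 37/300 * u)"
    using True assms by (intro mult_nonneg_nonneg) auto
  then show ?thesis
    using ln_one_plus_cubic[of u] assms
    by (simp add: power2_eq_square power3_eq_cube algebra_simps)
next
  case False
  define y where "y = (3 * u - 1)/4"
  have y: "- 1 < y" using assms by (simp add: y_def)
  have "1 + u = 4/3 * (1 + y)" by (simp add: y_def field_simps)
  then have "ln (1 + u) = ln (4/3) + ln (1 + y)"
    using y by (subst \<open>1 + u = 4/3 * (1 + y)\<close>, intro ln_mult_pos) auto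
  also have "\<dots> \<le> 28769/100000 + (y - y\<^sup>2/2 + y^3/3)"
    using ln_bounds(3) ln_one_plus_cubic[OF y] by simp
  finally have *: "ln (1 + u) \<le> 28769/100000 + (y - y\<^sup>2/2 + y^3/3)" .
  have "0 \<le> u - (28769/100000 + (y - y\<^sup>2/2 + y^3/3)) - 12/25 * u\<^sup>2 + 21/100 * u^3"
  proof -
    \<comment> \<open>the difference nearly has a double zero at \<open>17/50\<close>\<close>
    have "0 \<le> (u - 17/50)\<^sup>2 * (111/1600 * u - 219/20000) + (637/4000000 * u + 5123/150000000)"
      using False by (intro add_nonneg_nonneg mult_nonneg_nonneg) auto
    then show ?thesis unfolding y_def
      by (simp add: power2_eq_square power3_eq_cube field_simps)
  qed
  then show ?thesis using * by linarith
qed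

lemma DERIV_phi_minus:
  assumes "0 < q" "0 \<le> x"
  shows "DERIV (\<lambda>u. phi q (- u)) x :> - ((1 + x) powr (q - 1))"
  unfolding phi_def using assms by (auto intro!: derivative_eq_intros)

text \<open>For negative arguments \<open>phi q (- u)\<close> lies above the chord in the parameter \<open>q\<close> joining its values
  \<open>- ln (1 + u)\<close> at \<open>q = 0\<close> and \<open>- u\<close> at \<open>q = 1\<close>.\<close>

lemma phi_chord:
  fixes q u :: real
  assumes q: "0 < q" "q < 1" and u: "0 \<le> u"
  shows "- u + (1 - q) * (u - ln (1 + u)) \<le> phi q (- u)"
proof -
  let ?f = "\<lambda>u. u - (1 - q) * (u - ln (1 + u)) + phi q (- u)"
  have "?f 0 \<le> ?f u"
  proof (rule DERIV_nonneg_imp_nondecreasing[OF u])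
    fix x assume x: "0 \<le> x" "x \<le> u"
    have "DERIV ?f x :> 1 - (1 - q) * (1 - 1 / (1 + x)) + - ((1 + x) powr (q - 1))"
      using x by (auto intro!: derivative_eq_intros DERIV_phi_minus[OF q(1)])
    moreover have "0 \<le> 1 - (1 - q) * (1 - 1 / (1 + x)) + - ((1 + x) powr (q - 1))"
    proof -
      have "(1 + x) powr (q - 1) = (1/(1 + x)) powr (1 - q)"
        using x powr_minus_divide[of "1 + x" "1 - q"] by (simp add: powr_divide)
      also have "\<dots> \<le> 1 + (1 - q) * (1/(1 + x) - 1)"
        using q x by (intro powr_le_chord) auto
      finally show ?thesis by (simp add: algebra_simps)
    qed
    ultimately show "\<exists>y. DERIV ?f x :> y \<and> 0 \<le> y" by blast
  qed
  then show ?thesis by (simp add: phi_def)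
qed

text \<open>The correction to the linear function \<open>v\<close> carries the factor \<open>1 - q\<close>, which keeps the bound exact
  at \<open>q = 1\<close>, while its coefficients do not depend on \<open>q\<close>.\<close>

lemma phi_cubic_minorant:
  fixes q v :: real
  assumes q: "0 < q" "q < 1" and v: "- 1 \<le> v" "v \<le> 1"
  shows "v + (1 - q) * (12/25 * v\<^sup>2 + 21/100 * v^3) \<le> phi q v"
proof (cases "0 \<le> v")
  case True
  then show ?thesis using phi_cubic_nonneg[OF q] v by simp
next
  case False
  then have "(1 - q) * (12/25 * v\<^sup>2 + 21/100 * v^3) \<le> (1 - q) * (- v - ln (1 - v))"
    using ln_minorant[of "- v"] v q by (intro mult_left_mono) auto
  then show ?thesis using phi_chord[OF q, of "- v"] False by simp
qed

lemma phi_quadratic_nonneg: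
  fixes q v :: real
  assumes q: "0 < q" "q < 1" and v: "0 \<le> v" "v < 1"
  shows "v + (1 - q) * (v\<^sup>2/2) \<le> phi q v"
proof -
  let ?f = "\<lambda>v. phi q v - v - (1 - q) * (v\<^sup>2/2)"
  have "?f 0 \<le> ?f v"
  proof (rule DERIV_nonneg_imp_nondecreasing[OF v(1)])
    fix x assume x: "0 \<le> x" "x \<le> v"
    define D where "D = (1 - x) powr (q - 1) - 1 - (1 - q) * x"
    have "DERIV ?f x :> D"
      unfolding phi_def D_def using q x v
      by (auto intro!: derivative_eq_intros simp: field_simps power2_eq_square)
    moreover have "0 \<le> D"
    proof -
      have "1 + (1 - q) * (- ln (1 - x)) \<le> (1 - x) powr (q - 1)"
        using exp_ge_add_one_self[of "(q - 1) * ln (1 - x)"] x v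
        by (simp add: powr_def algebra_simps)
      moreover have "(1 - q) * x \<le> (1 - q) * (- ln (1 - x))"
        using ln_add_one_self_le_self2[of "- x"] x v q by (intro mult_left_mono) auto
      ultimately show ?thesis unfolding D_def by linarith
    qed
    ultimately show "\<exists>y. DERIV ?f x :> y \<and> 0 \<le> y" by blast
  qed
  then show ?thesis by (simp add: phi_def[of q 0])
qed

lemma phi_le_quadratic:
  fixes q u :: real
  assumes q: "0 < q" "q < 1" and u: "0 \<le> u"
  shows "phi q (- u) \<le> - u + (1 - q) * (u\<^sup>2/2)"
proof -
  let ?f = "\<lambda>u. - u + (1 - q) * (u\<^sup>2/2) - phi q (- u)"
  have "?f 0 \<le> ?f u"
  proof (rule DERIV_nonneg_imp_nondecreasing[OF u])
    fix x assume x: "0 \<le> x" "x \<le> u"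
    have "DERIV ?f x :> - 1 + (1 - q) * x - - ((1 + x) powr (q - 1))"
      using x by (auto intro!: derivative_eq_intros DERIV_phi_minus[OF q(1)])
    moreover have "1 + (q - 1) * ln (1 + x) \<le> (1 + x) powr (q - 1)"
      using exp_ge_add_one_self[of "(q - 1) * ln (1 + x)"] x by (simp add: powr_def)
    moreover have "(1 - q) * ln (1 + x) \<le> (1 - q) * x"
      using q x ln_add_one_self_le_self[of x] by (intro mult_left_mono) auto
    ultimately show "\<exists>y. DERIV ?f x :> y \<and> 0 \<le> y"
      by (intro exI[of _ "- 1 + (1 - q) * x - - ((1 + x) powr (q - 1))"]) (auto simp: algebra_simps)
  qed
  then show ?thesis by (simp add: phi_def[of q 0])
qed

lemma phi_le_ln:
  fixes q u :: real
  assumes q: "0 < q" and u: "0 \<le> u"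
  shows "phi q (- u) \<le> - ln (1 + u)"
  using exp_ge_add_one_self[of "q * ln (1 + u)"] q u
  by (simp add: phi_def powr_def field_simps)

text \<open>On \<open>[- u, 0]\<close> the difference of the two sides vanishes at both ends and, for \<open>y = - x\<close>, has a concave
  derivative vanishing at \<open>y = 0\<close>. So it first increases and then decreases. For \<open>x \<ge> 0\<close> the
  coefficient is at most \<open>(1 - q)/2\<close>, the second Taylor coefficient of \<open>phi q\<close> at \<open>0\<close>.\<close>

lemma phi_quadratic_interpolation:
  fixes q u x :: real
  assumes q: "0 < q" "q < 1" and u: "0 < u" and x: "- u \<le> x" "x \<le> 1"
  shows "x + (phi q (- u) + u) / u\<^sup>2 * x\<^sup>2 \<le> phi q x"
proof -
  define c where "c = (phi q (- u) + u) / u\<^sup>2"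
  have c_le: "c \<le> (1 - q)/2"
    using phi_le_quadratic[OF q, of u] u by (simp add: c_def field_simps)
  show ?thesis
  proof (cases "0 \<le> x")
    case True
    have "c * x\<^sup>2 \<le> (1 - q) * (x\<^sup>2/2)"
      using mult_right_mono[OF c_le, of "x\<^sup>2"] by simp
    moreover have "x + (1 - q) * (x\<^sup>2/2) \<le> phi q x"
    proof (cases "x = 1")
      case True
      have "1 + (1 - q) * (12/25 + 21/100) \<le> phi q 1" using phi_cubic_minorant[OF q, of 1] by simp
      then have "1 + (1 - q) * (1/2) \<le> phi q 1" using q by argo
      then show ?thesis unfolding True by simp
    next
      case False
      then show ?thesis using phi_quadratic_nonneg[OF q \<open>0 \<le> x\<close>] x by simp
    qed
    ultimately show ?thesis unfolding c_def[symmetric] by simp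
  next
    case False
    define y where "y = - x"
    have y: "0 < y" "y \<le> u" using False x by (auto simp: y_def)
    let ?g = "\<lambda>y. phi q (- y) + y - c * y\<^sup>2"
    let ?g' = "\<lambda>y. - ((1 + y) powr (q - 1)) + 1 - 2 * c * y"
    have d: "DERIV ?g z :> ?g' z" if "0 \<le> z" for z
      using that by (auto intro!: derivative_eq_intros DERIV_phi_minus[OF q(1)])
    have conv: "convex_on {0..} (\<lambda>z. (1 + z) powr (q - 1))"
    proof (rule f''_ge0_imp_convex)
      show "DERIV (\<lambda>z. (1 + z) powr (q - 1)) z :> (q - 1) * (1 + z) powr (q - 2)"
        if "z \<in> {0..}" for z
        using that by (auto intro!: derivative_eq_intros)
      show "DERIV (\<lambda>z. (q - 1) * (1 + z) powr (q - 2)) z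
            :> (q - 1) * ((q - 2) * (1 + z) powr (q - 3))"
        if "z \<in> {0..}" for z
        using that by (auto intro!: derivative_eq_intros)
      show "0 \<le> (q - 1) * ((q - 2) * (1 + z) powr (q - 3))" for z
        using q by (intro mult_nonpos_nonpos mult_nonpos_nonneg) auto
    qed auto
    have "0 \<le> ?g y"
    proof (rule ccontr)
      assume neg: "\<not> 0 \<le> ?g y"
      have g0: "?g 0 = 0" by (simp add: phi_def)
      have gu: "?g u = 0" using u by (simp add: c_def)
      have yu: "y < u" using neg gu y by (cases "y = u") auto
      obtain a where a: "0 < a" "a < y" "?g y - ?g 0 = (y - 0) * ?g' a"
        using MVT2[of 0 y ?g ?g'] y d by auto
      obtain b where b: "y < b" "b < u" "?g u - ?g y = (u - y) * ?g' b"
        using MVT2[of y u ?g ?g'] y yu d by auto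
      have a': "?g' a < 0"
        using a(3) neg g0 y by (metis diff_zero mult_nonneg_nonneg not_le less_imp_le)
      have "(u - y) * ?g' b > 0" using b(3) neg gu by linarith
      then have b': "?g' b > 0" using yu by (simp add: zero_less_mult_iff)
      have "(1 + ((1 - a/b) * 0 + a/b * b)) powr (q - 1)
            \<le> (1 - a/b) * (1 + 0) powr (q - 1) + a/b * (1 + b) powr (q - 1)"
        using convex_onD[OF conv, of "a/b" 0 b] a b y by simp
      then have "?g' a \<ge> a/b * ?g' b"
        using a b y by (simp add: algebra_simps)
      moreover have "a/b * ?g' b > 0" using a b b' y by (intro mult_pos_pos) auto
      ultimately show False using a' by linarith
    qed
    then show ?thesis by (simp add: y_def c_def)
  qed
qed

text \<open>At a negative minimum the second derivative is nonnegative. By convexity \<open>K\<close> is then nonnegative on one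
  side up to the end of the interval, so that the derivative keeps its sign there and \<open>h\<close> is at least its
  boundary value zero. The positive factor \<open>c\<close> allows a common exponential to be split off.\<close>

lemma nonneg_of_convex_second_derivative:
  fixes h h' c K :: "real \<Rightarrow> real"
  assumes d1: "\<And>x. DERIV h x :> h' x" and d2: "\<And>x. DERIV h' x :> c x * K x"
    and c: "\<And>x. 0 < c x" and conv: "convex_on {0..1} K"
    and ends: "h 0 = 0" "h 1 = 0" "0 \<le> h' 0" "h' 1 \<le> 0"
    and x: "0 \<le> x" "x \<le> 1"
  shows "0 \<le> h x"
proof -
  have "continuous_on {0..1} h"
    using d1 by (meson DERIV_continuous_on has_field_derivative_at_within)
  then obtain m where m: "m \<in> {0..1}" "\<And>y. y \<in> {0..1} \<Longrightarrow> h m \<le> h y"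
    using continuous_attains_inf[of "{0..1::real}" h] by auto
  have "0 \<le> h m"
  proof (rule ccontr)
    assume neg: "\<not> 0 \<le> h m"
    then have m01: "0 < m" "m < 1" using m ends by (force simp: less_le)+
    have h'm: "h' m = 0"
    proof (rule DERIV_local_min[OF d1])
      show "0 < min m (1 - m)" using m01 by simp
      show "\<forall>y. \<bar>m - y\<bar> < min m (1 - m) \<longrightarrow> h m \<le> h y" using m by (auto simp: abs_less_iff)
    qed
    have left: "\<exists>a\<in>{0..m}. K a < 0"
    proof (rule ccontr)
      assume pos: "\<not> ?thesis"
      have "0 \<le> h' y" if y: "0 \<le> y" "y \<le> m" for y
      proof -
        have "h' 0 \<le> h' y"
        proof (rule DERIV_nonneg_imp_nondecreasing[OF y(1)])
          fix z assume "0 \<le> z" "z \<le> y"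
          then show "\<exists>w. DERIV h' z :> w \<and> 0 \<le> w"
            using pos y d2[of z] less_imp_le[OF c[of z]]
            by (intro exI[of _ "c z * K z"]) (auto simp: not_less)
        qed
        then show ?thesis using ends by simp
      qed
      then have "h 0 \<le> h m"
        using DERIV_nonneg_imp_nondecreasing[of 0 m h] m01 d1 less_imp_le by metis
      then show False using neg ends by simp
    qed
    have right: "\<exists>b\<in>{m..1}. K b < 0"
    proof (rule ccontr)
      assume pos: "\<not> ?thesis"
      have "h' y \<le> 0" if y: "m \<le> y" "y \<le> 1" for y
      proof -
        have "h' y \<le> h' 1"
        proof (rule DERIV_nonneg_imp_nondecreasing[OF y(2)])
          fix z assume "y \<le> z" "z \<le> 1"
          then show "\<exists>w. DERIV h' z :> w \<and> 0 \<le> w"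
            using pos y d2[of z] less_imp_le[OF c[of z]]
            by (intro exI[of _ "c z * K z"]) (auto simp: not_less)
        qed
        then show ?thesis using ends by simp
      qed
      then have "h 1 \<le> h m"
        using DERIV_nonpos_imp_nonincreasing[of m 1 h] m01 d1 less_imp_le by metis
      then show False using neg ends by simp
    qed
    have Km: "K m < 0"
    proof -
      obtain a b where ab: "0 \<le> a" "a \<le> m" "m \<le> b" "b \<le> 1" "K a < 0" "K b < 0"
        using left right by auto
      show ?thesis
      proof (cases "a = b")
        case True then show ?thesis using ab by auto
      next
        case False
        then have "a < b" using ab by auto
        define t where "t = (m - a)/(b - a)"
        have "t * (b - a) = m - a" using \<open>a < b\<close> by (simp add: t_def)
        then have "m = (1 - t) * a + t * b" by (simp add: algebra_simps)
        moreover have "0 \<le> t" "t \<le> 1" using ab \<open>a < b\<close> by (simp_all add: t_def)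
        ultimately have t: "0 \<le> t" "t \<le> 1" "m = (1 - t) * a + t * b" by blast+
        have "K m \<le> (1 - t) * K a + t * K b"
          using convex_onD[OF conv t(1,2), of a b] ab t(3) by simp
        also have "\<dots> < 0"
        proof -
          have "(1 - t) * K a + t * K b \<le> (1 - t) * max (K a) (K b) + t * max (K a) (K b)"
            using t by (intro add_mono mult_left_mono) auto
          also have "\<dots> = max (K a) (K b)" by (simp add: algebra_simps)
          finally show ?thesis using ab by linarith
        qed
        finally show ?thesis .
      qed
    qed
    have "c m * K m < 0" using Km c[of m] by (simp add: mult_less_0_iff)
    then obtain e where e: "0 < e" "\<And>t. 0 < t \<Longrightarrow> t < e \<Longrightarrow> h' (m + t) < 0"
      using DERIV_neg_dec_right[OF d2[of m]] h'm by auto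
    define t where "t = min (e/2) (1 - m)"
    have t: "0 < t" "t < e" "m + t \<le> 1" using e m01 by (auto simp: t_def)
    obtain z where z: "m < z" "z < m + t" "h (m + t) - h m = (m + t - m) * h' z"
      using MVT2[of m "m + t" h h'] d1 t by auto
    have "h' z < 0" using e(2)[of "z - m"] z t by simp
    then have "t * h' z < 0" using t by (simp add: mult_less_0_iff)
    then have "h (m + t) < h m" using z(3) by simp
    then show False using m(2)[of "m + t"] t m01 by simp
  qed
  then show ?thesis using m x by force
qed

lemma convex_on_exp_sum:
  fixes a b :: real
  assumes "convex S" "0 \<le> a" "0 \<le> b"
  shows "convex_on S (\<lambda>x::real. a * exp (x * k) + b * exp (x * l) + d)"
proof (rule f''_ge0_imp_convex[OF assms(1)])
  show "DERIV (\<lambda>x. a * exp (x * k) + b * exp (x * l) + d) x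
        :> a * (exp (x * k) * k) + b * (exp (x * l) * l)" for x
    by (auto intro!: derivative_eq_intros)
  show "DERIV (\<lambda>x. a * (exp (x * k) * k) + b * (exp (x * l) * l)) x
        :> a * (exp (x * k) * k * k) + b * (exp (x * l) * l * l)" for x
    by (auto intro!: derivative_eq_intros)
  show "0 \<le> a * (exp (x * k) * k * k) + b * (exp (x * l) * l * l)" for x
    using assms by (simp add: mult.assoc)
qed

text \<open>The parabola has the values of \<open>c powr e\<close> at both ends and slope \<open>l\<close> at \<open>0\<close>; the third condition
  compares the slopes at \<open>1\<close>.\<close>

lemma powr_quadratic_minorant:
  fixes c l e :: real
  assumes c: "0 < c" and l: "l \<le> ln c" and r: "c * ln c + l + 2 - 2 * c \<le> 0"
    and e: "0 \<le> e" "e \<le> 1"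
  shows "1 + l * e + (c - 1 - l) * e\<^sup>2 \<le> c powr e"
proof -
  let ?h = "\<lambda>e. exp (e * ln c) - 1 - l * e - (c - 1 - l) * e\<^sup>2"
  let ?h' = "\<lambda>e. exp (e * ln c) * ln c - l - (c - 1 - l) * (2 * e)"
  let ?K = "\<lambda>e. (ln c)\<^sup>2 * exp (e * ln c) + 0 * exp (e * 0) + - (2 * (c - 1 - l))"
  have "0 \<le> ?h e"
  proof (rule nonneg_of_convex_second_derivative[of ?h ?h' "\<lambda>_. 1" ?K])
    show "DERIV ?h x :> ?h' x" for x by (auto intro!: derivative_eq_intros)
    show "DERIV ?h' x :> 1 * ?K x" for x
      by (auto intro!: derivative_eq_intros simp: power2_eq_square)
    show "convex_on {0..1} ?K" by (intro convex_on_exp_sum) auto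
    show "?h' 1 \<le> 0" using r c by (simp add: algebra_simps)
  qed (use c l e in auto)
  then show ?thesis using c by (simp add: powr_def mult.commute)
qed

text \<open>The value of the linear programming bound minus that of the bi-pyramid, times \<open>q\<close>. It vanishes
  for \<open>q = 0\<close> and \<open>q = 1\<close>, whatever the constants are. Its second derivative is
  \<open>(1 + u)\<^sup>q\<close> times a convex function, so the slopes at the two ends decide.\<close>

lemma exp_ratio_nonneg:
  fixes c u q :: real
  assumes c: "0 \<le> c" and u: "0 < u" and q: "0 \<le> q" "q \<le> 1"
    and l0: "0 \<le> c * (u - ln (1 + u)) - 5/2 + 3 * ln (3/2) + ln 2"
    and l1: "c * (u - (1 + u) * ln (1 + u)) - 5/2 + 9/2 * ln (3/2) + 2 * ln 2 \<le> 0"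
  shows "0 \<le> c * (u * q + 1 - (1 + u) powr q) - 5/2 * q - 4 + 3 * (3/2) powr q + 2 powr q"
proof -
  define L where "L = ln (1 + u)"
  define a where "a = ln (3/2::real)"
  define b where "b = ln (2::real)"
  let ?h = "\<lambda>q. c * (u * q + 1 - exp (q * L)) - 5/2 * q - 4 + 3 * exp (q * a) + exp (q * b)"
  let ?h' = "\<lambda>q. c * (u - exp (q * L) * L) - 5/2 + 3 * (exp (q * a) * a) + exp (q * b) * b"
  let ?K = "\<lambda>q. 3 * a\<^sup>2 * exp (q * (a - L)) + b\<^sup>2 * exp (q * (b - L)) + - (c * L\<^sup>2)"
  have ex: "exp L = 1 + u" "exp a = 3/2" "exp b = 2" using u by (simp_all add: L_def a_def b_def)
  have "0 \<le> ?h q"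
  proof (rule nonneg_of_convex_second_derivative[of ?h ?h' "\<lambda>q. exp (q * L)" ?K])
    show "DERIV ?h x :> ?h' x" for x by (auto intro!: derivative_eq_intros)
    have e: "exp (x * L) * exp (x * (k - L)) = exp (x * k)" for x k
      by (simp add: exp_add[symmetric] algebra_simps)
    have K: "exp (x * L) * ?K x = 3 * a\<^sup>2 * exp (x * a)
        + b\<^sup>2 * exp (x * b) - c * L\<^sup>2 * exp (x * L)" for x
    proof -
      have "p * (3 * a\<^sup>2 * r + b\<^sup>2 * t + - (c * L\<^sup>2)) = 3 * a\<^sup>2 * (p * r)
        + b\<^sup>2 * (p * t) - c * L\<^sup>2 * p"
        for p r t :: real by algebra
      from this[of "exp (x * L)" "exp (x * (a - L))" "exp (x * (b - L))"] show ?thesis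
        unfolding e .
    qed
    show "DERIV ?h' x :> exp (x * L) * ?K x" for x
      unfolding K by (auto intro!: derivative_eq_intros simp: power2_eq_square)
    show "convex_on {0..1} ?K" by (intro convex_on_exp_sum) auto
    show "?h 1 = 0" by (simp add: ex algebra_simps)
    show "?h' 1 \<le> 0" using l1 unfolding L_def[symmetric] a_def[symmetric] b_def[symmetric]
      by (simp add: ex algebra_simps)
    show "0 \<le> ?h' 0" using l0 unfolding L_def[symmetric] a_def[symmetric] b_def[symmetric] by simp
  qed (use q in auto)
  then show ?thesis using u by (simp add: powr_def L_def a_def b_def)
qed

text \<open>The linear bound almost touches the quadratic one, at a point close to \<open>e = 1/3\<close>.\<close>

lemma beta_bounds:
  fixes e :: real
  assumes e: "0 \<le> e" "e \<le> 1"
  shows "1 - 811/2000 * e + (811/2000 - 1/3) * e\<^sup>2 \<le> (2/3) powr e"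
    "9919/10000 * (1 - e) + 6346/10000 * e \<le> (2/3) powr e"
proof -
  have l: "ln (2/3::real) = - ln (3/2)" using ln_div[of 2 "3::real"] ln_div[of 3 "2::real"] by simp
  show 1: "1 - 811/2000 * e + (811/2000 - 1/3) * e\<^sup>2 \<le> (2/3) powr e"
    using powr_quadratic_minorant[of "2/3" "- 811/2000" e] ln_bounds(2) e by (simp add: l)
  \<comment> \<open>\<open>167/500\<close> is close to the double zero of the difference\<close>
  have "0 \<le> e\<^sup>2 - 2 * (167/500) * e + (167/500)\<^sup>2"
    using zero_le_power2[of "e - 167/500"] by (simp add: power2_diff algebra_simps)
  moreover have "(167/500)\<^sup>2 = (27889/250000::real)" by (simp add: power2_eq_square)
  ultimately have "9919/10000 * (1 - e) + 6346/10000 * e \<le> 1 - 811/2000 * e + (811/2000 - 1/3) * e\<^sup>2"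
    using e by argo
  with 1 show "9919/10000 * (1 - e) + 6346/10000 * e \<le> (2/3) powr e" by linarith
qed

lemma gamma_bounds:
  fixes e :: real
  assumes e: "0 \<le> e" "e \<le> 1"
  shows "1 - 1733/2500 * e + (1733/2500 - 1/2) * e\<^sup>2 \<le> (1/2) powr e"
    "978/1000 * (1 - e) + 414/1000 * e \<le> (1/2) powr e"
proof -
  have l: "ln (1/2::real) = - ln 2" by (simp add: ln_div)
  show 1: "1 - 1733/2500 * e + (1733/2500 - 1/2) * e\<^sup>2 \<le> (1/2) powr e"
    using powr_quadratic_minorant[of "1/2" "- 1733/2500" e] ln_bounds(1) e by (simp add: l)
  \<comment> \<open>\<open>209/625\<close> is close to the double zero of the difference\<close>
  have "0 \<le> e\<^sup>2 - 2 * (209/625) * e + (209/625)\<^sup>2"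
    using zero_le_power2[of "e - 209/625"] by (simp add: power2_diff algebra_simps)
  moreover have "(209/625)\<^sup>2 = (43681/390625::real)" by (simp add: power2_eq_square)
  ultimately have "978/1000 * (1 - e) + 414/1000 * e \<le> 1 - 1733/2500 * e + (1733/2500 - 1/2) * e\<^sup>2"
    using e by argo
  with 1 show "978/1000 * (1 - e) + 414/1000 * e \<le> (1/2) powr e" by linarith
qed

text \<open>Here \<open>c\<close> is the coefficient of \<open>phi_quadratic_interpolation\<close>. If \<open>P\<close> and \<open>C\<close> are such that
  \<open>P\<close> is at most the sum of the squared scalar products plus \<open>C\<close> times the squared length of the sum of the
  points, then the last two conclusions make the linear programming bound beat the bi-pyramid.\<close>

lemma quadratic_coefficient_bounds:
  fixes q u P C :: real
  assumes q: "0 < q" "q < 1" and u: "0 < u" and P: "0 \<le> P" and C: "0 \<le> C"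
    and C': "C * (u - ln (1 + u)) \<le> u\<^sup>2 / 2"
    and l0: "0 \<le> P * (u - ln (1 + u)) + u\<^sup>2 * (- 5/2 + 3 * ln (3/2) + ln 2)"
    and l1: "P * (u - (1 + u) * ln (1 + u)) + u\<^sup>2 * (- 5/2 + 9/2 * ln (3/2) + 2 * ln 2) \<le> 0"
  defines "c \<equiv> (phi q (- u) + u) / u\<^sup>2"
  shows "0 < c" "C * c \<le> 1/2" "5/2 + 3 * phi q (- (1/2)) + phi q (- 1) \<le> c * P"
proof -
  have u2: "0 < u\<^sup>2" using u by simp
  have "0 < (1 - q) * (u - ln (1 + u))"
    using q u ln_add_one_self_less_self[of u] by simp
  then show "0 < c"
    using phi_chord[OF q, of u] u by (simp add: c_def)
  have "c \<le> (u - ln (1 + u)) / u\<^sup>2"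
    unfolding c_def using phi_le_ln[OF q(1), of u] u by (intro divide_right_mono) auto
  then have "C * c \<le> C * ((u - ln (1 + u)) / u\<^sup>2)" using C by (rule mult_left_mono)
  also have "\<dots> \<le> 1/2" using C' u2 by (simp add: field_simps)
  finally show "C * c \<le> 1/2" .
  have "0 \<le> (P/u\<^sup>2) * (u * q + 1 - (1 + u) powr q) - 5/2 * q - 4 + 3 * (3/2) powr q + 2 powr q"
  proof (rule exp_ratio_nonneg)
    have "P / u\<^sup>2 * (u - ln (1 + u)) - 5/2 + 3 * ln (3/2) + ln 2
      = (P * (u - ln (1 + u)) + u\<^sup>2 * (- 5/2 + 3 * ln (3/2) + ln 2)) / u\<^sup>2"
      using u2 by (simp add: add_divide_distrib)
    then show "0 \<le> P / u\<^sup>2 * (u - ln (1 + u)) - 5/2 + 3 * ln (3/2) + ln 2"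
      using l0 by simp
    have "P / u\<^sup>2 * (u - (1 + u) * ln (1 + u)) - 5/2 + 9/2 * ln (3/2) + 2 * ln 2
      = (P * (u - (1 + u) * ln (1 + u)) + u\<^sup>2 * (- 5/2 + 9/2 * ln (3/2) + 2 * ln 2)) / u\<^sup>2"
      using u2 by (simp add: add_divide_distrib)
    then show "P / u\<^sup>2 * (u - (1 + u) * ln (1 + u)) - 5/2 + 9/2 * ln (3/2) + 2 * ln 2 \<le> 0"
      using l1 by (simp add: divide_nonpos_nonneg)
  qed (use u q P in auto)
  then have "5/2 * q + 3 * (1 - (3/2) powr q) + (1 - 2 powr q) \<le> P / u\<^sup>2 * (1 - (1 + u) powr q + u * q)"
    by (simp add: algebra_simps)
  then have "(5/2 * q + 3 * (1 - (3/2) powr q) + (1 - 2 powr q)) / q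
      \<le> (P / u\<^sup>2 * (1 - (1 + u) powr q + u * q)) / q"
    using q by (intro divide_right_mono) auto
  also have "(P / u\<^sup>2 * (1 - (1 + u) powr q + u * q)) / q = c * P"
    using q u by (simp add: c_def phi_def field_simps)
  finally show "5/2 + 3 * phi q (- (1/2)) + phi q (- 1) \<le> c * P"
    using q by (simp add: phi_def add_divide_distrib diff_divide_distrib)
qed

text \<open>The values of \<open>u\<close> are \<open>1 - 2 * \<mu>\<^sup>2\<close> at the lower ends \<open>1/9\<close>, \<open>1/8\<close>, \<open>1/6\<close>, \<open>1/5\<close>, \<open>2/9\<close> of five ranges of
  \<open>\<mu>\<^sup>2\<close>. In the first four \<open>P\<close> and \<open>C\<close> are the constants of \<open>product_squares_gt\<close>; the last \<open>P\<close> is slightly below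
  \<open>5/3\<close>, the smallest possible sum of squares of any five unit vectors.\<close>

lemma quadratic_coefficient_bounds_pieces:
  fixes q :: real
  assumes q: "0 < q" "q < 1"
    and mem: "(u, P, C) \<in> {(7/9::real, 353/200::real, 149/100::real), (3/4, 349/200, 147/100), (2/3, 1711/1000, 71/50),
      (3/5, 421/250, 69/50), (5/9, 833/500, 0)}"
  shows "0 < (phi q (- u) + u) / u\<^sup>2" "C * ((phi q (- u) + u) / u\<^sup>2) \<le> 1/2"
    "5/2 + 3 * phi q (- (1/2)) + phi q (- 1) \<le> (phi q (- u) + u) / u\<^sup>2 * P"
proof -
  have bnds: "69314/100000 \<le> ln (2::real)" "ln (2::real) \<le> 69315/100000" "40546/100000 \<le> ln (3/2::real)" "ln (3/2::real) \<le> 40547/100000"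
    using ln_bounds(1,2) by simp_all
  consider "u = 7/9" "P = 353/200" "C = 149/100" | "u = 3/4" "P = 349/200" "C = 147/100" | "u = 2/3" "P = 1711/1000" "C = 71/50" | "u = 3/5" "P = 421/250" "C = 69/50" | "u = 5/9" "P = 833/500" "C = 0"
    using mem by auto
  then have *: "0 < u \<and> 0 \<le> P \<and> 0 \<le> C \<and> C * (u - ln (1 + u)) \<le> u\<^sup>2 / 2
    \<and> 0 \<le> P * (u - ln (1 + u)) + u\<^sup>2 * (- 5/2 + 3 * ln (3/2) + ln 2)
    \<and> P * (u - (1 + u) * ln (1 + u)) + u\<^sup>2 * (- 5/2 + 9/2 * ln (3/2) + 2 * ln 2) \<le> 0"
  proof cases
    case 1
    then have e: "1 + u = 16/9" by simp
    show ?thesis using bnds ln_bounds(4) unfolding e unfolding 1 atLeastAtMost_iff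
      by (simp only: power2_eq_square) (elim conjE, intro conjI; argo)
  next
    case 2
    then have e: "1 + u = 7/4" by simp
    show ?thesis using bnds ln_bounds(5) unfolding e unfolding 2 atLeastAtMost_iff
      by (simp only: power2_eq_square) (elim conjE, intro conjI; argo)
  next
    case 3
    then have e: "1 + u = 5/3" by simp
    show ?thesis using bnds ln_bounds(6) unfolding e unfolding 3 atLeastAtMost_iff
      by (simp only: power2_eq_square) (elim conjE, intro conjI; argo)
  next
    case 4
    then have e: "1 + u = 8/5" by simp
    show ?thesis using bnds ln_bounds(7) unfolding e unfolding 4 atLeastAtMost_iff
      by (simp only: power2_eq_square) (elim conjE, intro conjI; argo)
  next
    case 5
    then have e: "1 + u = 14/9" by simp
    show ?thesis using bnds ln_bounds(8) unfolding e unfolding 5 atLeastAtMost_iff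
      by (simp only: power2_eq_square) (elim conjE, intro conjI; argo)
  qed
  show "0 < (phi q (- u) + u) / u\<^sup>2"
    using * by (elim conjE) (rule quadratic_coefficient_bounds(1)[OF q, of u P C]; assumption)
  show "C * ((phi q (- u) + u) / u\<^sup>2) \<le> 1/2"
    using * by (elim conjE) (rule quadratic_coefficient_bounds(2)[OF q, of u P C]; assumption)
  show "5/2 + 3 * phi q (- (1/2)) + phi q (- 1) \<le> (phi q (- u) + u) / u\<^sup>2 * P"
    using * by (elim conjE) (rule quadratic_coefficient_bounds(3)[OF q, of u P C]; assumption)
qed

text \<open>Moves the expansion point of \<open>phi q\<close> from \<open>1 - c\<close> to \<open>0\<close>.\<close>

lemma phi_rescale:
  assumes "0 < q" "0 \<le> c" "0 \<le> 1 - t"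
  shows "phi q (1 - c * (1 - t)) = phi q (1 - c) + c powr q * phi q t"
proof -
  have "(c * (1 - t)) powr q = c powr q * (1 - t) powr q" using assms by (simp add: powr_mult)
  then show ?thesis using assms(1) by (simp add: phi_def diff_divide_distrib right_diff_distrib)
qed

section \<open>Three unit vectors in coordinates adapted to a fixed axis\<close>

text \<open>The \<open>i\<close>-th vector has horizontal coordinates \<open>Xi\<close>, \<open>Yi\<close> and height \<open>zi\<close>. In the application the
  first axis carries the midpoint of the farthest pair and the third axis its difference.\<close>

locale three_unit_vectors =
  fixes X1 X2 X3 Y1 Y2 Y3 z1 z2 z3 :: real
  assumes unit: "X1\<^sup>2 + Y1\<^sup>2 + z1\<^sup>2 = 1" "X2\<^sup>2 + Y2\<^sup>2 + z2\<^sup>2 = 1" "X3\<^sup>2 + Y3\<^sup>2 + z3\<^sup>2 = 1"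
begin

definition W1 :: real where "W1 = X1 + X2 + X3"
definition W2 :: real where "W2 = Y1 + Y2 + Y3"
definition Z :: real where "Z = z1 + z2 + z3"
definition zeta :: real where "zeta = z1\<^sup>2 + z2\<^sup>2 + z3\<^sup>2"
definition w :: real where "w = sqrt (W1\<^sup>2 + W2\<^sup>2)"

text \<open>The scalar products in the bi-pyramid are \<open>- 1/2\<close>, so the \<open>ui\<close> are the deviations from it.\<close>

definition u1 :: real where "u1 = 1/2 + (X2 * X3 + Y2 * Y3 + z2 * z3)"
definition u2 :: real where "u2 = 1/2 + (X1 * X3 + Y1 * Y3 + z1 * z3)"
definition u3 :: real where "u3 = 1/2 + (X1 * X2 + Y1 * Y2 + z1 * z2)"

text \<open>In the limit \<open>zeta = 0\<close> this is a lower bound, in terms of \<open>w\<close>, for the second moment of three planar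
  unit vectors with sum of length \<open>w\<close> in the direction of that sum.\<close>

definition A :: real where "A = (3 + w\<^sup>2)/2 - w - (3 - w) * zeta/2 - w * zeta\<^sup>2/6"

lemma w_nonneg: "0 \<le> w" and w_squared: "w\<^sup>2 = W1\<^sup>2 + W2\<^sup>2" and zeta_nonneg: "0 \<le> zeta"
  by (simp_all add: w_def zeta_def)

lemma horizontal_sum_squares:
  "(X1\<^sup>2 + Y1\<^sup>2) + (X2\<^sup>2 + Y2\<^sup>2) + (X3\<^sup>2 + Y3\<^sup>2) = 3 - zeta"
  using unit by (simp add: zeta_def)

text \<open>For planar unit vectors \<open>a * b + a * c + b * c = a * b * c * cnj (a + b + c)\<close>. In general the
  difference is a sum of terms with factors \<open>1 - (cmod a)\<^sup>2 = z1\<^sup>2\<close> and so at most \<open>zeta\<close>, while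
  \<open>cmod (a * b * c)\<close> is at most \<open>1 - zeta/2 + zeta\<^sup>2/6\<close>, because its square is the product of the \<open>1 - zi\<^sup>2\<close>.\<close>

lemma norm_pair_products_le:
  fixes a b c :: complex
  defines "a \<equiv> Complex X1 Y1" and "b \<equiv> Complex X2 Y2" and "c \<equiv> Complex X3 Y3"
  shows "cmod (a * b + a * c + b * c) \<le> (1 - zeta/2 + zeta\<^sup>2/6) * w + zeta"
proof -
  have na: "(cmod a)\<^sup>2 = 1 - z1\<^sup>2" and nb: "(cmod b)\<^sup>2 = 1 - z2\<^sup>2" and nc: "(cmod c)\<^sup>2 = 1 - z3\<^sup>2"
    using unit by (simp_all add: a_def b_def c_def cmod_power2)
  have ca: "a * cnj a = of_real (1 - z1\<^sup>2)" and cb: "b * cnj b = of_real (1 - z2\<^sup>2)"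
    and cc: "c * cnj c = of_real (1 - z3\<^sup>2)"
    using na nb nc by (metis complex_norm_square)+
  have le: "cmod a \<le> 1" "cmod b \<le> 1" "cmod c \<le> 1"
    using na nb nc by (simp_all add: power2_le_imp_le[of _ 1])
  have wn: "cmod (a + b + c) = w"
    by (simp add: a_def b_def c_def w_def W1_def W2_def cmod_def)
  define r where "r = b * c * of_real (z1\<^sup>2) + a * c * of_real (z2\<^sup>2) + a * b * of_real (z3\<^sup>2)"
  have "a * b * c * cnj (a + b + c) = b * c * (a * cnj a) + a * c * (b * cnj b) + a * b * (c * cnj c)"
    by (simp add: algebra_simps)
  also have "\<dots> = a * b + a * c + b * c - r"
    unfolding ca cb cc r_def by (simp add: algebra_simps)
  finally have e: "a * b + a * c + b * c = a * b * c * cnj (a + b + c) + r" by simp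
  have bc: "cmod b * cmod c \<le> 1" "cmod a * cmod c \<le> 1" "cmod a * cmod b \<le> 1"
    using le by (auto intro: mult_le_one)
  have "cmod r \<le> cmod b * cmod c * z1\<^sup>2 + cmod a * cmod c * z2\<^sup>2 + cmod a * cmod b * z3\<^sup>2"
    unfolding r_def by (intro order_trans[OF norm_triangle_ineq] add_mono) (simp_all add: norm_mult norm_power)
  also have "\<dots> \<le> 1 * z1\<^sup>2 + 1 * z2\<^sup>2 + 1 * z3\<^sup>2"
    using bc by (intro add_mono mult_right_mono) auto
  finally have r: "cmod r \<le> zeta" by (simp add: zeta_def)
  have "cmod a * cmod b * cmod c \<le> 1 - zeta/2 + zeta\<^sup>2/6"
  proof (rule power2_le_imp_le)
    have p: "0 \<le> 1 - z1\<^sup>2" "0 \<le> 1 - z2\<^sup>2" "0 \<le> 1 - z3\<^sup>2"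
      using na nb nc by (metis zero_le_power2)+
    have "(1 - x) * (1 - y) * (1 - t) \<le> (1 - (x + y + t)/2 + (x + y + t)\<^sup>2/6)\<^sup>2"
      if "0 \<le> x" "0 \<le> y" "0 \<le> t" for x y t :: real
    proof -
      have "(1 - (x + y + t)/2 + (x + y + t)\<^sup>2/6)\<^sup>2 - (1 - x) * (1 - y) * (1 - t)
        = (x + y + t)\<^sup>2 * ((x + y + t)/6 - 1/2)\<^sup>2 + x * y * t
          + ((x - y)\<^sup>2 + (y - t)\<^sup>2 + (x - t)\<^sup>2)/6"
        by (simp add: power2_eq_square field_simps)
      also have "\<dots> \<ge> 0" using that by (intro add_nonneg_nonneg mult_nonneg_nonneg) auto
      finally show ?thesis by simp
    qed
    then show "(cmod a * cmod b * cmod c)\<^sup>2 \<le> (1 - zeta/2 + zeta\<^sup>2/6)\<^sup>2"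
      unfolding power_mult_distrib na nb nc zeta_def by simp
    have "1 - zeta/2 + zeta\<^sup>2/6 = (zeta - 3/2)\<^sup>2/6 + 5/8"
      by (simp add: power2_eq_square field_simps)
    then show "0 \<le> 1 - zeta/2 + zeta\<^sup>2/6" by simp
  qed
  then have "cmod (a * b * c * cnj (a + b + c)) \<le> (1 - zeta/2 + zeta\<^sup>2/6) * w"
    unfolding norm_mult complex_mod_cnj wn using w_nonneg by (intro mult_right_mono) auto
  then show ?thesis
    unfolding e using r norm_triangle_ineq[of "a * b * c * cnj (a + b + c)" r] by linarith
qed

text \<open>For complex numbers, \<open>2 * (Re a)\<^sup>2 = (cmod a)\<^sup>2 + Re (a\<^sup>2)\<close>. Thus the right-hand side is governed by
  the sum of the squares \<open>a\<^sup>2 + b\<^sup>2 + c\<^sup>2\<close>, that is, by \<open>(a + b + c)\<^sup>2\<close> minus twice the pair products of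
  \<open>norm_pair_products_le\<close>. The term with \<open>W2\<close> is the price for measuring along the first
  axis and not along the direction of the sum; \<open>tilt_absorption\<close> pays it.\<close>

lemma directional_second_moment:
  assumes "0 \<le> a" "0 \<le> b"
  shows "(a + b * w\<^sup>2) * A - a * W2\<^sup>2
    \<le> a * (X1\<^sup>2 + X2\<^sup>2 + X3\<^sup>2)
      + b * ((W1 * X1 + W2 * Y1)\<^sup>2 + (W1 * X2 + W2 * Y2)\<^sup>2 + (W1 * X3 + W2 * Y3)\<^sup>2)"
proof -
  define e where "e = Complex X1 Y1 * Complex X2 Y2 + Complex X1 Y1 * Complex X3 Y3
    + Complex X2 Y2 * Complex X3 Y3"
  define c where "c = of_real a + of_real b * cnj ((Complex W1 W2)\<^sup>2)"
  have "cmod c \<le> a + b * w\<^sup>2"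
  proof -
    have "cmod (Complex W1 W2) = w" by (simp add: cmod_def w_def)
    then show ?thesis unfolding c_def
      using norm_triangle_ineq[of "of_real a :: complex" "of_real b * cnj ((Complex W1 W2)\<^sup>2)"] assms
      by (simp add: norm_mult norm_power)
  qed
  then have "cmod c * cmod e \<le> (a + b * w\<^sup>2) * ((1 - zeta/2 + zeta\<^sup>2/6) * w + zeta)"
    unfolding e_def using assms by (intro mult_mono norm_pair_products_le) auto
  then have *: "Re (c * e) \<le> (a + b * w\<^sup>2) * ((1 - zeta/2 + zeta\<^sup>2/6) * w + zeta)"
    using complex_Re_le_cmod[of "c * e"] by (simp add: norm_mult)
  have Re: "Re (c * e) = (a + b * (W1\<^sup>2 - W2\<^sup>2)) * (X1*X2 - Y1*Y2 + X1*X3 - Y1*Y3 + X2*X3 - Y2*Y3)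
     + b * (2 * W1 * W2) * (X1*Y2 + Y1*X2 + X1*Y3 + Y1*X3 + X2*Y3 + Y2*X3)"
    unfolding c_def e_def by (simp add: power2_eq_square algebra_simps)
  have id: "a * (X1\<^sup>2 + X2\<^sup>2 + X3\<^sup>2)
      + b * ((W1 * X1 + W2 * Y1)\<^sup>2 + (W1 * X2 + W2 * Y2)\<^sup>2 + (W1 * X3 + W2 * Y3)\<^sup>2)
    = (a + b * (W1\<^sup>2 + W2\<^sup>2))
        * (((X1\<^sup>2 + Y1\<^sup>2) + (X2\<^sup>2 + Y2\<^sup>2) + (X3\<^sup>2 + Y3\<^sup>2) + (W1\<^sup>2
        + W2\<^sup>2))/2)
      - a * W2\<^sup>2 - Re (c * e)"
    unfolding Re W1_def W2_def by (simp add: power2_eq_square field_simps)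
  have "(a + b * w\<^sup>2) * A = (a + b * w\<^sup>2) * ((3 - zeta + w\<^sup>2)/2)
      - (a + b * w\<^sup>2) * ((1 - zeta/2 + zeta\<^sup>2/6) * w + zeta)"
    by (simp add: A_def field_simps)
  then show ?thesis
    using * unfolding id horizontal_sum_squares w_squared[symmetric] by linarith
qed

text \<open>The heights may correlate with the \<open>qi\<close>. The parameter \<open>tau\<close> distributes the resulting loss
  between the variance of the \<open>qi\<close> and the square of \<open>Z\<close>. Multiplied by \<open>tau * zeta\<close> the difference is a sum
  of squares of centred quantities plus a nonnegative multiple of \<open>Z^4\<close>.\<close>

lemma vertical_splitting:
  fixes q1 q2 q3 tau :: real
  assumes tau: "0 < tau" "tau * zeta \<le> 1"
  shows "(1 - tau * zeta) * (q1\<^sup>2 + q2\<^sup>2 + q3\<^sup>2) + tau * zeta * (q1 + q2 + q3)\<^sup>2/3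
      + 2 * (q1 + q2 + q3) * Z\<^sup>2/3 + Z^4/3 - Z\<^sup>2 * (1/tau - zeta)
    \<le> (q1 + Z * z1)\<^sup>2 + (q2 + Z * z2)\<^sup>2 + (q3 + Z * z3)\<^sup>2" (is "?L \<le> ?R")
proof (cases "zeta = 0")
  case True
  then have "z1 = 0" "z2 = 0" "z3 = 0"
    by (simp_all add: zeta_def add_nonneg_eq_0_iff)
  then have "z1 + z2 + z3 = 0" by simp
  then have "Z = 0" unfolding Z_def .
  then show ?thesis unfolding True by simp
next
  case False
  then have zeta: "0 < zeta" using zeta_nonneg by simp
  define p where "p = (q1 + q2 + q3)/3"
  let ?s = "\<lambda>q z. (tau * zeta * (q - p) + Z * (z - Z/3))\<^sup>2"
  define h where "h = q1\<^sup>2 + q2\<^sup>2 + q3\<^sup>2"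
  define c where "c = q1 * z1 + q2 * z2 + q3 * z3"
  have "(q1 - p)\<^sup>2 + (q2 - p)\<^sup>2 + (q3 - p)\<^sup>2 = h - 3 * p\<^sup>2"
    by (simp add: p_def h_def power2_eq_square field_simps)
  moreover have "(z1 - Z/3)\<^sup>2 + (z2 - Z/3)\<^sup>2 + (z3 - Z/3)\<^sup>2 = zeta - Z\<^sup>2/3"
    unfolding Z_def zeta_def by (simp add: power2_eq_square field_simps)
  moreover have "(q1 - p) * (z1 - Z/3) + (q2 - p) * (z2 - Z/3) + (q3 - p) * (z3 - Z/3) = c - p * Z"
    unfolding Z_def p_def c_def by (simp add: field_simps)
  moreover have "(t * a + y * d)\<^sup>2 + (t * b + y * e)\<^sup>2 + (t * f + y * g)\<^sup>2
    = t\<^sup>2 * (a\<^sup>2 + b\<^sup>2 + f\<^sup>2) + 2 * t * y * (a * d + b * e + f * g) + y\<^sup>2 * (d\<^sup>2 + e\<^sup>2 + g\<^sup>2)"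
    for t a y d b e f g :: real
    by (simp add: power2_eq_square algebra_simps)
  ultimately have s: "?s q1 z1 + ?s q2 z2 + ?s q3 z3
    = (tau * zeta)\<^sup>2 * (h - 3 * p\<^sup>2) + 2 * (tau * zeta) * Z * (c - p * Z) + Z\<^sup>2 * (zeta - Z\<^sup>2/3)"
    by simp
  have R: "?R = h + 2 * Z * c + Z\<^sup>2 * zeta"
    unfolding h_def c_def zeta_def by (simp add: power2_eq_square algebra_simps)
  have L: "?L = (1 - tau * zeta) * h + 3 * (tau * zeta) * p\<^sup>2 + 2 * p * Z\<^sup>2
        + Z^4/3 - Z\<^sup>2 * (1/tau - zeta)"
    unfolding h_def p_def by (simp add: power_divide)
  have "tau * zeta * (?R - ?L) = ?s q1 z1 + ?s q2 z2 + ?s q3 z3 + Z^4 * (1 - tau * zeta)/3"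
    unfolding s R L using tau by (simp add: field_simps power2_eq_square power4_eq_xxxx)
  moreover have "0 \<le> ?s q1 z1 + ?s q2 z2 + ?s q3 z3 + Z^4 * (1 - tau * zeta)/3"
    using tau by (intro add_nonneg_nonneg) auto
  ultimately have "0 \<le> tau * zeta * (?R - ?L)" by simp
  moreover have "0 < tau * zeta" using tau zeta by simp
  ultimately have "0 \<le> ?R - ?L" by (simp only: zero_le_mult_iff) linarith
  then show ?thesis by (simp only: diff_ge_0_iff_ge)
qed

lemma u_sum: "u1 + u2 + u3 = (w\<^sup>2 + Z\<^sup>2)/2"
  and u_dot: "u1 = (w\<^sup>2 + Z\<^sup>2)/2 - (W1 * X1 + W2 * Y1 + Z * z1)"
    "u2 = (w\<^sup>2 + Z\<^sup>2)/2 - (W1 * X2 + W2 * Y2 + Z * z2)"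
    "u3 = (w\<^sup>2 + Z\<^sup>2)/2 - (W1 * X3 + W2 * Y3 + Z * z3)"
  using unit unfolding u1_def u2_def u3_def w_squared W1_def W2_def Z_def
  by (simp_all add: power2_eq_square algebra_simps)

text \<open>The deviations satisfy \<open>u1\<^sup>2 + u2\<^sup>2 + u3\<^sup>2 = T - s^4/4\<close>, where \<open>s\<close> is the length of the sum of the
  three vectors and \<open>T\<close> the sum of their squared scalar products with that sum. Splitting off the heights from \<open>T\<close> leaves
  the planar second moment. All coordinates are gone but \<open>w\<close>, \<open>zeta\<close>, \<open>Z\<close>
  and the defect \<open>W2\<close>.\<close>

lemma second_moment_bound:
  assumes ab: "0 \<le> a" "0 \<le> b" and tau: "0 < tau" "tau * zeta \<le> 1"
  shows "(a + b * (1 - tau * zeta) * w\<^sup>2) * A - a * W2\<^sup>2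
      + b * (tau * zeta * w^4/3 - w^4/4 + w\<^sup>2 * Z\<^sup>2/6 - Z\<^sup>2 * (1/tau - zeta))
    \<le> a * (X1\<^sup>2 + X2\<^sup>2 + X3\<^sup>2) + b * (u1\<^sup>2 + u2\<^sup>2 + u3\<^sup>2)"
proof -
  define q1 where "q1 = W1 * X1 + W2 * Y1"
  define q2 where "q2 = W1 * X2 + W2 * Y2"
  define q3 where "q3 = W1 * X3 + W2 * Y3"
  have qs: "q1 + q2 + q3 = w\<^sup>2"
    unfolding w_squared q1_def q2_def q3_def by (simp add: W1_def W2_def power2_eq_square algebra_simps)
  have Zs: "Z * z1 + Z * z2 + Z * z3 = Z\<^sup>2" by (simp add: Z_def power2_eq_square algebra_simps)
  define s where "s = w\<^sup>2 + Z\<^sup>2"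
  have ts: "(q1 + Z * z1) + (q2 + Z * z2) + (q3 + Z * z3) = s" using qs Zs by (simp add: s_def)
  have usq: "u1\<^sup>2 + u2\<^sup>2 + u3\<^sup>2 = ((q1 + Z * z1)\<^sup>2 + (q2 + Z * z2)\<^sup>2 + (q3
        + Z * z3)\<^sup>2) - s\<^sup>2/4"
  proof -
    have "(s/2 - x)\<^sup>2 + (s/2 - y)\<^sup>2 + (s/2 - t)\<^sup>2 = x\<^sup>2 + y\<^sup>2
        + t\<^sup>2 - s\<^sup>2/4" if "x + y + t = s" for x y t :: real
      unfolding that[symmetric] by (simp add: power2_eq_square field_simps)
    from this[OF ts] show ?thesis unfolding u_dot q1_def q2_def q3_def s_def .
  qed
  have "(1 - tau * zeta) * (q1\<^sup>2 + q2\<^sup>2 + q3\<^sup>2) + (tau * zeta * w^4/3 - w^4/4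
        + w\<^sup>2 * Z\<^sup>2/6 - Z\<^sup>2 * (1/tau - zeta))
     \<le> u1\<^sup>2 + u2\<^sup>2 + u3\<^sup>2"
  proof -
    have squares: "s\<^sup>2 = w^4 + 2 * w\<^sup>2 * Z\<^sup>2 + Z^4" "(w\<^sup>2)\<^sup>2 = w^4"
      unfolding s_def by (simp_all add: power2_eq_square power4_eq_xxxx algebra_simps)
    have 1: "(1 - tau * zeta) * (q1\<^sup>2 + q2\<^sup>2 + q3\<^sup>2) + tau * zeta * w^4/3
      + 2 * w\<^sup>2 * Z\<^sup>2/3 + Z^4/3 - Z\<^sup>2 * (1/tau - zeta) - s\<^sup>2/4 \<le> u1\<^sup>2 + u2\<^sup>2 + u3\<^sup>2"
      unfolding usq using vertical_splitting[OF tau, of q1 q2 q3] unfolding qs squares(2)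
      by (rule diff_right_mono)
    have 2: "t + (m/3 - v/4 + x * y/6 - r) \<le> g"
      if "t + m/3 + 2 * x * y/3 + z/3 - r - k/4 \<le> g" "0 \<le> z" "k = v + 2 * x * y + z"
      for t m x y z r k g v :: real
      using that by argo
    show ?thesis by (rule 2[OF 1 _ squares(1)]) simp
  qed
  from mult_left_mono[OF this ab(2)]
  have 1: "b * (1 - tau * zeta) * (q1\<^sup>2 + q2\<^sup>2 + q3\<^sup>2)
      + b * (tau * zeta * w^4/3 - w^4/4 + w\<^sup>2 * Z\<^sup>2/6 - Z\<^sup>2 * (1/tau - zeta))
     \<le> b * (u1\<^sup>2 + u2\<^sup>2 + u3\<^sup>2)"
    by (simp only: distrib_left mult.assoc)
  have "0 \<le> b * (1 - tau * zeta)" using ab tau by simp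
  from directional_second_moment[OF ab(1) this] 1 show ?thesis
    unfolding q1_def q2_def q3_def by linarith
qed

text \<open>\<open>W2\<close> is large only if the horizontal sum points far away from the negative first axis; but then the
  term with \<open>W1 + w\<close> is large as well, by \<open>W2\<^sup>2 = (w - W1) * (w + W1)\<close>.\<close>

lemma tilt_absorption:
  assumes "0 \<le> a" and "a * w \<le> 2 * c" 
  shows "a * W2\<^sup>2 \<le> 4 * c * (W1 + w)"
proof -
  have "\<bar>W1\<bar> \<le> w" using w_squared w_nonneg by (metis abs_le_square_iff abs_of_nonneg le_add_same_cancel1 zero_le_power2)
  then have p: "0 \<le> W1 + w" by linarith
  have "W2\<^sup>2 = (w - W1) * (w + W1)" using w_squared by (simp add: power2_eq_square algebra_simps)
  also have "\<dots> \<le> (2 * w) * (w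
        + W1)" using p \<open>\<bar>W1\<bar> \<le> w\<close> by (intro mult_right_mono) auto
  finally have "a * W2\<^sup>2 \<le> a * ((2 * w) * (w + W1))" using assms by (intro mult_left_mono) auto
  also have "\<dots> = 2 * (a * w) * (w + W1)" by (simp add: algebra_simps)
  also have "\<dots> \<le> 2 * (2 * c) * (w + W1)" using assms p by (intro mult_right_mono) auto
  finally show ?thesis by (simp add: algebra_simps)
qed

end

section \<open>Polynomial inequalities in the reduced variables\<close>

text \<open>The terms of \<open>second_moment_bound\<close> in \<open>w\<close> and \<open>\<zeta>\<close> after \<open>\<zeta>\<^sup>2\<close> has been replaced by \<open>\<xi>\<close> in
  the part with factor \<open>k\<close> and \<open>\<zeta>\<^sup>3\<close> by zero. With \<open>\<xi>\<close> the value at \<open>\<zeta>\<close> of a tangent of the square function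
  this part is affine in \<open>\<zeta>\<close>.\<close>

definition node_form :: "real \<Rightarrow> real \<Rightarrow> real \<Rightarrow> real \<Rightarrow> real \<Rightarrow> real \<Rightarrow> real" where
  "node_form k a \<tau> \<zeta> \<xi> w =
     k * w\<^sup>2 * ((3/2 - 3/2 * (1 + \<tau>) * \<zeta> + 3/2 * \<tau> * \<xi>)
       + (- 1 + \<zeta>/2 + \<tau> * \<zeta> - \<tau> * \<xi>/2 - \<xi>/6) * w + (1/4 - \<tau> * \<zeta>/6) * w\<^sup>2)
     + a * ((3 + w\<^sup>2)/2 - w - (3 - w) * \<zeta>/2 - w * \<zeta>\<^sup>2/6)"

text \<open>Values at two nodes \<open>l\<close>, \<open>h\<close> control everything between them: the \<open>\<zeta>\<^sup>2\<close> with positive coefficient lies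
  above its tangent at \<open>t\<close>, and the \<open>\<zeta>\<^sup>2\<close> with negative coefficient, multiplied by \<open>a\<close>, below
  its chord.\<close>

lemma node_form_interpolation:
  fixes k a \<tau> \<zeta> l h t w :: real
  assumes "0 \<le> k" "0 \<le> a" "0 \<le> \<tau>" "0 \<le> w" and w: "(\<tau>/2 + 1/6) * w \<le> 3/2 * \<tau>"
    and z: "0 \<le> \<zeta>" "l \<le> \<zeta>" "\<zeta> \<le> h"
  shows "(h - \<zeta>) * node_form k a \<tau> l (2 * t * l - t\<^sup>2) w
        + (\<zeta> - l) * node_form k a \<tau> h (2 * t * h - t\<^sup>2) w
    \<le> (h - l) * ((a + k * (1 - \<tau> * \<zeta>) * w\<^sup>2) * ((3 + w\<^sup>2)/2 - w - (3 - w) * \<zeta>/2 - w * \<zeta>\<^sup>2/6)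
        + k * (\<tau> * \<zeta> * w^4/3 - w^4/4))" (is "?L \<le> ?R")
proof -
  have "?R - ?L = (h - l) * (k * w\<^sup>2 * ((3/2 * \<tau> - (\<tau>/2 + 1/6) * w) * (\<zeta> - t)\<^sup>2
        + \<tau> * w * \<zeta>^3/6))
      + (h - l) * (a * w * ((\<zeta> - l) * (h - \<zeta>))/6)"
    unfolding node_form_def by (simp add: power2_eq_square power3_eq_cube power4_eq_xxxx field_simps)
  also have "\<dots> \<ge> 0"
    using assms by (intro add_nonneg_nonneg mult_nonneg_nonneg divide_nonneg_nonneg) auto
  finally show ?thesis by simp
qed

text \<open>The quartic part is \<open>p2 * (w\<^sup>2 + s * w)\<^sup>2\<close> plus a multiple of \<open>w\<^sup>2\<close>, and the square is at least its
  tangent at \<open>w\<^sup>2 + s * w = \<sigma>\<close>. Then only the discriminant of a quadratic polynomial in \<open>w\<close> matters.\<close>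

lemma quartic_nonneg:
  fixes k p0 p1 p2 s \<sigma> q2 q1 q0 w :: real
  assumes k: "0 \<le> k" and p2: "0 \<le> p2" and s: "p1 = 2 * p2 * s"
    and lead: "0 < q2 + k * (p0 - p2 * s\<^sup>2 + 2 * p2 * \<sigma>)"
    and disc: "(q1 - 2 * k * p2 * s * \<sigma>)\<^sup>2 \<le> 4 * (q2 + k * (p0 - p2 * s\<^sup>2 + 2 * p2 * \<sigma>)) * (q0 - k * p2 * \<sigma>\<^sup>2)"
  shows "0 \<le> k * w\<^sup>2 * (p0 + p1 * w + p2 * w\<^sup>2) + q2 * w\<^sup>2 - q1 * w + q0"
proof -
  define A where "A = q2 + k * (p0 - p2 * s\<^sup>2 + 2 * p2 * \<sigma>)"
  define B where "B = q1 - 2 * k * p2 * s * \<sigma>"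
  define C where "C = q0 - k * p2 * \<sigma>\<^sup>2"
  have "k * w\<^sup>2 * (p0 + p1 * w + p2 * w\<^sup>2) + q2 * w\<^sup>2 - q1 * w + q0
    = k * p2 * (w\<^sup>2 + s * w - \<sigma>)\<^sup>2 + (A * w\<^sup>2 - B * w + C)"
    unfolding A_def B_def C_def s by (simp add: power2_eq_square algebra_simps)
  moreover have "0 \<le> k * p2 * (w\<^sup>2 + s * w - \<sigma>)\<^sup>2" using k p2 by simp
  moreover have "0 \<le> A * w\<^sup>2 - B * w + C"
  proof -
    have "4 * A * (A * w\<^sup>2 - B * w + C) = (2 * A * w - B)\<^sup>2 + (4 * A * C - B\<^sup>2)"
      by (simp add: power2_eq_square algebra_simps)
    also have "\<dots> \<ge> 0" using disc unfolding A_def B_def C_def by simp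
    finally have "0 \<le> 4 * A * (A * w\<^sup>2 - B * w + C)" .
    moreover have "0 < 4 * A" using lead by (simp add: A_def)
    ultimately show ?thesis by (simp only: zero_le_mult_iff) linarith
  qed
  ultimately show ?thesis by linarith
qed

lemma node_nonneg:
  fixes k a \<tau> \<zeta> \<xi> \<sigma> s q2 q1 q0 w A B C :: real
  assumes "0 \<le> k" "\<tau> * \<zeta> \<le> 3/2" "- 1 + \<zeta>/2 + \<tau> * \<zeta> - \<tau> * \<xi>/2 - \<xi>/6 = 2 * (1/4 - \<tau> * \<zeta>/6) * s"
    and "A = q2 + a/2 + k * ((3/2 - 3/2 * (1 + \<tau>) * \<zeta> + 3/2 * \<tau> * \<xi>) - (1/4 - \<tau> * \<zeta>/6) * s\<^sup>2 + 2 * (1/4 - \<tau> * \<zeta>/6) * \<sigma>)"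
    and "B = q1 + a * (1 - \<zeta>/2 + \<zeta>\<^sup>2/6) - 2 * k * (1/4 - \<tau> * \<zeta>/6) * s * \<sigma>"
    and "C = q0 + a * (3/2 - 3/2 * \<zeta>) - k * (1/4 - \<tau> * \<zeta>/6) * \<sigma>\<^sup>2"
    and "0 < A" "B\<^sup>2 \<le> 4 * A * C"
  shows "0 \<le> q2 * w\<^sup>2 - q1 * w + q0 + node_form k a \<tau> \<zeta> \<xi> w"
proof -
  have "0 \<le> k * w\<^sup>2 * ((3/2 - 3/2 * (1 + \<tau>) * \<zeta> + 3/2 * \<tau> * \<xi>)
       + (- 1 + \<zeta>/2 + \<tau> * \<zeta> - \<tau> * \<xi>/2 - \<xi>/6) * w + (1/4 - \<tau> * \<zeta>/6) * w\<^sup>2)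
     + (q2 + a/2) * w\<^sup>2 - (q1 + a * (1 - \<zeta>/2 + \<zeta>\<^sup>2/6)) * w + (q0 + a * (3/2 - 3/2 * \<zeta>))"
    using assms by (intro quartic_nonneg[where s = s and \<sigma> = \<sigma>]) (auto simp: mult.assoc)
  then show ?thesis unfolding node_form_def by (simp add: algebra_simps add_divide_distrib diff_divide_distrib)
qed

text \<open>The coefficient of \<open>u\<^sup>2\<close> when \<open>\<beta> * (8/25 * u\<^sup>2 + 7/75 * u\<^sup>3)\<close> is bounded below by a quadratic
  polynomial touching it at \<open>u = \<mu>\<close> and meeting it at the smallest possible \<open>u = - (1/2 - 2 * \<mu>\<^sup>2)\<close>.\<close>

definition tangent_coeff :: "real \<Rightarrow> real \<Rightarrow> real" where
  "tangent_coeff \<beta> \<mu> = \<beta> * (8/25 + 7/75 * (2 * \<mu> - (1/2 - 2 * \<mu>\<^sup>2)))"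

lemma tangent_coeff_nonneg:
  assumes "0 \<le> \<beta>" "0 \<le> \<mu>"
  shows "0 \<le> tangent_coeff \<beta> \<mu>"
  using assms unfolding tangent_coeff_def by (intro mult_nonneg_nonneg) (simp_all add: algebra_simps)

text \<open>The part affine in \<open>\<zeta>\<close> and quadratic in \<open>w\<close> of the inequality for a nearly antipodal farthest pair. The
  fractions \<open>1/1000\<close> are the slack that settles uniqueness.\<close>

definition antipodal_form :: "real \<Rightarrow> real \<Rightarrow> real \<Rightarrow> real \<Rightarrow> real \<Rightarrow> real \<Rightarrow> real \<Rightarrow> real \<Rightarrow> real" where
  "antipodal_form c \<beta> b g \<gamma> \<mu> \<zeta> w =
     (c - b/2 + 7/150 * \<beta> * (2 * \<mu> * (1/2 - 2 * \<mu>\<^sup>2) - \<mu>\<^sup>2) - 1/1000) * w\<^sup>2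
     - (4 * c * \<mu> + 63/200 * \<mu>^3) * w
     + ((4 * c - 2 * g - 1/1000) * \<mu>\<^sup>2 - 63/200 * \<mu>^3 + \<gamma> * \<mu>^4 - 7/25 * \<beta> * \<mu>\<^sup>2 * (1/2 - 2 * \<mu>\<^sup>2)
        + ((24/25 - 63/50 * \<mu>) * (1 - \<mu>\<^sup>2) - 1/1000) * \<zeta>)"

text \<open>The analogue of \<open>antipodal_form\<close> for the sum of the squared scalar products and \<open>\<mu> > 1/3\<close>. The summand
  \<open>1/10000\<close> makes the inequality strict.\<close>

definition bent_form :: "real \<Rightarrow> real \<Rightarrow> real \<Rightarrow> real \<Rightarrow> real \<Rightarrow> real" where
  "bent_form c P \<mu> \<zeta> w =
     (c - 1/2) * w\<^sup>2 - (4 * c * \<mu>) * w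
     + (4 * c * \<mu>\<^sup>2 + 3/4 + (1 - 2 * \<mu>\<^sup>2)\<^sup>2 - P - 1/10000 + 2 * (1 - \<mu>\<^sup>2) * \<zeta>)"

text \<open>The next fourteen lemmas are instances of \<open>node_nonneg\<close>. In each of them \<open>s\<close> completes the square of
  the quartic part and \<open>\<sigma>\<close> is the value of \<open>w\<^sup>2 + s * w\<close> at \<open>w = 2 * \<mu>\<close>, which holds when the sum of the
  five points vanishes. The leading coefficient, diminished by a positive constant, and the discriminant are
  written in the Bernstein basis of the range of \<open>\<mu>\<close>, where all coefficients are positive. At the node
  \<open>\<zeta> = 0\<close> of the first family the discriminant has the factor \<open>\<mu>\<^sup>2\<close>, because the bi-pyramid has
  \<open>\<mu> = 0\<close> and \<open>\<zeta> = 0\<close> and is an equality case apart from the slack.\<close>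

lemma antipodal_node_0_0:
  fixes \<mu> w :: real
  assumes \<mu>: "0 \<le> \<mu>" "\<mu> \<le> 1/3"
  shows "0 \<le> antipodal_form 1 (9919/10000) (811/2000) (1733/2500) (489/500) \<mu> (0) w
        + node_form (tangent_coeff (9919/10000) \<mu>) (24/25 * \<mu>\<^sup>2) 1 (0) (0) w"
proof -
  define A where "A = 2795429/3000000 - 605059/1500000 * \<mu>
        + 349109/500000 * \<mu>^2 - 69433/375000 * \<mu>^3 + 69433/187500 * \<mu>^4"
  define B where "B = 1093321/375000 * \<mu> + 488947/375000 * \<mu>^2 + 63/200 * \<mu>^3 + 69433/93750 * \<mu>^4"
  define C where "C = 848777/300000 * \<mu>^2 + 139167/125000 * \<mu>^3 + 223051/187500 * \<mu>^4
        + 69433/93750 * \<mu>^5 - 69433/93750 * \<mu>^6"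
  have "A = 781/1000 + (452429 * (1 - 3 * \<mu>)^4 + 4219030 * \<mu> * (1 - 3 * \<mu>)^3
        + 15634758 * \<mu>^2 * (1 - 3 * \<mu>)^2 + 28201606 * \<mu>^3 * (1 - 3 * \<mu>)
        + 22269985 * \<mu>^4) / 3000000"
    unfolding A_def by algebra
  also have "\<dots> > 0"
    using \<mu> by (intro add_pos_nonneg add_nonneg_nonneg mult_nonneg_nonneg divide_nonneg_nonneg zero_le_power) auto
  finally have A: "0 < A" .
  have "4 * A * C - B\<^sup>2 = (2300672729337 * \<mu>^2 * (1 - 3 * \<mu>)^8
        + 46195705119582 * \<mu>^3 * (1 - 3 * \<mu>)^7 + 398218104339176 * \<mu>^4 * (1 - 3 * \<mu>)^6
        + 1911859195113106 * \<mu>^5 * (1 - 3 * \<mu>)^5 + 5529361302406406 * \<mu>^6 * (1 - 3 * \<mu>)^4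
        + 9669525428722114 * \<mu>^7 * (1 - 3 * \<mu>)^3 + 9580977089003512 * \<mu>^8 * (1 - 3 * \<mu>)^2
        + 4396456812911502 * \<mu>^9 * (1 - 3 * \<mu>) + 374343225831137 * \<mu>^10) / 1125000000000"
    unfolding A_def B_def C_def by algebra
  also have "\<dots> \<ge> 0"
    using \<mu> by (intro add_nonneg_nonneg mult_nonneg_nonneg divide_nonneg_nonneg zero_le_power) auto
  finally have D: "B\<^sup>2 \<le> 4 * A * C" by simp
  have powers: "\<mu>^5 = \<mu> * \<mu> * \<mu> * \<mu> * \<mu>" "\<mu>^6 = \<mu> * \<mu> * \<mu> * \<mu> * \<mu> * \<mu>"
    by (simp_all add: eval_nat_numeral)
  show ?thesis
    unfolding antipodal_form_def
    by (rule node_nonneg[where A = A and B = B and C = C and s = "(- 2)" and \<sigma> = "4 * \<mu>\<^sup>2 + 2 * (- 2) * \<mu>"])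
      ((rule A D | (insert \<mu>, simp add: tangent_coeff_nonneg; fail) | (simp add: A_def B_def C_def tangent_coeff_def power2_eq_square power3_eq_cube power4_eq_xxxx powers field_simps; fail))+)
qed

lemma antipodal_node_0_1:
  fixes \<mu> w :: real
  assumes \<mu>: "0 \<le> \<mu>" "\<mu> \<le> 1/3"
  shows "0 \<le> antipodal_form 1 (9919/10000) (811/2000) (1733/2500) (489/500) \<mu> (1/4) w
        + node_form (tangent_coeff (9919/10000) \<mu>) (24/25 * \<mu>\<^sup>2) 1 (1/4) (0) w"
proof -
  define A where "A = 13960037/16000000 - 962143/4000000 * \<mu>
        + 25423499/36000000 * \<mu>^2 - 486031/4500000 * \<mu>^3 + 69433/225000 * \<mu>^4"
  define B where "B = 2793321/800000 * \<mu> + 35419/30000 * \<mu>^2 + 258433/600000 * \<mu>^3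
        + 69433/150000 * \<mu>^4"
  define C where "C = 959/4000 - 63/200 * \<mu> + 11221541/4000000 * \<mu>^2 + 605059/600000 * \<mu>^3
        + 10875071/9000000 * \<mu>^4 + 69433/225000 * \<mu>^5 - 69433/112500 * \<mu>^6"
  have "A = 19/25 + (16200333 * (1 - 3 * \<mu>)^4 + 159766848 * \<mu> * (1 - 3 * \<mu>)^3
        + 664777646 * \<mu>^2 * (1 - 3 * \<mu>)^2 + 1409043952 * \<mu>^3 * (1 - 3 * \<mu>)
        + 1290048085 * \<mu>^4) / 144000000"
    unfolding A_def by algebra
  also have "\<dots> > 0"
    using \<mu> by (intro add_pos_nonneg add_nonneg_nonneg mult_nonneg_nonneg divide_nonneg_nonneg zero_le_power) auto
  finally have A: "0 < A" .
  have "4 * A * C - B\<^sup>2 = (135550214265375 * (1 - 3 * \<mu>)^10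
        + 3851042102885250 * \<mu> * (1 - 3 * \<mu>)^9 + 48850182375000669 * \<mu>^2 * (1 - 3 * \<mu>)^8
        + 362485735477078707 * \<mu>^3 * (1 - 3 * \<mu>)^7
        + 1731575536549872381 * \<mu>^4 * (1 - 3 * \<mu>)^6
        + 5516348477440136163 * \<mu>^5 * (1 - 3 * \<mu>)^5
        + 11711279699050368413 * \<mu>^6 * (1 - 3 * \<mu>)^4
        + 15972678759313170137 * \<mu>^7 * (1 - 3 * \<mu>)^3
        + 12709229303492260864 * \<mu>^8 * (1 - 3 * \<mu>)^2
        + 4525606881145043215 * \<mu>^9 * (1 - 3 * \<mu>) + 42632282300527850 * \<mu>^10) / 162000000000000"
    unfolding A_def B_def C_def by algebra
  also have "\<dots> \<ge> 0"
    using \<mu> by (intro add_nonneg_nonneg mult_nonneg_nonneg divide_nonneg_nonneg zero_le_power) auto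
  finally have D: "B\<^sup>2 \<le> 4 * A * C" by simp
  have powers: "\<mu>^5 = \<mu> * \<mu> * \<mu> * \<mu> * \<mu>" "\<mu>^6 = \<mu> * \<mu> * \<mu> * \<mu> * \<mu> * \<mu>"
    by (simp_all add: eval_nat_numeral)
  show ?thesis
    unfolding antipodal_form_def
    by (rule node_nonneg[where A = A and B = B and C = C and s = "(- 3/2)" and \<sigma> = "4 * \<mu>\<^sup>2 + 2 * (- 3/2) * \<mu>"])
      ((rule A D | (insert \<mu>, simp add: tangent_coeff_nonneg; fail) | (simp add: A_def B_def C_def tangent_coeff_def power2_eq_square power3_eq_cube power4_eq_xxxx powers field_simps; fail))+)
qed

lemma antipodal_node_0_2:
  fixes \<mu> w :: real
  assumes \<mu>: "0 \<le> \<mu>" "\<mu> \<le> 1/3"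
  shows "0 \<le> antipodal_form 1 (9919/10000) (811/2000) (1733/2500) (489/500) \<mu> (1) w
        + node_form (tangent_coeff (9919/10000) \<mu>) (24/25 * \<mu>\<^sup>2) 1 (1) (3/4) w"
proof -
  define A where "A = 2778321/4000000 - 69433/3000000 * \<mu>
        + 4905221/9000000 * \<mu>^2 - 69433/1125000 * \<mu>^3 + 69433/562500 * \<mu>^4"
  define B where "B = 4 * \<mu> + 16/25 * \<mu>^2 + 63/200 * \<mu>^3"
  define C where "C = 959/1000 - 63/50 * \<mu> + 756867/500000 * \<mu>^2 + 189/200 * \<mu>^3
        + 329617/281250 * \<mu>^4 - 69433/281250 * \<mu>^5 - 69433/281250 * \<mu>^6"
  have "A = 623/1000 + (2576889 * (1 - 3 * \<mu>)^4 + 30089472 * \<mu> * (1 - 3 * \<mu>)^3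
        + 151274126 * \<mu>^2 * (1 - 3 * \<mu>)^2 + 371311168 * \<mu>^3 * (1 - 3 * \<mu>)
        + 360597817 * \<mu>^4) / 36000000"
    unfolding A_def by algebra
  also have "\<dots> > 0"
    using \<mu> by (intro add_pos_nonneg add_nonneg_nonneg mult_nonneg_nonneg divide_nonneg_nonneg zero_le_power) auto
  finally have A: "0 < A" .
  have "4 * A * C - B\<^sup>2 = (107908598479500 * (1 - 3 * \<mu>)^10
        + 3091884576417000 * \<mu> * (1 - 3 * \<mu>)^9 + 39389627703188367 * \<mu>^2 * (1 - 3 * \<mu>)^8
        + 292976780082604920 * \<mu>^3 * (1 - 3 * \<mu>)^7
        + 1403370268685815896 * \<mu>^4 * (1 - 3 * \<mu>)^6
        + 4497282042248348880 * \<mu>^5 * (1 - 3 * \<mu>)^5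
        + 9675800509288521230 * \<mu>^6 * (1 - 3 * \<mu>)^4
        + 13583924621074836440 * \<mu>^7 * (1 - 3 * \<mu>)^3
        + 11543583544817406436 * \<mu>^8 * (1 - 3 * \<mu>)^2
        + 4963988287383699448 * \<mu>^9 * (1 - 3 * \<mu>) + 598981899227609243 * \<mu>^10) / 40500000000000"
    unfolding A_def B_def C_def by algebra
  also have "\<dots> \<ge> 0"
    using \<mu> by (intro add_nonneg_nonneg mult_nonneg_nonneg divide_nonneg_nonneg zero_le_power) auto
  finally have D: "B\<^sup>2 \<le> 4 * A * C" by simp
  have powers: "\<mu>^5 = \<mu> * \<mu> * \<mu> * \<mu> * \<mu>" "\<mu>^6 = \<mu> * \<mu> * \<mu> * \<mu> * \<mu> * \<mu>"
    by (simp_all add: eval_nat_numeral)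
  show ?thesis
    unfolding antipodal_form_def
    by (rule node_nonneg[where A = A and B = B and C = C and s = "0" and \<sigma> = "4 * \<mu>\<^sup>2 + 2 * 0 * \<mu>"])
      ((rule A D | (insert \<mu>, simp add: tangent_coeff_nonneg; fail) | (simp add: A_def B_def C_def tangent_coeff_def power2_eq_square power3_eq_cube power4_eq_xxxx powers field_simps; fail))+)
qed

lemma antipodal_node_1_0:
  fixes \<mu> w :: real
  assumes \<mu>: "0 \<le> \<mu>" "\<mu> \<le> 1/3"
  shows "0 \<le> antipodal_form (1/2) (3173/5000) (1/3) (1/2) (207/500) \<mu> (0) w
        + node_form (tangent_coeff (3173/5000) \<mu>) (24/25 * \<mu>\<^sup>2) 1 (0) (0) w"
proof -
  define A where "A = 209531/500000 - 193553/750000 * \<mu>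
        + 154903/250000 * \<mu>^2 - 22211/187500 * \<mu>^3 + 22211/93750 * \<mu>^4"
  define B where "B = 244907/187500 * \<mu> + 221249/187500 * \<mu>^2 + 63/200 * \<mu>^3 + 22211/46875 * \<mu>^4"
  define C where "C = 248449/150000 * \<mu>^2 + 74853/125000 * \<mu>^3 + 103009/187500 * \<mu>^4
        + 22211/46875 * \<mu>^5 - 22211/46875 * \<mu>^6"
  have "A = 87/250 + (106593 * (1 - 3 * \<mu>)^4 + 892010 * \<mu> * (1 - 3 * \<mu>)^3
        + 3201486 * \<mu>^2 * (1 - 3 * \<mu>)^2 + 6459002 * \<mu>^3 * (1 - 3 * \<mu>) + 6369245 * \<mu>^4) / 1500000"
    unfolding A_def by algebra
  also have "\<dots> > 0"
    using \<mu> by (intro add_pos_nonneg add_nonneg_nonneg mult_nonneg_nonneg divide_nonneg_nonneg zero_le_power) auto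
  finally have A: "0 < A" .
  have "4 * A * C - B\<^sup>2 = (301031002093 * \<mu>^2 * (1 - 3 * \<mu>)^8
        + 6159209126748 * \<mu>^3 * (1 - 3 * \<mu>)^7 + 54100244595514 * \<mu>^4 * (1 - 3 * \<mu>)^6
        + 264576107925284 * \<mu>^5 * (1 - 3 * \<mu>)^5 + 778756687831834 * \<mu>^6 * (1 - 3 * \<mu>)^4
        + 1382904919793596 * \<mu>^7 * (1 - 3 * \<mu>)^3 + 1382524293326218 * \<mu>^8 * (1 - 3 * \<mu>)^2
        + 623851798863828 * \<mu>^9 * (1 - 3 * \<mu>) + 35893455782693 * \<mu>^10) / 281250000000"
    unfolding A_def B_def C_def by algebra
  also have "\<dots> \<ge> 0"
    using \<mu> by (intro add_nonneg_nonneg mult_nonneg_nonneg divide_nonneg_nonneg zero_le_power) auto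
  finally have D: "B\<^sup>2 \<le> 4 * A * C" by simp
  have powers: "\<mu>^5 = \<mu> * \<mu> * \<mu> * \<mu> * \<mu>" "\<mu>^6 = \<mu> * \<mu> * \<mu> * \<mu> * \<mu> * \<mu>"
    by (simp_all add: eval_nat_numeral)
  show ?thesis
    unfolding antipodal_form_def
    by (rule node_nonneg[where A = A and B = B and C = C and s = "(- 2)" and \<sigma> = "4 * \<mu>\<^sup>2 + 2 * (- 2) * \<mu>"])
      ((rule A D | (insert \<mu>, simp add: tangent_coeff_nonneg; fail) | (simp add: A_def B_def C_def tangent_coeff_def power2_eq_square power3_eq_cube power4_eq_xxxx powers field_simps; fail))+)
qed

lemma antipodal_node_1_1:
  fixes \<mu> w :: real
  assumes \<mu>: "0 \<le> \<mu>" "\<mu> \<le> 1/3"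
  shows "0 \<le> antipodal_form (1/2) (3173/5000) (1/3) (1/2) (207/500) \<mu> (1/4) w
        + node_form (tangent_coeff (3173/5000) \<mu>) (24/25 * \<mu>\<^sup>2) 1 (1/4) (0) w"
proof -
  define A where "A = 9146837/24000000 - 307781/2000000 * \<mu>
        + 11245033/18000000 * \<mu>^2 - 155477/2250000 * \<mu>^3 + 22211/112500 * \<mu>^4"
  define B where "B = 669907/400000 * \<mu> + 15923/15000 * \<mu>^2 + 116711/300000 * \<mu>^3 + 22211/75000 * \<mu>^4"
  define C where "C = 959/4000 - 63/200 * \<mu> + 2849847/2000000 * \<mu>^2 + 193553/300000 * \<mu>^3
        + 2526157/4500000 * \<mu>^4 + 22211/112500 * \<mu>^5 - 22211/56250 * \<mu>^6"
  have "A = 33/100 + (3680511 * (1 - 3 * \<mu>)^4 + 33086016 * \<mu> * (1 - 3 * \<mu>)^3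
        + 144006682 * \<mu>^2 * (1 - 3 * \<mu>)^2 + 363237584 * \<mu>^3 * (1 - 3 * \<mu>)
        + 403068695 * \<mu>^4) / 72000000"
    unfolding A_def by algebra
  also have "\<dots> > 0"
    using \<mu> by (intro add_pos_nonneg add_nonneg_nonneg mult_nonneg_nonneg divide_nonneg_nonneg zero_le_power) auto
  finally have A: "0 < A" .
  have "4 * A * C - B\<^sup>2 = (29604881305125 * (1 - 3 * \<mu>)^10
        + 837295454661750 * \<mu> * (1 - 3 * \<mu>)^9 + 10629994641521157 * \<mu>^2 * (1 - 3 * \<mu>)^8
        + 79407445871164446 * \<mu>^3 * (1 - 3 * \<mu>)^7 + 384355906756524168 * \<mu>^4 * (1 - 3 * \<mu>)^6
        + 1250325728753882514 * \<mu>^5 * (1 - 3 * \<mu>)^5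
        + 2738974743407836264 * \<mu>^6 * (1 - 3 * \<mu>)^4
        + 3920379294698258986 * \<mu>^7 * (1 - 3 * \<mu>)^3
        + 3392240236923771467 * \<mu>^8 * (1 - 3 * \<mu>)^2 + 1473345580551078320 * \<mu>^9 * (1 - 3 * \<mu>)
        + 169869228561835675 * \<mu>^10) / 81000000000000"
    unfolding A_def B_def C_def by algebra
  also have "\<dots> \<ge> 0"
    using \<mu> by (intro add_nonneg_nonneg mult_nonneg_nonneg divide_nonneg_nonneg zero_le_power) auto
  finally have D: "B\<^sup>2 \<le> 4 * A * C" by simp
  have powers: "\<mu>^5 = \<mu> * \<mu> * \<mu> * \<mu> * \<mu>" "\<mu>^6 = \<mu> * \<mu> * \<mu> * \<mu> * \<mu> * \<mu>"
    by (simp_all add: eval_nat_numeral)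
  show ?thesis
    unfolding antipodal_form_def
    by (rule node_nonneg[where A = A and B = B and C = C and s = "(- 3/2)" and \<sigma> = "4 * \<mu>\<^sup>2 + 2 * (- 3/2) * \<mu>"])
      ((rule A D | (insert \<mu>, simp add: tangent_coeff_nonneg; fail) | (simp add: A_def B_def C_def tangent_coeff_def power2_eq_square power3_eq_cube power4_eq_xxxx powers field_simps; fail))+)
qed

lemma antipodal_node_1_2:
  fixes \<mu> w :: real
  assumes \<mu>: "0 \<le> \<mu>" "\<mu> \<le> 1/3"
  shows "0 \<le> antipodal_form (1/2) (3173/5000) (1/3) (1/2) (207/500) \<mu> (1) w
        + node_form (tangent_coeff (3173/5000) \<mu>) (24/25 * \<mu>\<^sup>2) 1 (1) (3/4) w"
proof -
  define A where "A = 1603721/6000000 - 22211/1500000 * \<mu>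
        + 2347207/4500000 * \<mu>^2 - 22211/562500 * \<mu>^3 + 22211/281250 * \<mu>^4"
  define B where "B = 2 * \<mu> + 16/25 * \<mu>^2 + 63/200 * \<mu>^3"
  define C where "C = 959/1000 - 63/50 * \<mu> - 12461/250000 * \<mu>^2 + 189/200 * \<mu>^3
        + 302681/562500 * \<mu>^4 - 22211/140625 * \<mu>^5 - 22211/140625 * \<mu>^6"
  have "A = 239/1000 + (509163 * (1 - 3 * \<mu>)^4 + 5843424 * \<mu> * (1 - 3 * \<mu>)^3
        + 34484842 * \<mu>^2 * (1 - 3 * \<mu>)^2 + 103415456 * \<mu>^3 * (1 - 3 * \<mu>)
        + 117834539 * \<mu>^4) / 18000000"
    unfolding A_def by algebra
  also have "\<dots> > 0"
    using \<mu> by (intro add_pos_nonneg add_nonneg_nonneg mult_nonneg_nonneg divide_nonneg_nonneg zero_le_power) auto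
  finally have A: "0 < A" .
  have "4 * A * C - B\<^sup>2 = (10381286963250 * (1 - 3 * \<mu>)^10
        + 297223852369500 * \<mu> * (1 - 3 * \<mu>)^9 + 3800597588577963 * \<mu>^2 * (1 - 3 * \<mu>)^8
        + 28505372393201130 * \<mu>^3 * (1 - 3 * \<mu>)^7 + 138372616726072194 * \<mu>^4 * (1 - 3 * \<mu>)^6
        + 451947021755895570 * \<mu>^5 * (1 - 3 * \<mu>)^5 + 998226420218901620 * \<mu>^6 * (1 - 3 * \<mu>)^4
        + 1454163414358860110 * \<mu>^7 * (1 - 3 * \<mu>)^3
        + 1307331846134927404 * \<mu>^8 * (1 - 3 * \<mu>)^2 + 623680937317632922 * \<mu>^9 * (1 - 3 * \<mu>)
        + 103397652471107777 * \<mu>^10) / 10125000000000"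
    unfolding A_def B_def C_def by algebra
  also have "\<dots> \<ge> 0"
    using \<mu> by (intro add_nonneg_nonneg mult_nonneg_nonneg divide_nonneg_nonneg zero_le_power) auto
  finally have D: "B\<^sup>2 \<le> 4 * A * C" by simp
  have powers: "\<mu>^5 = \<mu> * \<mu> * \<mu> * \<mu> * \<mu>" "\<mu>^6 = \<mu> * \<mu> * \<mu> * \<mu> * \<mu> * \<mu>"
    by (simp_all add: eval_nat_numeral)
  show ?thesis
    unfolding antipodal_form_def
    by (rule node_nonneg[where A = A and B = B and C = C and s = "0" and \<sigma> = "4 * \<mu>\<^sup>2 + 2 * 0 * \<mu>"])
      ((rule A D | (insert \<mu>, simp add: tangent_coeff_nonneg; fail) | (simp add: A_def B_def C_def tangent_coeff_def power2_eq_square power3_eq_cube power4_eq_xxxx powers field_simps; fail))+)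
qed

lemma bent_node_0_0:
  fixes \<mu> w :: real
  assumes \<mu>: "1/3 \<le> \<mu>" "\<mu> \<le> 221/625"
  shows "0 \<le> bent_form (149/100) (353/200) \<mu> (0) w + node_form 1 (2 * \<mu>\<^sup>2) (51/50) (0) (0) w"
proof -
  define A where "A = 149/100 - 2 * \<mu> + 3 * \<mu>^2"
  define B where "B = 49/25 * \<mu> + 6 * \<mu>^2"
  define C where "C = -151/10000 + 24/25 * \<mu>^2 + 8 * \<mu>^3"
  have "A = 1041/1000 + (1041 * (221 - 625 * \<mu>)^2 + 433750 * (3 * \<mu> - 1) * (221 - 625 * \<mu>)
        + 45663625 * (3 * \<mu> - 1)^2) / 1444000"
    unfolding A_def by algebra
  also have "\<dots> > 0"
    using \<mu> by (intro add_pos_nonneg add_nonneg_nonneg mult_nonneg_nonneg divide_nonneg_nonneg zero_le_power) auto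
  finally have A: "0 < A" .
  have "4 * A * C - B\<^sup>2 = (9497529 * (221 - 625 * \<mu>)^6
        + 11536751250 * (3 * \<mu> - 1) * (221 - 625 * \<mu>)^5
        + 5817097350575 * (3 * \<mu> - 1)^2 * (221 - 625 * \<mu>)^4
        + 1557961338057500 * (3 * \<mu> - 1)^3 * (221 - 625 * \<mu>)^3
        + 233670396493754375 * (3 * \<mu> - 1)^4 * (221 - 625 * \<mu>)^2
        + 18601220938966531250 * (3 * \<mu> - 1)^5 * (221 - 625 * \<mu>)
        + 613682247382431640625 * (3 * \<mu> - 1)^6) / 752734096000000"
    unfolding A_def B_def C_def by algebra
  also have "\<dots> \<ge> 0"
    using \<mu> by (intro add_nonneg_nonneg mult_nonneg_nonneg divide_nonneg_nonneg zero_le_power) auto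
  finally have D: "B\<^sup>2 \<le> 4 * A * C" by simp
  have powers: "\<mu>^5 = \<mu> * \<mu> * \<mu> * \<mu> * \<mu>" "\<mu>^6 = \<mu> * \<mu> * \<mu> * \<mu> * \<mu> * \<mu>"
    by (simp_all add: eval_nat_numeral)
  show ?thesis
    unfolding bent_form_def
    by (rule node_nonneg[where A = A and B = B and C = C and s = "(- 2)" and \<sigma> = "4 * \<mu>\<^sup>2 + 2 * (- 2) * \<mu>"])
      ((rule A D | (insert \<mu>, simp add: tangent_coeff_nonneg; fail) | (simp add: A_def B_def C_def tangent_coeff_def power2_eq_square power3_eq_cube power4_eq_xxxx powers field_simps; fail))+)
qed

lemma bent_node_0_1:
  fixes \<mu> w :: real
  assumes \<mu>: "1/3 \<le> \<mu>" "\<mu> \<le> 221/625"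
  shows "0 \<le> bent_form (149/100) (353/200) \<mu> (1/3) w + node_form 1 (2 * \<mu>\<^sup>2) (51/50) (1/3) (0) w"
proof -
  define A where "A = 5069/4350 - 74/75 * \<mu> + 191/75 * \<mu>^2"
  define B where "B = 409/87 * \<mu> + 2482/675 * \<mu>^2"
  define C where "C = 19547/30000 + 59/29 * \<mu>^2 + 296/75 * \<mu>^3 + 68/75 * \<mu>^4"
  have "A = 1007/1000 + (87979 * (221 - 625 * \<mu>)^2 + 39008850 * (3 * \<mu> - 1) * (221 - 625 * \<mu>)
        + 4343858835 * (3 * \<mu> - 1)^2) / 125628000"
    unfolding A_def by algebra
  also have "\<dots> > 0"
    using \<mu> by (intro add_pos_nonneg add_nonneg_nonneg mult_nonneg_nonneg divide_nonneg_nonneg zero_le_power) auto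
  finally have A: "0 < A" .
  have "4 * A * C - B\<^sup>2 = (1408374238941 * (221 - 625 * \<mu>)^6
        + 1656738476217210 * (3 * \<mu> - 1) * (221 - 625 * \<mu>)^5
        + 808251899433509891 * (3 * \<mu> - 1)^2 * (221 - 625 * \<mu>)^4
        + 209172620544646811500 * (3 * \<mu> - 1)^3 * (221 - 625 * \<mu>)^3
        + 30260570280889634457075 * (3 * \<mu> - 1)^4 * (221 - 625 * \<mu>)^2
        + 2317743008992961641704250 * (3 * \<mu> - 1)^5 * (221 - 625 * \<mu>)
        + 73324076154497400663699725 * (3 * \<mu> - 1)^6) / 7956775761768000000"
    unfolding A_def B_def C_def by algebra
  also have "\<dots> \<ge> 0"
    using \<mu> by (intro add_nonneg_nonneg mult_nonneg_nonneg divide_nonneg_nonneg zero_le_power) auto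
  finally have D: "B\<^sup>2 \<le> 4 * A * C" by simp
  have powers: "\<mu>^5 = \<mu> * \<mu> * \<mu> * \<mu> * \<mu>" "\<mu>^6 = \<mu> * \<mu> * \<mu> * \<mu> * \<mu> * \<mu>"
    by (simp_all add: eval_nat_numeral)
  show ?thesis
    unfolding bent_form_def
    by (rule node_nonneg[where A = A and B = B and C = C and s = "(- 37/29)" and \<sigma> = "4 * \<mu>\<^sup>2 + 2 * (- 37/29) * \<mu>"])
      ((rule A D | (insert \<mu>, simp add: tangent_coeff_nonneg; fail) | (simp add: A_def B_def C_def tangent_coeff_def power2_eq_square power3_eq_cube power4_eq_xxxx powers field_simps; fail))+)
qed

lemma bent_node_1_0:
  fixes \<mu> w :: real
  assumes \<mu>: "707/2000 \<le> \<mu>" "\<mu> \<le> 4083/10000"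
  shows "0 \<le> bent_form (147/100) (349/200) \<mu> (0) w + node_form 1 (2 * \<mu>\<^sup>2) (26/25) (0) (- 9/400) w"
proof -
  define A where "A = 586224519/400000000 - 19691/10000 * \<mu> + 3 * \<mu>^2"
  define B where "B = 200264519/100000000 * \<mu> + 29691/5000 * \<mu>^2"
  define C where "C = 49/10000 + 100264519/100000000 * \<mu>^2 + 19691/2500 * \<mu>^3"
  have "A = 1029/1000 + (46148479 * (4083 - 10000 * \<mu>)^2
        + 478133030 * (2000 * \<mu> - 707) * (4083 - 10000 * \<mu>)
        + 1327044375 * (2000 * \<mu> - 707)^2) / 120121600000000"
    unfolding A_def by algebra
  also have "\<dots> > 0"
    using \<mu> by (intro add_pos_nonneg add_nonneg_nonneg mult_nonneg_nonneg divide_nonneg_nonneg zero_le_power) auto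
  finally have A: "0 < A" .
  have "4 * A * C - B\<^sup>2 = (172311785471807099013 * (4083 - 10000 * \<mu>)^6
        + 4659148488115753652426 * (2000 * \<mu> - 707) * (4083 - 10000 * \<mu>)^5
        + 51128279174331219141399 * (2000 * \<mu> - 707)^2 * (4083 - 10000 * \<mu>)^4
        + 289052986223300000569372 * (2000 * \<mu> - 707)^3 * (4083 - 10000 * \<mu>)^3
        + 875987545073172904620515 * (2000 * \<mu> - 707)^4 * (4083 - 10000 * \<mu>)^2
        + 1316339962185013589030650 * (2000 * \<mu> - 707)^5 * (4083 - 10000 * \<mu>)
        + 725927355415977679190625 * (2000 * \<mu> - 707)^6) / 54164326404988928000000000000000000000"
    unfolding A_def B_def C_def by algebra
  also have "\<dots> \<ge> 0"
    using \<mu> by (intro add_nonneg_nonneg mult_nonneg_nonneg divide_nonneg_nonneg zero_le_power) auto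
  finally have D: "B\<^sup>2 \<le> 4 * A * C" by simp
  have powers: "\<mu>^5 = \<mu> * \<mu> * \<mu> * \<mu> * \<mu>" "\<mu>^6 = \<mu> * \<mu> * \<mu> * \<mu> * \<mu> * \<mu>"
    by (simp_all add: eval_nat_numeral)
  show ?thesis
    unfolding bent_form_def
    by (rule node_nonneg[where A = A and B = B and C = C and s = "(- 19691/10000)" and \<sigma> = "4 * \<mu>\<^sup>2 + 2 * (- 19691/10000) * \<mu>"])
      ((rule A D | (insert \<mu>, simp add: tangent_coeff_nonneg; fail) | (simp add: A_def B_def C_def tangent_coeff_def power2_eq_square power3_eq_cube power4_eq_xxxx powers field_simps; fail))+)
qed

lemma bent_node_1_1:
  fixes \<mu> w :: real
  assumes \<mu>: "707/2000 \<le> \<mu>" "\<mu> \<le> 4083/10000"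
  shows "0 \<le> bent_form (147/100) (349/200) \<mu> (1/3) w
        + node_form 1 (2 * \<mu>\<^sup>2) (26/25) (1/3) (31/400) w"
proof -
  define A where "A = 3298944751/2768000000 - 32393/30000 * \<mu> + 571/225 * \<mu>^2"
  define B where "B = 3019653551/692000000 * \<mu> + 521537/135000 * \<mu>^2"
  define C where "C = 20147/30000 + 3522960653/2076000000 * \<mu>^2 + 32393/7500 * \<mu>^3 + 208/225 * \<mu>^4"
  have "A = 507/500 + (70528490663 * (4083 - 10000 * \<mu>)^2
        + 827202471414 * (2000 * \<mu> - 707) * (4083 - 10000 * \<mu>)
        + 2491459810623 * (2000 * \<mu> - 707)^2) / 187029331200000000"
    unfolding A_def by algebra
  also have "\<dots> > 0"
    using \<mu> by (intro add_pos_nonneg add_nonneg_nonneg mult_nonneg_nonneg divide_nonneg_nonneg zero_le_power) auto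
  finally have A: "0 < A" .
  have "4 * A * C - B\<^sup>2 = (1018676683325398519434833329 * (4083 - 10000 * \<mu>)^6
        + 26351256632806888072639769986 * (2000 * \<mu> - 707) * (4083 - 10000 * \<mu>)^5
        + 275359147378752130833615999835 * (2000 * \<mu> - 707)^2 * (4083 - 10000 * \<mu>)^4
        + 1466598638889756367912379546220 * (2000 * \<mu> - 707)^3 * (4083 - 10000 * \<mu>)^3
        + 4084625176090865885501268152535 * (2000 * \<mu> - 707)^4 * (4083 - 10000 * \<mu>)^2
        + 5283554753095966965768837607026 * (2000 * \<mu> - 707)^5 * (4083 - 10000 * \<mu>)
        + 1958365921351542597303851091069 * (2000 * \<mu> - 707)^6) / 34155211766089943162880000000000000000000000"
    unfolding A_def B_def C_def by algebra
  also have "\<dots> \<ge> 0"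
    using \<mu> by (intro add_nonneg_nonneg mult_nonneg_nonneg divide_nonneg_nonneg zero_le_power) auto
  finally have D: "B\<^sup>2 \<le> 4 * A * C" by simp
  have powers: "\<mu>^5 = \<mu> * \<mu> * \<mu> * \<mu> * \<mu>" "\<mu>^6 = \<mu> * \<mu> * \<mu> * \<mu> * \<mu> * \<mu>"
    by (simp_all add: eval_nat_numeral)
  show ?thesis
    unfolding bent_form_def
    by (rule node_nonneg[where A = A and B = B and C = C and s = "(- 97179/69200)" and \<sigma> = "4 * \<mu>\<^sup>2 + 2 * (- 97179/69200) * \<mu>"])
      ((rule A D | (insert \<mu>, simp add: tangent_coeff_nonneg; fail) | (simp add: A_def B_def C_def tangent_coeff_def power2_eq_square power3_eq_cube power4_eq_xxxx powers field_simps; fail))+)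
qed

lemma bent_node_2_0:
  fixes \<mu> w :: real
  assumes \<mu>: "2041/5000 \<le> \<mu>" "\<mu> \<le> 4473/10000"
  shows "0 \<le> bent_form (142/65) (3383/1950) \<mu> (0) w + node_form 1 (2 * \<mu>\<^sup>2) (3/5) (0) (- 9/400) w"
proof -
  define A where "A = 113633267/52000000 - 1979/1000 * \<mu> + 3 * \<mu>^2"
  define B where "B = 62686267/13000000 * \<mu> + 2979/500 * \<mu>^2"
  define C where "C = 5861/390000 + 49686267/13000000 * \<mu>^2 + 1979/250 * \<mu>^3"
  have "A = 1689/1000 + (244801771 * (4473 - 10000 * \<mu>)^2
        + 1027007616 * (5000 * \<mu> - 2041) * (4473 - 10000 * \<mu>)
        + 1098657584 * (5000 * \<mu> - 2041)^2) / 198745300000000"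
    unfolding A_def by algebra
  also have "\<dots> > 0"
    using \<mu> by (intro add_pos_nonneg add_nonneg_nonneg mult_nonneg_nonneg divide_nonneg_nonneg zero_le_power) auto
  finally have A: "0 < A" .
  have "4 * A * C - B\<^sup>2 = (67371211008714926714731 * (4473 - 10000 * \<mu>)^6
        + 747150535024551955268057 * (5000 * \<mu> - 2041) * (4473 - 10000 * \<mu>)^5
        + 3429192668126061725918615 * (5000 * \<mu> - 2041)^2 * (4473 - 10000 * \<mu>)^4
        + 8337212728507748911571415 * (5000 * \<mu> - 2041)^3 * (4473 - 10000 * \<mu>)^3
        + 11327701664494947949729750 * (5000 * \<mu> - 2041)^4 * (4473 - 10000 * \<mu>)^2
        + 8161759039574041579737928 * (5000 * \<mu> - 2041)^5 * (4473 - 10000 * \<mu>)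
        + 2440390175441202297265376 * (5000 * \<mu> - 2041)^6) / 1415332678127669833593750000000000000000"
    unfolding A_def B_def C_def by algebra
  also have "\<dots> \<ge> 0"
    using \<mu> by (intro add_nonneg_nonneg mult_nonneg_nonneg divide_nonneg_nonneg zero_le_power) auto
  finally have D: "B\<^sup>2 \<le> 4 * A * C" by simp
  have powers: "\<mu>^5 = \<mu> * \<mu> * \<mu> * \<mu> * \<mu>" "\<mu>^6 = \<mu> * \<mu> * \<mu> * \<mu> * \<mu> * \<mu>"
    by (simp_all add: eval_nat_numeral)
  show ?thesis
    unfolding bent_form_def
    by (rule node_nonneg[where A = A and B = B and C = C and s = "(- 1979/1000)" and \<sigma> = "4 * \<mu>\<^sup>2 + 2 * (- 1979/1000) * \<mu>"])
      ((rule A D | (insert \<mu>, simp add: tangent_coeff_nonneg; fail) | (simp add: A_def B_def C_def tangent_coeff_def power2_eq_square power3_eq_cube power4_eq_xxxx powers field_simps; fail))+)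
qed

lemma bent_node_2_1:
  fixes \<mu> w :: real
  assumes \<mu>: "2041/5000 \<le> \<mu>" "\<mu> \<le> 4473/10000"
  shows "0 \<le> bent_form (142/65) (3383/1950) \<mu> (1/3) w
        + node_form 1 (2 * \<mu>\<^sup>2) (3/5) (1/3) (31/400) w"
proof -
  define A where "A = 20146637/10400000 - 1339/1000 * \<mu> + 41/15 * \<mu>^2"
  define B where "B = 17341237/2600000 * \<mu> + 59153/13500 * \<mu>^2"
  define C where "C = 265861/390000 + 31223711/7800000 * \<mu>^2 + 1339/250 * \<mu>^3 + 8/15 * \<mu>^4"
  have "A = 1661/1000 + (3608370167 * (4473 - 10000 * \<mu>)^2
        + 15794443752 * (5000 * \<mu> - 2041) * (4473 - 10000 * \<mu>)
        + 17481349128 * (5000 * \<mu> - 2041)^2) / 2981179500000000"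
    unfolding A_def by algebra
  also have "\<dots> > 0"
    using \<mu> by (intro add_pos_nonneg add_nonneg_nonneg mult_nonneg_nonneg divide_nonneg_nonneg zero_le_power) auto
  finally have A: "0 < A" .
  have "4 * A * C - B\<^sup>2 = (10076057541692310279085580147 * (4473 - 10000 * \<mu>)^6
        + 102456139932959912243372258021 * (5000 * \<mu> - 2041) * (4473 - 10000 * \<mu>)^5
        + 419063994245853600548447143595 * (5000 * \<mu> - 2041)^2 * (4473 - 10000 * \<mu>)^4
        + 866794477845484580719351483755 * (5000 * \<mu> - 2041)^3 * (4473 - 10000 * \<mu>)^3
        + 921526104571613891422131761730 * (5000 * \<mu> - 2041)^4 * (4473 - 10000 * \<mu>)^2
        + 432732815707684089529111185576 * (5000 * \<mu> - 2041)^5 * (4473 - 10000 * \<mu>)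
        + 42421939189299317074052403288 * (5000 * \<mu> - 2041)^6) / 42990730098127971195410156250000000000000000"
    unfolding A_def B_def C_def by algebra
  also have "\<dots> \<ge> 0"
    using \<mu> by (intro add_nonneg_nonneg mult_nonneg_nonneg divide_nonneg_nonneg zero_le_power) auto
  finally have D: "B\<^sup>2 \<le> 4 * A * C" by simp
  have powers: "\<mu>^5 = \<mu> * \<mu> * \<mu> * \<mu> * \<mu>" "\<mu>^6 = \<mu> * \<mu> * \<mu> * \<mu> * \<mu> * \<mu>"
    by (simp_all add: eval_nat_numeral)
  show ?thesis
    unfolding bent_form_def
    by (rule node_nonneg[where A = A and B = B and C = C and s = "(- 309/200)" and \<sigma> = "4 * \<mu>\<^sup>2 + 2 * (- 309/200) * \<mu>"])
      ((rule A D | (insert \<mu>, simp add: tangent_coeff_nonneg; fail) | (simp add: A_def B_def C_def tangent_coeff_def power2_eq_square power3_eq_cube power4_eq_xxxx powers field_simps; fail))+)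
qed

lemma bent_node_3_0:
  fixes \<mu> w :: real
  assumes \<mu>: "559/1250 \<le> \<mu>" "\<mu> \<le> 943/2000"
  shows "0 \<le> bent_form (69/20) (171/100) \<mu> (0) w + node_form 1 (2 * \<mu>\<^sup>2) (9/25) (0) (- 9/400) w"
proof -
  define A where "A = 86334729/25000000 - 4961/2500 * \<mu> + 3 * \<mu>^2"
  define B where "B = 61638479/6250000 * \<mu> + 7461/1250 * \<mu>^2"
  define C where "C = 399/10000 + 55388479/6250000 * \<mu>^2 + 4961/625 * \<mu>^3"
  have "A = 2849/1000 + (66026875 * (943 - 2000 * \<mu>)^2
        + 216946280 * (1250 * \<mu> - 559) * (943 - 2000 * \<mu>)
        + 179030032 * (1250 * \<mu> - 559)^2) / 492075000000"
    unfolding A_def by algebra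
  also have "\<dots> > 0"
    using \<mu> by (intro add_pos_nonneg add_nonneg_nonneg mult_nonneg_nonneg divide_nonneg_nonneg zero_le_power) auto
  finally have A: "0 < A" .
  have "4 * A * C - B\<^sup>2 = (8384412689558871875 * (943 - 2000 * \<mu>)^6
        + 78881603077935235950 * (1250 * \<mu> - 559) * (943 - 2000 * \<mu>)^5
        + 309443982131522236185 * (1250 * \<mu> - 559)^2 * (943 - 2000 * \<mu>)^4
        + 648039658880875659004 * (1250 * \<mu> - 559)^3 * (943 - 2000 * \<mu>)^3
        + 764307870973710617184 * (1250 * \<mu> - 559)^4 * (943 - 2000 * \<mu>)^2
        + 481480208565999772608 * (1250 * \<mu> - 559)^5 * (943 - 2000 * \<mu>)
        + 126605001056443069952 * (1250 * \<mu> - 559)^6) / 206857570664794921875000000000"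
    unfolding A_def B_def C_def by algebra
  also have "\<dots> \<ge> 0"
    using \<mu> by (intro add_nonneg_nonneg mult_nonneg_nonneg divide_nonneg_nonneg zero_le_power) auto
  finally have D: "B\<^sup>2 \<le> 4 * A * C" by simp
  have powers: "\<mu>^5 = \<mu> * \<mu> * \<mu> * \<mu> * \<mu>" "\<mu>^6 = \<mu> * \<mu> * \<mu> * \<mu> * \<mu> * \<mu>"
    by (simp_all add: eval_nat_numeral)
  show ?thesis
    unfolding bent_form_def
    by (rule node_nonneg[where A = A and B = B and C = C and s = "(- 4961/2500)" and \<sigma> = "4 * \<mu>\<^sup>2 + 2 * (- 4961/2500) * \<mu>"])
      ((rule A D | (insert \<mu>, simp add: tangent_coeff_nonneg; fail) | (simp add: A_def B_def C_def tangent_coeff_def power2_eq_square power3_eq_cube power4_eq_xxxx powers field_simps; fail))+)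
qed

lemma bent_node_3_1:
  fixes \<mu> w :: real
  assumes \<mu>: "559/1250 \<le> \<mu>" "\<mu> \<le> 943/2000"
  shows "0 \<le> bent_form (69/20) (171/100) \<mu> (1/3) w + node_form 1 (2 * \<mu>\<^sup>2) (9/25) (1/3) (31/400) w"
proof -
  define A where "A = 73975149/23000000 - 3701/2500 * \<mu> + 71/25 * \<mu>^2"
  define B where "B = 65652599/5750000 * \<mu> + 157427/33750 * \<mu>^2"
  define C where "C = 21197/30000 + 150957797/17250000 * \<mu>^2 + 3701/625 * \<mu>^3 + 8/25 * \<mu>^4"
  have "A = 281/100 + (4488470293 * (943 - 2000 * \<mu>)^2
        + 14955369032 * (1250 * \<mu> - 559) * (943 - 2000 * \<mu>)
        + 12499819792 * (1250 * \<mu> - 559)^2) / 33953175000000"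
    unfolding A_def by algebra
  also have "\<dots> > 0"
    using \<mu> by (intro add_pos_nonneg add_nonneg_nonneg mult_nonneg_nonneg divide_nonneg_nonneg zero_le_power) auto
  finally have A: "0 < A" .
  have "4 * A * C - B\<^sup>2 = (315702851715657056831763197 * (943 - 2000 * \<mu>)^6
        + 2632532451766949343039850434 * (1250 * \<mu> - 559) * (943 - 2000 * \<mu>)^5
        + 8935684205400734731433069295 * (1250 * \<mu> - 559)^2 * (943 - 2000 * \<mu>)^4
        + 15660531593743277292018302020 * (1250 * \<mu> - 559)^3 * (943 - 2000 * \<mu>)^3
        + 14712267270961387336930416480 * (1250 * \<mu> - 559)^4 * (943 - 2000 * \<mu>)^2
        + 6808107409972491210984508224 * (1250 * \<mu> - 559)^5 * (943 - 2000 * \<mu>)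
        + 1121693592159093500288277248 * (1250 * \<mu> - 559)^6) / 4214082778113988992919921875000000000"
    unfolding A_def B_def C_def by algebra
  also have "\<dots> \<ge> 0"
    using \<mu> by (intro add_nonneg_nonneg mult_nonneg_nonneg divide_nonneg_nonneg zero_le_power) auto
  finally have D: "B\<^sup>2 \<le> 4 * A * C" by simp
  have powers: "\<mu>^5 = \<mu> * \<mu> * \<mu> * \<mu> * \<mu>" "\<mu>^6 = \<mu> * \<mu> * \<mu> * \<mu> * \<mu> * \<mu>"
    by (simp_all add: eval_nat_numeral)
  show ?thesis
    unfolding bent_form_def
    by (rule node_nonneg[where A = A and B = B and C = C and s = "(- 3701/2300)" and \<sigma> = "4 * \<mu>\<^sup>2 + 2 * (- 3701/2300) * \<mu>"])
      ((rule A D | (insert \<mu>, simp add: tangent_coeff_nonneg; fail) | (simp add: A_def B_def C_def tangent_coeff_def power2_eq_square power3_eq_cube power4_eq_xxxx powers field_simps; fail))+)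
qed

lemma affine_plus_node_form_nonneg:
  fixes k a \<tau> \<zeta> l h t w f0 f1 :: real
  assumes "0 \<le> k" "0 \<le> a" "0 \<le> \<tau>" "0 \<le> w" "(\<tau>/2 + 1/6) * w \<le> 3/2 * \<tau>"
    and "0 \<le> \<zeta>" "l \<le> \<zeta>" "\<zeta> \<le> h" "l < h"
    and l: "0 \<le> (f0 + f1 * l) + node_form k a \<tau> l (2 * t * l - t\<^sup>2) w"
    and h: "0 \<le> (f0 + f1 * h) + node_form k a \<tau> h (2 * t * h - t\<^sup>2) w"
  shows "0 \<le> (f0 + f1 * \<zeta>) + ((a + k * (1 - \<tau> * \<zeta>) * w\<^sup>2) * ((3
        + w\<^sup>2)/2 - w - (3 - w) * \<zeta>/2 - w * \<zeta>\<^sup>2/6)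
        + k * (\<tau> * \<zeta> * w^4/3 - w^4/4))" (is "0 \<le> _ + ?R")
proof -
  have "0 \<le> (h - \<zeta>) * ((f0 + f1 * l) + node_form k a \<tau> l (2 * t * l - t\<^sup>2) w)
      + (\<zeta> - l) * ((f0 + f1 * h) + node_form k a \<tau> h (2 * t * h - t\<^sup>2) w)"
    using l h assms(7,8) by (intro add_nonneg_nonneg[OF mult_nonneg_nonneg mult_nonneg_nonneg]) simp_all
  also have "\<dots> = (h - l) * (f0 + f1 * \<zeta>)
        + ((h - \<zeta>) * node_form k a \<tau> l (2 * t * l - t\<^sup>2) w
      + (\<zeta> - l) * node_form k a \<tau> h (2 * t * h - t\<^sup>2) w)"
    by (simp add: algebra_simps)
  also have "\<dots> \<le> (h - l) * (f0 + f1 * \<zeta>) + (h - l) * ?R"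
    using node_form_interpolation[of k a \<tau> w \<zeta> l h t] assms by simp
  also have "\<dots> = (h - l) * ((f0 + f1 * \<zeta>) + ?R)" by (simp add: distrib_left)
  finally show ?thesis using \<open>l < h\<close> by (simp only: zero_le_mult_iff) linarith
qed

text \<open>The weight \<open>c\<close> of the squared length of the sum and the data \<open>\<beta>\<close>, \<open>b\<close>, \<open>g\<close>, \<open>\<gamma>\<close> for the two polynomials
  into which the estimate splits: the values at \<open>e = 0\<close> and \<open>e = 1\<close> of the linear bounds in
  \<open>beta_bounds\<close> and \<open>gamma_bounds\<close>, and of \<open>(1 - f)/e\<close> for the quadratic bounds \<open>f\<close> there.\<close>

definition antipodal_params :: "(real \<times> real \<times> real \<times> real \<times> real) set" where
  "antipodal_params = {(1, 9919/10000, 811/2000, 1733/2500, 489/500), (1/2, 3173/5000, 1/3, 1/2, 207/500)}"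

text \<open>The nodes \<open>0\<close>, \<open>1/4\<close>, \<open>1\<close> and the tangents of the square function at \<open>0\<close> and \<open>1/2\<close> fit
  together: both tangents have the value zero at \<open>1/4\<close>.\<close>

lemma antipodal_form_plus_nonneg:
  fixes \<mu> w \<zeta> :: real
  assumes par: "(c, \<beta>, b, g, \<gamma>) \<in> antipodal_params"
    and \<mu>: "0 \<le> \<mu>" "\<mu> \<le> 1/3" and w: "0 \<le> w" "w \<le> 9/4" and \<zeta>: "0 \<le> \<zeta>" "\<zeta> \<le> 1"
  shows "0 \<le> antipodal_form c \<beta> b g \<gamma> \<mu> \<zeta> w
    + ((24/25 * \<mu>\<^sup>2 + tangent_coeff \<beta> \<mu> * (1 - 1 * \<zeta>) * w\<^sup>2) * ((3 + w\<^sup>2)/2 - w - (3 - w) * \<zeta>/2 - w * \<zeta>\<^sup>2/6)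
        + tangent_coeff \<beta> \<mu> * (1 * \<zeta> * w^4/3 - w^4/4))"
proof -
  define f0 where "f0 = antipodal_form c \<beta> b g \<gamma> \<mu> 0 w"
  define f1 where "f1 = (24/25 - 63/50 * \<mu>) * (1 - \<mu>\<^sup>2) - 1/1000"
  have f: "antipodal_form c \<beta> b g \<gamma> \<mu> z w = f0 + f1 * z" for z
    by (simp add: f0_def f1_def antipodal_form_def)
  have k: "0 \<le> tangent_coeff \<beta> \<mu>"
    using par \<mu> by (intro tangent_coeff_nonneg) (auto simp: antipodal_params_def)
  have n0: "0 \<le> (f0 + f1 * 0) + node_form (tangent_coeff \<beta> \<mu>) (24/25 * \<mu>\<^sup>2) 1 0 0 w"
    and n1: "0 \<le> (f0 + f1 * (1/4)) + node_form (tangent_coeff \<beta> \<mu>) (24/25 * \<mu>\<^sup>2) 1 (1/4) 0 w"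
    and n2: "0 \<le> (f0 + f1 * 1) + node_form (tangent_coeff \<beta> \<mu>) (24/25 * \<mu>\<^sup>2) 1 1 (3/4) w"
    using par unfolding f[symmetric] antipodal_params_def
    by (elim insertE emptyE; simp only: prod.inject antipodal_node_0_0[OF \<mu>] antipodal_node_0_1[OF \<mu>]
      antipodal_node_0_2[OF \<mu>] antipodal_node_1_0[OF \<mu>] antipodal_node_1_1[OF \<mu>] antipodal_node_1_2[OF \<mu>])+
  show ?thesis
  proof (cases "\<zeta> \<le> 1/4")
    case True
    show ?thesis unfolding f
      by (rule affine_plus_node_form_nonneg[where l = 0 and h = "1/4" and t = 0]) (use True k w \<zeta> n0 n1 in auto)
  next
    case False
    show ?thesis unfolding f
      by (rule affine_plus_node_form_nonneg[where l = "1/4" and h = 1 and t = "1/2"])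
        (use False k w \<zeta> n1 n2 in \<open>auto simp: power2_eq_square\<close>)
  qed
qed

text \<open>Weight \<open>c\<close> of the squared length of the sum, claimed bound \<open>P\<close>, splitting parameter \<open>\<tau>\<close>, tangent point
  \<open>t\<close>, and the range of \<open>\<mu>\<close>. The ranges overlap slightly, since their exact ends, where \<open>\<mu>\<^sup>2\<close> is \<open>1/8\<close>,
  \<open>1/6\<close>, \<open>1/5\<close>, \<open>2/9\<close>, are irrational.\<close>

definition bent_params :: "(real \<times> real \<times> real \<times> real \<times> real \<times> real) set" where
  "bent_params = {(149/100, 353/200, 51/50, 0, 1/3, 221/625), (147/100, 349/200, 26/25, 3/20, 707/2000, 4083/10000), (142/65, 3383/1950, 3/5, 3/20, 2041/5000, 4473/10000), (69/20, 171/100, 9/25, 3/20, 559/1250, 943/2000)}"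

lemma bent_form_plus_nonneg:
  fixes \<mu> w \<zeta> :: real
  assumes par: "(c, P, \<tau>, t, lo, hi) \<in> bent_params"
    and \<mu>: "lo \<le> \<mu>" "\<mu> \<le> hi" and w: "0 \<le> w" "w \<le> 3/2" and \<zeta>: "0 \<le> \<zeta>" "\<zeta> \<le> 1/3"
  shows "0 \<le> bent_form c P \<mu> \<zeta> w
    + ((2 * \<mu>\<^sup>2 + 1 * (1 - \<tau> * \<zeta>) * w\<^sup>2) * ((3 + w\<^sup>2)/2 - w - (3 - w) * \<zeta>/2 - w * \<zeta>\<^sup>2/6)
        + 1 * (\<tau> * \<zeta> * w^4/3 - w^4/4))"
proof -
  define f0 where "f0 = bent_form c P \<mu> 0 w"
  define f1 where "f1 = 2 * (1 - \<mu>\<^sup>2)"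
  have f: "bent_form c P \<mu> z w = f0 + f1 * z" for z
    by (simp add: f0_def f1_def bent_form_def)
  have \<tau>: "1/3 \<le> \<tau>" using par by (auto simp: bent_params_def)
  then have "(\<tau>/2 + 1/6) * w \<le> \<tau> * (3/2)" using w by (intro mult_mono) auto
  then have \<tau>: "0 \<le> \<tau>" "(\<tau>/2 + 1/6) * w \<le> 3/2 * \<tau>" using \<tau> by simp_all
  have n0: "0 \<le> (f0 + f1 * 0) + node_form 1 (2 * \<mu>\<^sup>2) \<tau> 0 (2 * t * 0 - t\<^sup>2) w"
    and n1: "0 \<le> (f0 + f1 * (1/3)) + node_form 1 (2 * \<mu>\<^sup>2) \<tau> (1/3) (2 * t * (1/3) - t\<^sup>2) w"
    using par \<mu> unfolding f[symmetric] bent_params_def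
    by (elim insertE emptyE; simp only: prod.inject; elim conjE; hypsubst;
      use bent_node_0_0[of \<mu> w] bent_node_0_1[of \<mu> w] bent_node_1_0[of \<mu> w] bent_node_1_1[of \<mu> w]
      bent_node_2_0[of \<mu> w] bent_node_2_1[of \<mu> w] bent_node_3_0[of \<mu> w] bent_node_3_1[of \<mu> w]
      in \<open>simp add: power2_eq_square[of "_ / _"]\<close>)+
  show ?thesis unfolding f
    by (rule affine_plus_node_form_nonneg[where l = 0 and h = "1/3" and t = t]) (use \<tau> w \<zeta> n0 n1 in auto)
qed

section \<open>The quadratic forms of a configuration\<close>

text \<open>The tangent of the cubic at \<open>1/2\<close> meets it again at \<open>- 1\<close>.\<close>

lemma cubic_ge_linear: "(3 * x - 1)/4 \<le> x^3" if "- 1 \<le> x" for x :: real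
proof -
  have "x^3 - (3 * x - 1)/4 = (x
        + 1) * (2 * x - 1)\<^sup>2/4" by (simp add: power2_eq_square power3_eq_cube field_simps)
  also have "\<dots> \<ge> 0" using that by simp
  finally show ?thesis by simp
qed

context three_unit_vectors
begin

lemma coordinate_bounds: "\<bar>X1\<bar> \<le> 1" "\<bar>X2\<bar> \<le> 1" "\<bar>X3\<bar> \<le> 1" and zeta_le: "zeta \<le> 3"
proof -
  have *: "x\<^sup>2 \<le> 1" "z\<^sup>2 \<le> 1" if "x\<^sup>2 + y\<^sup>2 + z\<^sup>2 = 1" for x y z :: real
    using that zero_le_power2[of x] zero_le_power2[of y] zero_le_power2[of z] by linarith+
  show "\<bar>X1\<bar> \<le> 1" "\<bar>X2\<bar> \<le> 1" "\<bar>X3\<bar> \<le> 1"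
    using *(1)[OF unit(1)] *(1)[OF unit(2)] *(1)[OF unit(3)] by (simp_all add: abs_le_square_iff[of _ 1, simplified])
  show "zeta \<le> 3"
    unfolding zeta_def using *(2)[OF unit(1)] *(2)[OF unit(2)] *(2)[OF unit(3)] by linarith
qed

lemma W1_ge: "- w \<le> W1"
proof -
  have "\<bar>W1\<bar> \<le> w" using w_squared w_nonneg by (metis abs_le_square_iff abs_of_nonneg le_add_same_cancel1 zero_le_power2)
  then show ?thesis by linarith
qed

lemma shifted_sum_ge:
  assumes "0 \<le> \<mu>"
  shows "(w - 2 * \<mu>)\<^sup>2 \<le> (W1 + 2 * \<mu>)\<^sup>2 + W2\<^sup>2"
proof -
  have "(W1 + 2 * \<mu>)\<^sup>2 + W2\<^sup>2 - (w - 2 * \<mu>)\<^sup>2 = 4 * \<mu> * (W1 + w)"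
    using w_squared by (simp add: power2_eq_square algebra_simps)
  also have "\<dots> \<ge> 0" using assms W1_ge by simp
  finally show ?thesis by simp
qed

text \<open>The sum of \<open>12/25 * x\<^sup>2 + 21/100 * x\<^sup>3\<close> over the six scalar products \<open>x\<close> between the triangle and the
  farthest pair. For the vector \<open>(X, Y, z)\<close> they are \<open>\<mu> * X + \<nu> * z\<close> and \<open>\<mu> * X - \<nu> * z\<close> with
  \<open>\<nu>\<^sup>2 = 1 - \<mu>\<^sup>2\<close>.\<close>

definition polar_part :: "real \<Rightarrow> real" where
  "polar_part \<mu> = 24/25 * (\<mu>\<^sup>2 * (X1\<^sup>2 + X2\<^sup>2 + X3\<^sup>2) + (1 - \<mu>\<^sup>2) * zeta)
    + 21/100 * (2 * \<mu>^3 * (X1^3 + X2^3 + X3^3)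
      + 6 * \<mu> * (1 - \<mu>\<^sup>2) * (X1 * z1\<^sup>2 + X2 * z2\<^sup>2 + X3 * z3\<^sup>2))"

text \<open>The analogue of \<open>polar_part\<close> for the triangle: \<open>3/2\<close> times the cubic correction at \<open>2/3 * u\<close>.\<close>

definition triangle_part :: real where
  "triangle_part = 8/25 * (u1\<^sup>2 + u2\<^sup>2 + u3\<^sup>2) + 7/75 * (u1^3 + u2^3 + u3^3)"

text \<open>The terms of third degree are odd in the \<open>Xi\<close>. The pure cubes are bounded by a linear function and so
  by the sum \<open>W1 \<ge> - w\<close>, the mixed ones by \<open>Xi \<ge> - 1\<close>.\<close>

lemma polar_part_ge:
  assumes \<mu>: "0 \<le> \<mu>" "\<mu> \<le> 1"
  shows "24/25 * \<mu>\<^sup>2 * (X1\<^sup>2 + X2\<^sup>2 + X3\<^sup>2)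
        + (24/25 - 63/50 * \<mu>) * (1 - \<mu>\<^sup>2) * zeta
      - 63/200 * \<mu>^3 * (1 + w) \<le> polar_part \<mu>"
proof -
  have X: "- 1 \<le> X1" "- 1 \<le> X2" "- 1 \<le> X3" using coordinate_bounds by linarith+
  have "- (1 + w) \<le> 4/3 * (X1^3 + X2^3 + X3^3)"
    using cubic_ge_linear[OF X(1)] cubic_ge_linear[OF X(2)] cubic_ge_linear[OF X(3)] W1_ge
    by (simp add: W1_def)
  then have 1: "63/200 * \<mu>^3 * (- (1 + w)) \<le> 63/200 * \<mu>^3 * (4/3 * (X1^3 + X2^3 + X3^3))"
    using \<mu> by (intro mult_left_mono) auto
  have "- zeta \<le> X1 * z1\<^sup>2 + X2 * z2\<^sup>2 + X3 * z3\<^sup>2"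
    using mult_right_mono[OF X(1), of "z1\<^sup>2"] mult_right_mono[OF X(2), of "z2\<^sup>2"] mult_right_mono[OF X(3), of "z3\<^sup>2"]
    by (simp add: zeta_def)
  then have 2: "63/50 * \<mu> * (1 - \<mu>\<^sup>2) * (- zeta) \<le> 63/50 * \<mu> * (1 - \<mu>\<^sup>2) * (X1 * z1\<^sup>2 + X2 * z2\<^sup>2 + X3 * z3\<^sup>2)"
    using \<mu> by (intro mult_left_mono) (auto simp: power_le_one)
  have eq: "24/25 * (\<mu>\<^sup>2 * s + (1 - \<mu>\<^sup>2) * zeta) + 21/100 * (2 * \<mu>^3 * c
        + 6 * \<mu> * (1 - \<mu>\<^sup>2) * d)
    = 24/25 * \<mu>\<^sup>2 * s + (24/25 - 63/50 * \<mu>) * (1 - \<mu>\<^sup>2) * zeta - 63/200 * \<mu>^3 * (1 + w)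
      + (63/200 * \<mu>^3 * (4/3 * c) - 63/200 * \<mu>^3 * (- (1 + w)))
      + (63/50 * \<mu> * (1 - \<mu>\<^sup>2) * d - 63/50 * \<mu> * (1 - \<mu>\<^sup>2) * (- zeta))" for s c d
    by (simp add: field_simps)
  show ?thesis using 1 2 unfolding polar_part_def eq by linarith
qed

lemma polar_part_nonneg:
  assumes \<mu>: "0 \<le> \<mu>" "\<mu> \<le> 1/3"
  shows "0 \<le> polar_part \<mu>"
proof -
  have *: "0 \<le> 24/25 * (\<mu>\<^sup>2 * x\<^sup>2 + (1 - \<mu>\<^sup>2) * z\<^sup>2)
        + 21/100 * (2 * \<mu>^3 * x^3 + 6 * \<mu> * (1 - \<mu>\<^sup>2) * (x * z\<^sup>2))"
    if "\<bar>x\<bar> \<le> 1" for x z :: real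
  proof -
    have "\<mu> * \<bar>x\<bar> \<le> 1/3 * 1" using that \<mu> by (intro mult_mono) auto
    then have y: "- (1/3) \<le> \<mu> * x" using \<mu> by (smt (verit, best) mult_minus_right mult_nonneg_nonneg zero_le_mult_iff)
    have "\<mu>\<^sup>2 \<le> 1" using \<mu> by (simp add: power_le_one)
    then have "0 \<le> (\<mu> * x)\<^sup>2 * (24/25 + 21/50 * (\<mu> * x)) + (1 - \<mu>\<^sup>2) * z\<^sup>2 * (24/25 + 63/50 * (\<mu> * x))"
      using y by (intro add_nonneg_nonneg[OF mult_nonneg_nonneg mult_nonneg_nonneg]) auto
    also have "(\<mu> * x)\<^sup>2 * (24/25 + 21/50 * (\<mu> * x)) + (1 - \<mu>\<^sup>2) * z\<^sup>2 * (24/25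
        + 63/50 * (\<mu> * x))
      = 24/25 * (\<mu>\<^sup>2 * x\<^sup>2 + (1 - \<mu>\<^sup>2) * z\<^sup>2) + 21/100 * (2 * \<mu>^3 * x^3 + 6 * \<mu> * (1 - \<mu>\<^sup>2) * (x * z\<^sup>2))"
      by (simp add: power2_eq_square power3_eq_cube field_simps)
    finally show ?thesis .
  qed
  have "polar_part \<mu> = (24/25 * (\<mu>\<^sup>2 * X1\<^sup>2 + (1 - \<mu>\<^sup>2) * z1\<^sup>2)
        + 21/100 * (2 * \<mu>^3 * X1^3 + 6 * \<mu> * (1 - \<mu>\<^sup>2) * (X1 * z1\<^sup>2)))
    + (24/25 * (\<mu>\<^sup>2 * X2\<^sup>2 + (1 - \<mu>\<^sup>2) * z2\<^sup>2) + 21/100 * (2 * \<mu>^3 * X2^3 + 6 * \<mu> * (1 - \<mu>\<^sup>2) * (X2 * z2\<^sup>2)))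
    + (24/25 * (\<mu>\<^sup>2 * X3\<^sup>2 + (1 - \<mu>\<^sup>2) * z3\<^sup>2) + 21/100 * (2 * \<mu>^3 * X3^3 + 6 * \<mu> * (1 - \<mu>\<^sup>2) * (X3 * z3\<^sup>2)))"
    unfolding polar_part_def zeta_def by (simp add: algebra_simps)
  then show ?thesis using *[OF coordinate_bounds(1), of z1] *[OF coordinate_bounds(2), of z2]
      *[OF coordinate_bounds(3), of z3] by linarith
qed

lemma triangle_part_nonneg:
  assumes "- 1/2 \<le> u1" "- 1/2 \<le> u2" "- 1/2 \<le> u3"
  shows "0 \<le> triangle_part"
proof -
  have *: "0 \<le> 8/25 * u\<^sup>2 + 7/75 * u^3" if "- 1/2 \<le> u" for u :: real
  proof -
    have "0 \<le> u\<^sup>2 * (8/25 + 7/75 * u)" using that by (intro mult_nonneg_nonneg) auto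
    then show ?thesis by (simp add: power2_eq_square power3_eq_cube algebra_simps)
  qed
  show ?thesis unfolding triangle_part_def
    using *[OF assms(1)] *[OF assms(2)] *[OF assms(3)] by argo
qed

text \<open>The cubic \<open>u\<^sup>3\<close> is at least the quadratic polynomial that touches it at \<open>\<mu>\<close> and meets it at the smallest
  admissible \<open>u\<close>, since \<open>(u - \<mu>)\<^sup>2 * (u + v) \<ge> 0\<close> for \<open>u \<ge> - v\<close>.\<close>

lemma triangle_part_ge:
  assumes u: "- (1/2 - 2 * \<mu>\<^sup>2) \<le> u1" "- (1/2 - 2 * \<mu>\<^sup>2) \<le> u2" "- (1/2 - 2 * \<mu>\<^sup>2) \<le> u3"
    and \<beta>: "0 \<le> \<beta>"
  shows "tangent_coeff \<beta> \<mu> * (u1\<^sup>2 + u2\<^sup>2 + u3\<^sup>2)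
      + 7/150 * \<beta> * (2 * \<mu> * (1/2 - 2 * \<mu>\<^sup>2) - \<mu>\<^sup>2) * (w\<^sup>2 + Z\<^sup>2) - 7/25 * \<beta> * \<mu>\<^sup>2 * (1/2 - 2 * \<mu>\<^sup>2)
    \<le> \<beta> * triangle_part"
proof -
  define v where "v = 1/2 - 2 * \<mu>\<^sup>2"
  have *: "(2 * \<mu> - v) * x\<^sup>2
        + (2 * \<mu> * v - \<mu>\<^sup>2) * x - \<mu>\<^sup>2 * v \<le> x^3" if "- v \<le> x" for x
  proof -
    have "0 \<le> (x - \<mu>)\<^sup>2 * (x + v)" using that by (intro mult_nonneg_nonneg) auto
    then show ?thesis by (simp add: power2_eq_square power3_eq_cube algebra_simps)
  qed
  have "(2 * \<mu> - v) * (u1\<^sup>2 + u2\<^sup>2 + u3\<^sup>2) + (2 * \<mu> * v - \<mu>\<^sup>2) * (u1 + u2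
        + u3) - 3 * \<mu>\<^sup>2 * v \<le> u1^3 + u2^3 + u3^3"
    using *[of u1] *[of u2] *[of u3] u unfolding v_def[symmetric] by (simp add: distrib_left)
  then have 1: "\<beta> * (8/25 * (u1\<^sup>2 + u2\<^sup>2 + u3\<^sup>2) + 7/75 * ((2 * \<mu> - v) * (u1\<^sup>2 + u2\<^sup>2 + u3\<^sup>2) + (2 * \<mu> * v - \<mu>\<^sup>2) * (u1 + u2 + u3) - 3 * \<mu>\<^sup>2 * v))
    \<le> \<beta> * triangle_part"
    unfolding triangle_part_def using \<beta> by (intro mult_left_mono) auto
  have eq: "\<beta> * (8/25 * t + 7/75 * ((2 * \<mu> - v) * t
        + (2 * \<mu> * v - \<mu>\<^sup>2) * (r/2) - 3 * \<mu>\<^sup>2 * v))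
    = tangent_coeff \<beta> \<mu> * t + 7/150 * \<beta> * (2 * \<mu> * v - \<mu>\<^sup>2) * r - 7/25 * \<beta> * \<mu>\<^sup>2 * v" for t r
    unfolding tangent_coeff_def v_def[symmetric] by (simp add: field_simps)
  show ?thesis using 1 unfolding u_sum eq v_def[symmetric] .
qed

text \<open>For \<open>w > 9/4\<close> or \<open>zeta > 1\<close> crude estimates suffice. Otherwise \<open>second_moment_bound\<close> with
  \<open>tau = 1\<close> applies; then \<open>Z\<close> occurs only through \<open>Z\<^sup>2\<close> with a nonnegative coefficient, and the remaining
  inequality is \<open>antipodal_form_plus_nonneg\<close>.\<close>

lemma antipodal_bound:
  assumes par: "(c, \<beta>, b, g, \<gamma>) \<in> antipodal_params"
    and \<mu>: "0 \<le> \<mu>" "\<mu> \<le> 1/3"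
    and u: "- (1/2 - 2 * \<mu>\<^sup>2) \<le> u1" "- (1/2 - 2 * \<mu>\<^sup>2) \<le> u2" "- (1/2 - 2 * \<mu>\<^sup>2) \<le> u3"
  shows "(\<mu>\<^sup>2 + w\<^sup>2 + zeta)/1000
    \<le> c * ((W1 + 2 * \<mu>)\<^sup>2 + W2\<^sup>2 + Z\<^sup>2) + polar_part \<mu> + \<beta> * triangle_part + \<gamma> * \<mu>^4
      - b/2 * (w\<^sup>2 + Z\<^sup>2) - 2 * g * \<mu>\<^sup>2" (is "_ \<le> ?F")
proof -
  have pr: "1/2 \<le> c" "c \<le> 1" "0 \<le> \<beta>" "0 \<le> \<gamma>" "b \<le> 2 * c" "0 \<le> b" "0 \<le> g" "g \<le> 7/10"
    using par by (auto simp: antipodal_params_def)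
  have \<mu>2: "0 \<le> \<mu>\<^sup>2" "\<mu>\<^sup>2 \<le> 1/9" using \<mu> power_mono[of \<mu> "1/3" 2] by (auto simp: power2_eq_square)
  have \<mu>4: "0 \<le> \<gamma> * \<mu>^4" using pr by simp
  have "- 1/2 \<le> u1" "- 1/2 \<le> u2" "- 1/2 \<le> u3" using u \<mu>2 by linarith+
  then have t0: "0 \<le> \<beta> * triangle_part" using pr triangle_part_nonneg by simp
  have Z0: "0 \<le> (c - b/2) * Z\<^sup>2" using pr by simp
  have shift: "c * (w - 2 * \<mu>)\<^sup>2 \<le> c * ((W1 + 2 * \<mu>)\<^sup>2 + W2\<^sup>2)"
    using pr shifted_sum_ge[OF \<mu>(1)] by (intro mult_left_mono) auto
  consider "9/4 < w" | "w \<le> 9/4" "1 < zeta" | "w \<le> 9/4" "zeta \<le> 1" by linarith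
  then show ?thesis
  proof cases
    case 1
    have "(19/27 * w)\<^sup>2 \<le> (w - 2 * \<mu>)\<^sup>2" using 1 \<mu> by (intro power_mono) auto
    moreover have "(19/27 * w)\<^sup>2 = 361/729 * w\<^sup>2" by (simp add: power2_eq_square)
    ultimately have shift_scaled: "c * (361/729 * w\<^sup>2) \<le> c * (w - 2 * \<mu>)\<^sup>2"
      using pr by (intro mult_left_mono) auto
    have "(9/4)\<^sup>2 \<le> w\<^sup>2" using 1 by (intro power_mono) auto
    then have w2: "5 \<le> w\<^sup>2" by (simp add: power2_eq_square[of "9/4"])
    have "(\<mu>\<^sup>2 + w\<^sup>2
        + zeta)/1000 \<le> c * (361/729 * w\<^sup>2) - b/2 * w\<^sup>2 - 2 * g * \<mu>\<^sup>2"
      using par unfolding antipodal_params_def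
      by (elim insertE emptyE; simp only: prod.inject; use w2 zeta_le \<mu>2 in argo)
    moreover have "?F = (c * (361/729 * w\<^sup>2) - b/2 * w\<^sup>2 - 2 * g * \<mu>\<^sup>2)
      + (c * ((W1 + 2 * \<mu>)\<^sup>2 + W2\<^sup>2) - c * (361/729 * w\<^sup>2)) + (c - b/2) * Z\<^sup>2
      + polar_part \<mu> + \<beta> * triangle_part + \<gamma> * \<mu>^4"
      by (simp add: field_simps)
    ultimately show ?thesis using shift_scaled polar_part_nonneg[OF \<mu>] t0 \<mu>4 Z0 shift by linarith
  next
    case 2
    have p: "(24/25 - 63/50 * \<mu>) * (1 - \<mu>\<^sup>2) * zeta - 63/200 * \<mu>^3 * (1 + w) \<le> polar_part \<mu>"
    proof -
      have "0 \<le> 24/25 * \<mu>\<^sup>2 * (X1\<^sup>2 + X2\<^sup>2 + X3\<^sup>2)" by simp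
      then show ?thesis using polar_part_ge[of \<mu>] \<mu> by linarith
    qed
    have "27/50 * (8/9) \<le> (24/25 - 63/50 * \<mu>) * (1 - \<mu>\<^sup>2)" using \<mu> \<mu>2 by (intro mult_mono) auto
    then have "12/25 * zeta \<le> (24/25 - 63/50 * \<mu>) * (1 - \<mu>\<^sup>2) * zeta"
      using zeta_nonneg by (intro mult_right_mono) auto
    then have z: "19/40 + zeta/1000 \<le> (24/25 - 63/50 * \<mu>) * (1 - \<mu>\<^sup>2) * zeta"
      using 2 by linarith
    have "\<mu>^3 = \<mu>\<^sup>2 * \<mu>" by (simp add: power2_eq_square power3_eq_cube)
    also have "\<dots> \<le> 1/9 * \<mu>" using \<mu> \<mu>2 by (intro mult_right_mono) auto
    finally have "\<mu>^3 * (1 + w) \<le> 1/9 * \<mu> * (1 + w)" using w_nonneg by (intro mult_right_mono) auto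
    then have cub: "63/200 * \<mu>^3 * (1 + w) \<le> 7/200 * \<mu> * (1 + w)" by simp
    have base: "(\<mu>\<^sup>2 + w\<^sup>2)/1000 + 7/200 * \<mu> * (1
        + w) \<le> c * (w - 2 * \<mu>)\<^sup>2 - b/2 * w\<^sup>2 - 2 * g * \<mu>\<^sup>2 + 19/40"
    proof -
      have 1: "(\<mu>\<^sup>2 + w\<^sup>2)/1000 + 7/200 * \<mu> * (1
        + w) \<le> 1 * (w - 2 * \<mu>)\<^sup>2 - (811/2000)/2 * w\<^sup>2 - 2 * (1733/2500) * \<mu>\<^sup>2 + 19/40"
      proof -
        \<comment> \<open>this square nearly completes the quadratic polynomial in \<open>w\<close>\<close>
        have "(w - 507/200 * \<mu>)\<^sup>2 = w\<^sup>2 - 507/100 * (\<mu> * w) + 257049/40000 * \<mu>\<^sup>2"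
          and "(w - 2 * \<mu>)\<^sup>2 = w\<^sup>2 - 4 * (\<mu> * w) + 4 * \<mu>\<^sup>2"
          and "7/200 * \<mu> * (1 + w) = 7/200 * \<mu> + 7/200 * (\<mu> * w)"
          by (simp_all add: power2_eq_square algebra_simps)
        moreover have "0 \<le> (w - 507/200 * \<mu>)\<^sup>2" "0 \<le> w\<^sup>2" "0 \<le> \<mu> * w" using \<mu> w_nonneg by simp_all
        ultimately show ?thesis using \<mu> \<mu>2 by argo
      qed
      have 2: "(\<mu>\<^sup>2 + w\<^sup>2)/1000 + 7/200 * \<mu> * (1
        + w) \<le> 1/2 * (w - 2 * \<mu>)\<^sup>2 - (1/3)/2 * w\<^sup>2 - 2 * (1/2) * \<mu>\<^sup>2 + 19/40"
      proof -
        \<comment> \<open>this square nearly completes the quadratic polynomial in \<open>w\<close>\<close>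
        have "(w - 31/10 * \<mu>)\<^sup>2 = w\<^sup>2 - 31/5 * (\<mu> * w) + 961/100 * \<mu>\<^sup>2"
          and "(w - 2 * \<mu>)\<^sup>2 = w\<^sup>2 - 4 * (\<mu> * w) + 4 * \<mu>\<^sup>2"
          and "7/200 * \<mu> * (1 + w) = 7/200 * \<mu> + 7/200 * (\<mu> * w)"
          by (simp_all add: power2_eq_square algebra_simps)
        moreover have "0 \<le> (w - 31/10 * \<mu>)\<^sup>2" "0 \<le> w\<^sup>2" "0 \<le> \<mu> * w" using \<mu> w_nonneg by simp_all
        ultimately show ?thesis using \<mu> \<mu>2 by argo
      qed
      show ?thesis using par unfolding antipodal_params_def
        by (elim insertE emptyE; simp only: prod.inject 1 2)+
    qed
    have split: "?F = (c * (w - 2 * \<mu>)\<^sup>2 - b/2 * w\<^sup>2 - 2 * g * \<mu>\<^sup>2)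
      + (c * ((W1 + 2 * \<mu>)\<^sup>2 + W2\<^sup>2) - c * (w - 2 * \<mu>)\<^sup>2) + (c - b/2) * Z\<^sup>2
      + polar_part \<mu> + \<beta> * triangle_part + \<gamma> * \<mu>^4"
      by (simp add: field_simps)
    have add: "(m + v + y)/1000 \<le> f"
      if "f = e1 + (e2 - e3) + e4 + p + e5 + e6" "(m + v)/1000 + r \<le> e1 + 19/40" "g - q \<le> p"
        "19/40 + y/1000 \<le> g" "q \<le> r" "0 \<le> e5" "0 \<le> e6" "0 \<le> e4" "e3 \<le> e2"
      for m v y f e1 e2 e3 e4 e5 e6 p q r g :: real
      using that by argo
    show ?thesis by (rule add[OF split base p z cub t0 \<mu>4 Z0 shift])
  next
    case 3
    have k: "0 \<le> tangent_coeff \<beta> \<mu>" using pr \<mu> by (intro tangent_coeff_nonneg) auto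
    have tau: "(0::real) < 1" "1 * zeta \<le> 1" using 3 by auto
    have m: "(24/25 * \<mu>\<^sup>2
        + tangent_coeff \<beta> \<mu> * (1 - 1 * zeta) * w\<^sup>2) * A - 24/25 * \<mu>\<^sup>2 * W2\<^sup>2
      + tangent_coeff \<beta> \<mu> * (1 * zeta * w^4/3 - w^4/4 + w\<^sup>2 * Z\<^sup>2/6 - Z\<^sup>2 * (1/1 - zeta))
      \<le> 24/25 * \<mu>\<^sup>2 * (X1\<^sup>2 + X2\<^sup>2 + X3\<^sup>2) + tangent_coeff \<beta> \<mu> * (u1\<^sup>2 + u2\<^sup>2 + u3\<^sup>2)"
      using second_moment_bound[of "24/25 * \<mu>\<^sup>2" "tangent_coeff \<beta> \<mu>" 1] k tau by simp
    have "24/25 * \<mu>\<^sup>2 * w \<le> 24/25 * (\<mu> * (1/3)) * (9/4)"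
      using \<mu> 3 w_nonneg unfolding power2_eq_square by (intro mult_mono) auto
    also have "\<dots> \<le> \<mu>" using \<mu> by simp
    also have "\<dots> \<le> 2 * (c * \<mu>)" using mult_right_mono[of "1/2" c \<mu>] pr \<mu> by simp
    finally have tilt: "24/25 * \<mu>\<^sup>2 * W2\<^sup>2 \<le> 4 * (c * \<mu>) * (W1 + w)"
      by (intro tilt_absorption) auto
    have sq: "(W1 + 2 * \<mu>)\<^sup>2 + W2\<^sup>2 = w\<^sup>2 + 4 * \<mu> * W1 + 4 * \<mu>\<^sup>2"
      unfolding w_squared by (simp add: power2_eq_square algebra_simps)
    define l where "l = 7/150 * \<beta> * (2 * \<mu> * (1/2 - 2 * \<mu>\<^sup>2) - \<mu>\<^sup>2)"
    have l: "0 \<le> l"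
    proof -
      have "0 \<le> \<mu> * (1 - \<mu> - 4 * \<mu>\<^sup>2)" using \<mu> \<mu>2 by (intro mult_nonneg_nonneg) auto
      then show ?thesis unfolding l_def using pr by (intro mult_nonneg_nonneg) (auto simp: power2_eq_square algebra_simps)
    qed
    have Zc: "0 \<le> Z\<^sup>2 * (c - b/2 + l - tangent_coeff \<beta> \<mu> * (1 - zeta)
        + tangent_coeff \<beta> \<mu> * w\<^sup>2/6)"
    proof -
      have "tangent_coeff \<beta> \<mu> \<le> \<beta> * (8/25 + 7/75 * (2 * (1/3) - (1/2 - 2 * (1/9))))"
        unfolding tangent_coeff_def using \<mu> \<mu>2 pr by (intro mult_left_mono add_mono diff_mono) auto
      also have "\<dots> \<le> c - b/2" using par by (auto simp: antipodal_params_def)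
      finally have "tangent_coeff \<beta> \<mu> \<le> c - b/2" .
      moreover have "0 \<le> tangent_coeff \<beta> \<mu> * zeta" using k zeta_nonneg by simp
      moreover have "0 \<le> tangent_coeff \<beta> \<mu> * w\<^sup>2/6" using k by simp
      ultimately have "0 \<le> c - b/2 + l - tangent_coeff \<beta> \<mu> * (1 - zeta) + tangent_coeff \<beta> \<mu> * w\<^sup>2/6"
        using l by (simp add: right_diff_distrib)
      then show ?thesis by simp
    qed
    define k where "k = tangent_coeff \<beta> \<mu>"
    have "c * (w\<^sup>2 + 4 * \<mu> * W1 + 4 * \<mu>\<^sup>2 + Z\<^sup>2) + p + r + \<gamma> * \<mu>^4
      - b/2 * (w\<^sup>2 + Z\<^sup>2) - 2 * g * \<mu>\<^sup>2 - (\<mu>\<^sup>2 + w\<^sup>2 + zeta)/1000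
    = antipodal_form c \<beta> b g \<gamma> \<mu> zeta w
      + (v + k * (1 * zeta * w^4/3 - w^4/4))
      + Z\<^sup>2 * (c - b/2 + l - k * (1 - zeta) + k * w\<^sup>2/6)
      + (24/25 * \<mu>\<^sup>2 * x + k * y - (v - 24/25 * \<mu>\<^sup>2 * W2\<^sup>2
        + k * (1 * zeta * w^4/3 - w^4/4 + w\<^sup>2 * Z\<^sup>2/6 - Z\<^sup>2 * (1/1 - zeta))))
      + (4 * (c * \<mu>) * (W1 + w) - 24/25 * \<mu>\<^sup>2 * W2\<^sup>2)
      + (p - (24/25 * \<mu>\<^sup>2 * x + (24/25 - 63/50 * \<mu>) * (1 - \<mu>\<^sup>2) * zeta - 63/200 * \<mu>^3 * (1 + w)))
      + (r - (k * y + l * (w\<^sup>2 + Z\<^sup>2) - 7/25 * \<beta> * \<mu>\<^sup>2 * (1/2 - 2 * \<mu>\<^sup>2)))" for p r v x y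
      unfolding antipodal_form_def l_def[symmetric] by (simp add: field_simps)
    note eq = this[of "polar_part \<mu>" "\<beta> * triangle_part"
        "(24/25 * \<mu>\<^sup>2 + k * (1 - 1 * zeta) * w\<^sup>2) * A" "X1\<^sup>2 + X2\<^sup>2
        + X3\<^sup>2" "u1\<^sup>2 + u2\<^sup>2 + u3\<^sup>2"]
    have main: "0 \<le> antipodal_form c \<beta> b g \<gamma> \<mu> zeta w
      + ((24/25 * \<mu>\<^sup>2 + k * (1 - 1 * zeta) * w\<^sup>2) * A + k * (1 * zeta * w^4/3 - w^4/4))"
      unfolding A_def k_def using antipodal_form_plus_nonneg[OF par \<mu> w_nonneg 3(1) zeta_nonneg 3(2)] .
    have add: "d \<le> f" if "f - d = e1 + e2 + (m - n) + (n' - m') + (p - p') + (r - r')"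
      "0 \<le> e1" "0 \<le> e2" "n \<le> m" "m' \<le> n'" "p' \<le> p" "r' \<le> r" for d f e1 e2 m n m' n' p p' r r' :: real
      using that by linarith
    have polar: "24/25 * \<mu>\<^sup>2 * (X1\<^sup>2 + X2\<^sup>2 + X3\<^sup>2)
        + (24/25 - 63/50 * \<mu>) * (1 - \<mu>\<^sup>2) * zeta
      - 63/200 * \<mu>^3 * (1 + w) \<le> polar_part \<mu>"
      using polar_part_ge \<mu> by simp
    show ?thesis
      unfolding sq
      by (rule add[OF eq main Zc[folded k_def] m[folded k_def] tilt polar
            triangle_part_ge[OF u pr(3), folded l_def k_def]])
  qed
qed

text \<open>The sum of the squared scalar products over all ten pairs.\<close>

definition product_squares :: "real \<Rightarrow> real" where
  "product_squares \<mu> = 2 * (\<mu>\<^sup>2 * (X1\<^sup>2 + X2\<^sup>2 + X3\<^sup>2) + (1 - \<mu>\<^sup>2) * zeta)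
    + ((u1 - 1/2)\<^sup>2 + (u2 - 1/2)\<^sup>2 + (u3 - 1/2)\<^sup>2) + (2 * \<mu>\<^sup>2 - 1)\<^sup>2"

text \<open>The squared Frobenius norm of the matrix \<open>M\<close> formed by summing \<open>P P\<^sup>T\<close> over the five points is \<open>5\<close>
  plus twice the sum in question. \<open>M\<close> has trace \<open>5\<close>, and its entry along the third axis is
  \<open>2 * (1 - \<mu>\<^sup>2) + zeta\<close>; the other two diagonal entries are balanced at best.\<close>

lemma product_squares_ge:
  "5/3 + 3/4 * (2 * (1 - \<mu>\<^sup>2) + zeta - 5/3)\<^sup>2 \<le> product_squares \<mu>"
proof -
  define a where "a = X1\<^sup>2 + X2\<^sup>2 + X3\<^sup>2"
  define b where "b = Y1\<^sup>2 + Y2\<^sup>2 + Y3\<^sup>2"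
  have ab: "a + b = 3 - zeta" using horizontal_sum_squares by (simp add: a_def b_def)
  have gram: "3 + 2 * ((u1 - 1/2)\<^sup>2 + (u2 - 1/2)\<^sup>2 + (u3 - 1/2)\<^sup>2)
    = a\<^sup>2 + b\<^sup>2 + zeta\<^sup>2 + 2 * ((X1 * Y1 + X2 * Y2 + X3 * Y3)\<^sup>2 + (X1 * z1 + X2 * z2 + X3 * z3)\<^sup>2
      + (Y1 * z1 + Y2 * z2 + Y3 * z3)\<^sup>2)"
  proof -
    have "(X1\<^sup>2 + Y1\<^sup>2 + z1\<^sup>2)\<^sup>2 + (X2\<^sup>2 + Y2\<^sup>2 + z2\<^sup>2)\<^sup>2
        + (X3\<^sup>2 + Y3\<^sup>2 + z3\<^sup>2)\<^sup>2
      + 2 * ((u1 - 1/2)\<^sup>2 + (u2 - 1/2)\<^sup>2 + (u3 - 1/2)\<^sup>2)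
      = a\<^sup>2 + b\<^sup>2 + zeta\<^sup>2 + 2 * ((X1 * Y1 + X2 * Y2 + X3 * Y3)\<^sup>2 + (X1 * z1 + X2 * z2 + X3 * z3)\<^sup>2
      + (Y1 * z1 + Y2 * z2 + Y3 * z3)\<^sup>2)"
      unfolding a_def b_def zeta_def u1_def u2_def u3_def
      by (simp add: power2_eq_square algebra_simps)
    then show ?thesis unfolding unit by simp
  qed
  define m where "m = \<mu>\<^sup>2"
  have "5 + 2 * product_squares \<mu>
    = (a + 2 * m)\<^sup>2 + b\<^sup>2 + (2 * (1 - m) + zeta)\<^sup>2 + 2 * ((X1 * Y1 + X2 * Y2 + X3 * Y3)\<^sup>2
      + (X1 * z1 + X2 * z2 + X3 * z3)\<^sup>2 + (Y1 * z1 + Y2 * z2 + Y3 * z3)\<^sup>2)"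
    using gram unfolding product_squares_def a_def[symmetric] m_def[symmetric]
    by (simp add: power2_eq_square algebra_simps)
  moreover have "0 \<le> 2 * ((X1 * Y1 + X2 * Y2 + X3 * Y3)\<^sup>2
      + (X1 * z1 + X2 * z2 + X3 * z3)\<^sup>2 + (Y1 * z1 + Y2 * z2 + Y3 * z3)\<^sup>2)" by simp
  moreover have "2 * ((a + 2 * m)\<^sup>2 + b\<^sup>2) = (a + 2 * m + b)\<^sup>2 + (a + 2 * m - b)\<^sup>2"
    by (simp add: power2_eq_square algebra_simps)
  moreover have "0 \<le> (a + 2 * m - b)\<^sup>2" by simp
  moreover have "a + 2 * m + b = 5 - (2 * (1 - m) + zeta)" using ab by simp
  moreover have "(5 - n)\<^sup>2 + 2 * n\<^sup>2 = 50/3 + 3 * (n - 5/3)\<^sup>2" for n :: real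
    by (simp add: power2_eq_square field_simps)
  ultimately have "10 + 4 * product_squares \<mu> \<ge> 50/3 + 3 * (2 * (1 - m) + zeta - 5/3)\<^sup>2"
    by (smt (verit))
  then show ?thesis unfolding m_def by simp
qed

text \<open>As in \<open>antipodal_bound\<close>, but with a splitting parameter adapted to the weight \<open>c\<close>: the coefficient of
  \<open>Z\<^sup>2\<close> is nonnegative because of \<open>1/\<tau> \<le> c - 1/2\<close>.\<close>

lemma product_squares_ge_near_optimum:
  assumes par: "(c, P, \<tau>, t, lo, hi) \<in> bent_params" and \<mu>: "lo \<le> \<mu>" "\<mu> \<le> hi"
    and w: "w \<le> 3/2" and z: "zeta \<le> 1/3"
  shows "P + 1/10000 \<le> product_squares \<mu> + c * ((W1 + 2 * \<mu>)\<^sup>2 + W2\<^sup>2 + Z\<^sup>2)"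
proof -
  have "1 \<le> c \<and> 1/3 \<le> \<tau> \<and> \<tau> \<le> 3 \<and> 1/\<tau> \<le> c - 1/2 \<and> 0 \<le> lo \<and> hi \<le> 1/2"
    using par unfolding bent_params_def by (elim insertE emptyE; simp only: prod.inject; simp)
  then have pr: "1 \<le> c" "1/3 \<le> \<tau>" "\<tau> \<le> 3" "1/\<tau> \<le> c - 1/2" "0 \<le> lo" "hi \<le> 1/2"
    by simp_all
  have \<mu>2: "0 \<le> \<mu>" "\<mu> \<le> 1/2" using pr \<mu> by auto
  have "\<tau> * zeta \<le> 3 * (1/3)" using pr z zeta_nonneg by (intro mult_mono) auto
  then have tau: "0 < \<tau>" "\<tau> * zeta \<le> 1" using pr by auto
  have m: "(2 * \<mu>\<^sup>2 + 1 * (1 - \<tau> * zeta) * w\<^sup>2) * A - 2 * \<mu>\<^sup>2 * W2\<^sup>2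
      + 1 * (\<tau> * zeta * w^4/3 - w^4/4 + w\<^sup>2 * Z\<^sup>2/6 - Z\<^sup>2 * (1/\<tau> - zeta))
      \<le> 2 * \<mu>\<^sup>2 * (X1\<^sup>2 + X2\<^sup>2 + X3\<^sup>2) + 1 * (u1\<^sup>2 + u2\<^sup>2 + u3\<^sup>2)"
    using second_moment_bound[of "2 * \<mu>\<^sup>2" 1 \<tau>] tau by simp
  have "2 * \<mu>\<^sup>2 * w = 2 * \<mu> * (\<mu> * w)" by (simp add: power2_eq_square)
  also have "\<dots> \<le> 2 * \<mu> * (1/2 * (3/2))" using \<mu>2 w w_nonneg by (intro mult_left_mono mult_mono) auto
  also have "\<dots> \<le> 2 * (c * \<mu>)" using mult_right_mono[OF pr(1), of \<mu>] \<mu>2 by simp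
  finally have tilt: "2 * \<mu>\<^sup>2 * W2\<^sup>2 \<le> 4 * (c * \<mu>) * (W1 + w)"
    by (intro tilt_absorption) auto
  have sq: "(W1 + 2 * \<mu>)\<^sup>2 + W2\<^sup>2 = w\<^sup>2 + 4 * \<mu> * W1 + 4 * \<mu>\<^sup>2"
    unfolding w_squared by (simp add: power2_eq_square algebra_simps)
  have usq: "(u1 - 1/2)\<^sup>2 + (u2 - 1/2)\<^sup>2 + (u3 - 1/2)\<^sup>2 = u1\<^sup>2 + u2\<^sup>2
        + u3\<^sup>2 - (w\<^sup>2 + Z\<^sup>2)/2 + 3/4"
    unfolding u_sum[symmetric] by (simp add: power2_eq_square field_simps)
  have p: "(2 * \<mu>\<^sup>2 - 1)\<^sup>2 = (1 - 2 * \<mu>\<^sup>2)\<^sup>2" by (simp add: power2_commute)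
  have "0 \<le> c - 1/2 - 1/\<tau> + zeta + w\<^sup>2/6" using pr(4) zeta_nonneg by simp
  then have Zc: "0 \<le> Z\<^sup>2 * (c - 1/2 - 1/\<tau> + zeta + w\<^sup>2/6)" by simp
  have "(2 * (\<mu>\<^sup>2 * x + (1 - \<mu>\<^sup>2) * zeta) + (y - (w\<^sup>2 + Z\<^sup>2)/2 + 3/4)
        + (1 - 2 * \<mu>\<^sup>2)\<^sup>2)
      + c * (w\<^sup>2 + 4 * \<mu> * W1 + 4 * \<mu>\<^sup>2 + Z\<^sup>2) - (P + 1/10000)
    = bent_form c P \<mu> zeta w
      + (v + 1 * (\<tau> * zeta * w^4/3 - w^4/4))
      + Z\<^sup>2 * (c - 1/2 - 1/\<tau> + zeta + w\<^sup>2/6)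
      + (2 * \<mu>\<^sup>2 * x + 1 * y - (v - 2 * \<mu>\<^sup>2 * W2\<^sup>2
      + 1 * (\<tau> * zeta * w^4/3 - w^4/4 + w\<^sup>2 * Z\<^sup>2/6 - Z\<^sup>2 * (1/\<tau> - zeta))))
      + (4 * (c * \<mu>) * (W1 + w) - 2 * \<mu>\<^sup>2 * W2\<^sup>2)" for x y v
    unfolding bent_form_def by (simp add: diff_divide_distrib add_divide_distrib algebra_simps)
  note eq = this[of "X1\<^sup>2 + X2\<^sup>2 + X3\<^sup>2" "u1\<^sup>2 + u2\<^sup>2 + u3\<^sup>2" "(2 * \<mu>\<^sup>2 + 1 * (1 - \<tau> * zeta) * w\<^sup>2) * A"]
  have "0 \<le> bent_form c P \<mu> zeta w
      + ((2 * \<mu>\<^sup>2 + 1 * (1 - \<tau> * zeta) * w\<^sup>2) * A + 1 * (\<tau> * zeta * w^4/3 - w^4/4))"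
    unfolding A_def using bent_form_plus_nonneg[OF par \<mu> w_nonneg w zeta_nonneg z] .
  then have "0 \<le> product_squares \<mu> + c * ((W1 + 2 * \<mu>)\<^sup>2 + W2\<^sup>2 + Z\<^sup>2) - (P + 1/10000)"
    unfolding product_squares_def usq p sq using eq Zc m tilt by linarith
  then show ?thesis by simp
qed

text \<open>The bound \<open>product_squares_ge\<close> suffices if the five points are far from balanced (\<open>w\<close> large) or the
  triangle is far from the horizontal plane (\<open>zeta\<close> large). Otherwise
  \<open>product_squares_ge_near_optimum\<close> is used; for the two upper ranges of \<open>\<mu>\<close> it is averaged with the
  bound \<open>5/3\<close>, with weights \<open>13/20\<close> and \<open>2/5\<close>, which is what makes the large weights \<open>c\<close> possible
  there.\<close>

lemma product_squares_gt:
  assumes "(lo, hi, P, C) \<in> {(1/3, 221/625, 353/200, 149/100), (707/2000, 4083/10000, 349/200, 147/100),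
      (2041/5000, 4473/10000, 1711/1000, 71/50), (559/1250, 943/2000, 421/250, 69/50)}"
    and \<mu>: "lo \<le> \<mu>" "\<mu> \<le> hi"
  shows "P < product_squares \<mu> + C * ((W1 + 2 * \<mu>)\<^sup>2 + W2\<^sup>2 + Z\<^sup>2)"
proof -
  define d where "d = (W1 + 2 * \<mu>)\<^sup>2 + W2\<^sup>2 + Z\<^sup>2"
  define p where "p = product_squares \<mu>"
  have \<mu>0: "0 \<le> \<mu>" "\<mu> \<le> 943/2000" using assms by auto
  have d: "(w - 2 * \<mu>)\<^sup>2 \<le> d" using shifted_sum_ge[OF \<mu>0(1)] by (simp add: d_def add_increasing2)
  have d0: "0 \<le> d" by (simp add: d_def)
  have "5/3 + 3/4 * (2 * (1 - \<mu>\<^sup>2)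
        + zeta - 5/3)\<^sup>2 \<le> p" unfolding p_def by (rule product_squares_ge)
  moreover have "0 \<le> 3/4 * (2 * (1 - \<mu>\<^sup>2) + zeta - 5/3)\<^sup>2" by simp
  ultimately have p0: "5/3 \<le> p" by linarith
  have C: "69/50 \<le> C" "P \<le> 353/200" using assms(1) by auto
  consider "3/2 < w" | "1/3 < zeta" | "w \<le> 3/2" "zeta \<le> 1/3" by linarith
  then have "P < p + C * d"
  proof cases
    case 1
    have "(1/2)\<^sup>2 \<le> (w - 2 * \<mu>)\<^sup>2" using 1 \<mu>0 by (intro power_mono) auto
    then have "1/4 \<le> d" using d by (simp add: power2_eq_square)
    then have "69/50 * (1/4) \<le> C * d" using C by (intro mult_mono) auto
    then show ?thesis using C p0 by linarith
  next
    case 2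
    have "\<mu>\<^sup>2 \<le> hi\<^sup>2" using \<mu> \<mu>0 by (intro power_mono) auto
    moreover have hi: "0 \<le> 2/3 - 2 * hi\<^sup>2" "P < 5/3 + 3/4 * (2/3 - 2 * hi\<^sup>2)\<^sup>2"
      using assms(1) by (elim insertE emptyE; simp only: prod.inject; simp add: power2_eq_square)+
    ultimately have "(2/3 - 2 * hi\<^sup>2)\<^sup>2 \<le> (2 * (1 - \<mu>\<^sup>2) + zeta - 5/3)\<^sup>2"
      using 2 by (intro power_mono) auto
    moreover have "0 \<le> C * d" using C d0 by simp
    ultimately show ?thesis
      using hi product_squares_ge[of \<mu>] unfolding p_def[symmetric] by linarith
  next
    case near: 3
    consider "lo = 1/3" "hi = 221/625" "P = 353/200" "C = 149/100"
      | "lo = 707/2000" "hi = 4083/10000" "P = 349/200" "C = 147/100"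
      | "lo = 2041/5000" "hi = 4473/10000" "P = 1711/1000" "C = 71/50"
      | "lo = 559/1250" "hi = 943/2000" "P = 421/250" "C = 69/50"
      using assms(1) by auto
    then show ?thesis
    proof cases
      case 1
      have "353/200 + 1/10000 \<le> p + 149/100 * d"
        using product_squares_ge_near_optimum[of "149/100" "353/200" "51/50" "0" "1/3" "221/625" \<mu>, OF _ _ _ near] \<mu>
        unfolding 1 d_def p_def by (simp add: bent_params_def)
      then show ?thesis unfolding 1 by linarith
    next
      case 2
      have "349/200 + 1/10000 \<le> p + 147/100 * d"
        using product_squares_ge_near_optimum[of "147/100" "349/200" "26/25" "3/20" "707/2000" "4083/10000" \<mu>, OF _ _ _ near] \<mu>
        unfolding 2 d_def p_def by (simp add: bent_params_def)
      then show ?thesis unfolding 2 by linarith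
    next
      case 3
      have "3383/1950 + 1/10000 \<le> p + 142/65 * d"
        using product_squares_ge_near_optimum[of "142/65" "3383/1950" "3/5" "3/20" "2041/5000" "4473/10000" \<mu>, OF _ _ _ near] \<mu>
        unfolding 3 d_def p_def by (simp add: bent_params_def)
      then show ?thesis using p0 unfolding 3 by argo
    next
      case 4
      have "171/100 + 1/10000 \<le> p + 69/20 * d"
        using product_squares_ge_near_optimum[of "69/20" "171/100" "9/25" "3/20" "559/1250" "943/2000" \<mu>, OF _ _ _ near] \<mu>
        unfolding 4 d_def p_def by (simp add: bent_params_def)
      then show ?thesis using p0 unfolding 4 by argo
    qed
  qed
  then show ?thesis unfolding p_def d_def .
qed

end

section \<open>The transformed energy of a configuration\<close>

lemma polar_product_le:
  assumes "x\<^sup>2 + y\<^sup>2 + z\<^sup>2 = 1" "\<mu>\<^sup>2 + \<nu>\<^sup>2 = 1"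
  shows "\<mu> * x + \<nu> * z \<le> 1" "\<mu> * x - \<nu> * z \<le> (1::real)"
proof -
  have "0 \<le> (\<mu> - x)\<^sup>2 + (\<nu> - z)\<^sup>2 + y\<^sup>2" "0 \<le> (\<mu> - x)\<^sup>2 + (\<nu>
        + z)\<^sup>2 + y\<^sup>2" by simp_all
  then show "\<mu> * x + \<nu> * z \<le> 1" "\<mu> * x - \<nu> * z \<le> 1"
    using assms by (simp_all add: power2_eq_square algebra_simps)
qed

context three_unit_vectors
begin

text \<open>The sum of \<open>phi q\<close> over the ten pairs, if the farthest pair is \<open>(\<mu>, 0, \<nu>)\<close> and \<open>(\<mu>, 0, - \<nu>)\<close>.\<close>

definition phi_sum :: "real \<Rightarrow> real \<Rightarrow> real \<Rightarrow> real" where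
  "phi_sum q \<mu> \<nu> = (phi q (\<mu> * X1 + \<nu> * z1) + phi q (\<mu> * X1 - \<nu> * z1))
    + (phi q (\<mu> * X2 + \<nu> * z2) + phi q (\<mu> * X2 - \<nu> * z2))
    + (phi q (\<mu> * X3 + \<nu> * z3) + phi q (\<mu> * X3 - \<nu> * z3))
    + (phi q (u1 - 1/2) + phi q (u2 - 1/2) + phi q (u3 - 1/2)) + phi q (2 * \<mu>\<^sup>2 - 1)"

definition pairs_ge :: "real \<Rightarrow> real \<Rightarrow> real \<Rightarrow> bool" where
  "pairs_ge \<mu> \<nu> a \<longleftrightarrow> a \<le> \<mu> * X1 + \<nu> * z1 \<and> a \<le> \<mu> * X1 - \<nu> * z1 \<and> a \<le> \<mu> * X2 + \<nu> * z2
    \<and> a \<le> \<mu> * X2 - \<nu> * z2 \<and> a \<le> \<mu> * X3 + \<nu> * z3 \<and> a \<le> \<mu> * X3 - \<nu> * z3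
    \<and> a \<le> u1 - 1/2 \<and> a \<le> u2 - 1/2 \<and> a \<le> u3 - 1/2"

lemma triangle_product_le: "u1 - 1/2 \<le> 1" "u2 - 1/2 \<le> 1" "u3 - 1/2 \<le> 1"
proof -
  have *: "a * a' + b * b' + c * c' \<le> 1" if "a\<^sup>2 + b\<^sup>2 + c\<^sup>2 = 1" "a'\<^sup>2
        + b'\<^sup>2 + c'\<^sup>2 = 1"
    for a b c a' b' c' :: real
  proof -
    have "0 \<le> (a - a')\<^sup>2 + (b - b')\<^sup>2 + (c - c')\<^sup>2" by simp
    then show ?thesis using that by (simp add: power2_eq_square algebra_simps)
  qed
  show "u1 - 1/2 \<le> 1" "u2 - 1/2 \<le> 1" "u3 - 1/2 \<le> 1"
    unfolding u1_def u2_def u3_def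
    using *[OF unit(2) unit(3)] *[OF unit(1) unit(3)] *[OF unit(1) unit(2)] by simp_all
qed

text \<open>With \<open>e = 1 - q\<close>, \<open>\<beta> = (2/3) powr e\<close>, \<open>\<gamma> = (1/2) powr e\<close> and \<open>d\<close> the squared length of the sum of the five
  points, the expansions at \<open>0\<close>, \<open>- 1/2\<close> and \<open>- 1\<close> give \<open>d/2\<close>, minus multiples of \<open>1 - \<beta>\<close> and \<open>1 - \<gamma>\<close>, plus \<open>e\<close>
  times the cubic corrections. After the bounds for \<open>\<beta>\<close> and \<open>\<gamma>\<close> everything except \<open>d/2\<close> has the factor \<open>e\<close> and
  splits into \<open>e * (1 - e)\<close> and \<open>e\<^sup>2\<close> times the two polynomials of \<open>antipodal_bound\<close>. The amount
  \<open>d/2 \<ge> e * (1 - e) * d + e\<^sup>2 * d/2\<close> pays for their \<open>d\<close>-terms.\<close>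

lemma phi_sum_antipodal:
  assumes q: "0 < q" "q < 1" and \<mu>: "0 \<le> \<mu>" "\<mu> \<le> 1/3" and \<nu>: "\<mu>\<^sup>2 + \<nu>\<^sup>2 = 1"
    and low: "pairs_ge \<mu> \<nu> (2 * \<mu>\<^sup>2 - 1)"
  shows "3 * phi q (- (1/2)) + phi q (- 1) + (1 - q) * ((\<mu>\<^sup>2 + w\<^sup>2
        + zeta)/1000) \<le> phi_sum q \<mu> \<nu>"
proof -
  define e where "e = 1 - q"
  have e: "0 \<le> e" "e \<le> 1" using q by (auto simp: e_def)
  define \<beta> where "\<beta> = (2/3::real) powr e"
  define \<gamma> where "\<gamma> = (1/2::real) powr e"
  have \<mu>2: "0 \<le> \<mu>\<^sup>2" "\<mu>\<^sup>2 \<le> 1/9" using \<mu> power_mono[of \<mu> "1/3" 2] by (auto simp: power2_eq_square)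
  have u: "- (1/2 - 2 * \<mu>\<^sup>2) \<le> u1" "- (1/2 - 2 * \<mu>\<^sup>2) \<le> u2" "- (1/2 - 2 * \<mu>\<^sup>2) \<le> u3"
    using low by (auto simp: pairs_ge_def)
  have u': "- 1/2 \<le> u1" "- 1/2 \<le> u2" "- 1/2 \<le> u3" using u \<mu>2 by linarith+
  have c: "v + e * (12/25 * v\<^sup>2 + 21/100 * v^3) \<le> phi q v" if "- 1 \<le> v" "v \<le> 1" for v
    using phi_cubic_minorant[OF q that] by (simp add: e_def)
  have polar: "2 * (\<mu> * x) + e * (24/25 * (\<mu>\<^sup>2 * x\<^sup>2 + (1 - \<mu>\<^sup>2) * z\<^sup>2)
      + 21/100 * (2 * \<mu>^3 * x^3 + 6 * \<mu> * (1 - \<mu>\<^sup>2) * (x * z\<^sup>2)))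
    \<le> phi q (\<mu> * x + \<nu> * z) + phi q (\<mu> * x - \<nu> * z)"
    if "x\<^sup>2 + y\<^sup>2 + z\<^sup>2 = 1" "2 * \<mu>\<^sup>2 - 1 \<le> \<mu> * x + \<nu> * z" "2 * \<mu>\<^sup>2 - 1 \<le> \<mu> * x - \<nu> * z" for x y z
  proof -
    have \<nu>2: "1 - \<mu>\<^sup>2 = \<nu>\<^sup>2" using \<nu> by simp
    have "2 * (\<mu> * x) + e * (24/25 * (\<mu>\<^sup>2 * x\<^sup>2 + (1 - \<mu>\<^sup>2) * z\<^sup>2)
      + 21/100 * (2 * \<mu>^3 * x^3 + 6 * \<mu> * (1 - \<mu>\<^sup>2) * (x * z\<^sup>2)))
      = ((\<mu> * x + \<nu> * z) + e * (12/25 * (\<mu> * x + \<nu> * z)\<^sup>2 + 21/100 * (\<mu> * x + \<nu> * z)^3))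
      + ((\<mu> * x - \<nu> * z) + e * (12/25 * (\<mu> * x - \<nu> * z)\<^sup>2 + 21/100 * (\<mu> * x - \<nu> * z)^3))"
      unfolding \<nu>2 by (simp add: power2_eq_square power3_eq_cube field_simps)
    also have "\<dots> \<le> phi q (\<mu> * x + \<nu> * z) + phi q (\<mu> * x - \<nu> * z)"
      using that \<mu>2 polar_product_le[OF that(1) \<nu>] by (intro add_mono c) linarith+
    finally show ?thesis .
  qed
  have "2 * (\<mu> * W1) + e * polar_part \<mu>
    = (2 * (\<mu> * X1) + e * (24/25 * (\<mu>\<^sup>2 * X1\<^sup>2 + (1 - \<mu>\<^sup>2) * z1\<^sup>2)
      + 21/100 * (2 * \<mu>^3 * X1^3 + 6 * \<mu> * (1 - \<mu>\<^sup>2) * (X1 * z1\<^sup>2))))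
    + (2 * (\<mu> * X2) + e * (24/25 * (\<mu>\<^sup>2 * X2\<^sup>2 + (1 - \<mu>\<^sup>2) * z2\<^sup>2)
      + 21/100 * (2 * \<mu>^3 * X2^3 + 6 * \<mu> * (1 - \<mu>\<^sup>2) * (X2 * z2\<^sup>2))))
    + (2 * (\<mu> * X3) + e * (24/25 * (\<mu>\<^sup>2 * X3\<^sup>2 + (1 - \<mu>\<^sup>2) * z3\<^sup>2)
      + 21/100 * (2 * \<mu>^3 * X3^3 + 6 * \<mu> * (1 - \<mu>\<^sup>2) * (X3 * z3\<^sup>2))))"
    unfolding polar_part_def W1_def zeta_def by (simp add: algebra_simps)
  also have "\<dots> \<le> (phi q (\<mu> * X1 + \<nu> * z1) + phi q (\<mu> * X1 - \<nu> * z1))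
    + (phi q (\<mu> * X2 + \<nu> * z2) + phi q (\<mu> * X2 - \<nu> * z2))
    + (phi q (\<mu> * X3 + \<nu> * z3) + phi q (\<mu> * X3 - \<nu> * z3))"
    using low unfolding pairs_ge_def
    by (intro add_mono polar[OF unit(1)] polar[OF unit(2)] polar[OF unit(3)]) auto
  finally have 1: "2 * (\<mu> * W1) + e * polar_part \<mu> \<le> (phi q (\<mu> * X1 + \<nu> * z1)
        + phi q (\<mu> * X1 - \<nu> * z1))
    + (phi q (\<mu> * X2 + \<nu> * z2) + phi q (\<mu> * X2 - \<nu> * z2))
    + (phi q (\<mu> * X3 + \<nu> * z3) + phi q (\<mu> * X3 - \<nu> * z3))" .
  have pw: "(3/2::real) powr q = 3/2 * \<beta>" "(2::real) powr q = 2 * \<gamma>"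
    unfolding \<beta>_def \<gamma>_def e_def powr_diff
    by (simp_all add: powr_divide field_simps)
  have tri: "phi q (- (1/2)) + \<beta> * x + e * (\<beta> * (8/25 * x\<^sup>2 + 7/75 * x^3)) \<le> phi q (x - 1/2)"
    if "- 1/2 \<le> x" "x - 1/2 \<le> 1" for x
  proof -
    have "phi q (x - 1/2) = phi q (- (1/2)) + 3/2 * \<beta> * phi q (2/3 * x)"
      using phi_rescale[of q "3/2" "2/3 * x"] q that by (simp add: pw algebra_simps)
    moreover have "3/2 * \<beta> * (2/3 * x + e * (12/25 * (2/3 * x)\<^sup>2 + 21/100 * (2/3 * x)^3))
        \<le> 3/2 * \<beta> * phi q (2/3 * x)"
      using that by (intro mult_left_mono c) (auto simp: \<beta>_def)
    moreover have "3/2 * \<beta> * (2/3 * x + e * (12/25 * (2/3 * x)\<^sup>2 + 21/100 * (2/3 * x)^3))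
      = \<beta> * x + e * (\<beta> * (8/25 * x\<^sup>2 + 7/75 * x^3))"
      by (simp add: power2_eq_square power3_eq_cube field_simps)
    ultimately show ?thesis by linarith
  qed
  have 2: "3 * phi q (- (1/2)) + \<beta> * ((w\<^sup>2 + Z\<^sup>2)/2) + e * (\<beta> * triangle_part)
      \<le> phi q (u1 - 1/2) + phi q (u2 - 1/2) + phi q (u3 - 1/2)"
    using tri[OF u'(1) triangle_product_le(1)] tri[OF u'(2) triangle_product_le(2)]
      tri[OF u'(3) triangle_product_le(3)]
    unfolding u_sum[symmetric] triangle_part_def by (simp add: algebra_simps)
  have 3: "phi q (- 1) + 2 * \<gamma> * \<mu>\<^sup>2 + e * (\<gamma> * \<mu>^4) \<le> phi q (2 * \<mu>\<^sup>2 - 1)"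
  proof -
    have "phi q (2 * \<mu>\<^sup>2 - 1) = phi q (- 1) + 2 * \<gamma> * phi q (\<mu>\<^sup>2)"
      using phi_rescale[of q 2 "\<mu>\<^sup>2"] q \<mu>2 by (simp add: pw algebra_simps)
    moreover have "2 * \<gamma> * (\<mu>\<^sup>2 + e * ((\<mu>\<^sup>2)\<^sup>2/2)) \<le> 2 * \<gamma> * phi q (\<mu>\<^sup>2)"
      using phi_quadratic_nonneg[OF q, of "\<mu>\<^sup>2"] \<mu>2 by (intro mult_left_mono) (auto simp: \<gamma>_def e_def)
    moreover have "2 * \<gamma> * (\<mu>\<^sup>2 + e * ((\<mu>\<^sup>2)\<^sup>2/2)) = 2 * \<gamma> * \<mu>\<^sup>2 + e * (\<gamma> * \<mu>^4)"
      by (simp add: power2_eq_square power4_eq_xxxx field_simps)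
    ultimately show ?thesis by linarith
  qed
  define d where "d = (W1 + 2 * \<mu>)\<^sup>2 + W2\<^sup>2 + Z\<^sup>2"
  define s where "s = w\<^sup>2 + Z\<^sup>2"
  have s0: "0 \<le> s" "0 \<le> d" by (simp_all add: s_def d_def)
  have ds: "2 * (\<mu> * W1) = d/2 - s/2 - 2 * \<mu>\<^sup>2"
    unfolding d_def s_def w_squared by (simp add: power2_eq_square algebra_simps)
  have t0: "0 \<le> triangle_part" using u' by (rule triangle_part_nonneg)
  define Q where "Q = (\<mu>\<^sup>2 + w\<^sup>2 + zeta)/1000"
  define p where "p = polar_part \<mu>"
  define t where "t = triangle_part"
  have flat0: "Q \<le> 1 * d + p + 9919/10000 * t
        + 489/500 * \<mu>^4 - 811/2000/2 * s - 2 * (1733/2500) * \<mu>\<^sup>2"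
    unfolding Q_def d_def p_def t_def s_def by (rule antipodal_bound[OF _ \<mu> u]) (simp add: antipodal_params_def)
  have flat1: "Q \<le> 1/2 * d + p + 3173/5000 * t + 207/500 * \<mu>^4 - 1/3/2 * s - 2 * (1/2) * \<mu>\<^sup>2"
    unfolding Q_def d_def p_def t_def s_def by (rule antipodal_bound[OF _ \<mu> u]) (simp add: antipodal_params_def)
  have b1: "(1 - 811/2000 * e + (811/2000 - 1/3) * e\<^sup>2) * (s/2) \<le> \<beta> * (s/2)"
    using beta_bounds(1)[OF e] s0 by (intro mult_right_mono) (auto simp: \<beta>_def)
  have b2: "e * ((9919/10000 * (1 - e) + 6346/10000 * e) * t) \<le> e * (\<beta> * t)"
    using beta_bounds(2)[OF e] t0 e by (intro mult_left_mono mult_right_mono) (auto simp: \<beta>_def t_def)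
  have g1: "(1 - 1733/2500 * e
        + (1733/2500 - 1/2) * e\<^sup>2) * (2 * \<mu>\<^sup>2) \<le> \<gamma> * (2 * \<mu>\<^sup>2)"
    using gamma_bounds(1)[OF e] \<mu>2 by (intro mult_right_mono) (auto simp: \<gamma>_def)
  have g2: "e * ((978/1000 * (1 - e) + 414/1000 * e) * \<mu>^4) \<le> e * (\<gamma> * \<mu>^4)"
    using gamma_bounds(2)[OF e] e by (intro mult_left_mono mult_right_mono) (auto simp: \<gamma>_def)
  have h0: "0 \<le> e * (1 - e) * (1 * d + p + 9919/10000 * t
        + 489/500 * \<mu>^4 - 811/2000/2 * s - 2 * (1733/2500) * \<mu>\<^sup>2 - Q)"
    using flat0 e by (intro mult_nonneg_nonneg) auto
  have h1: "0 \<le> e\<^sup>2 * (1/2 * d + p + 3173/5000 * t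
        + 207/500 * \<mu>^4 - 1/3/2 * s - 2 * (1/2) * \<mu>\<^sup>2 - Q)"
    using flat1 e by (intro mult_nonneg_nonneg) auto
  \<comment> \<open>\<open>d/2 = e * (1 - e) * d + e\<^sup>2 * (d/2) + (1 - e)\<^sup>2 * (d/2)\<close>\<close>
  have h2: "0 \<le> (1 - e)\<^sup>2 * (d/2)" using s0 by simp
  have "(d/2 - s/2 - 2 * \<mu>\<^sup>2 + e * p) + ((1 - 811/2000 * e + (811/2000 - 1/3) * e\<^sup>2) * (s/2)
        + e * ((9919/10000 * (1 - e) + 6346/10000 * e) * t))
      + ((1 - 1733/2500 * e + (1733/2500 - 1/2) * e\<^sup>2) * (2 * \<mu>\<^sup>2)
        + e * ((978/1000 * (1 - e) + 414/1000 * e) * \<mu>^4)) - e * Q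
    = e * (1 - e) * (1 * d + p + 9919/10000 * t + 489/500 * \<mu>^4 - 811/2000/2 * s - 2 * (1733/2500) * \<mu>\<^sup>2 - Q)
      + e\<^sup>2 * (1/2 * d + p + 3173/5000 * t + 207/500 * \<mu>^4 - 1/3/2 * s - 2 * (1/2) * \<mu>\<^sup>2 - Q)
      + (1 - e)\<^sup>2 * (d/2)"
    by (simp add: power2_eq_square field_simps)
  then have "e * Q \<le> (d/2 - s/2 - 2 * \<mu>\<^sup>2 + e * p) + (\<beta> * (s/2) + e * (\<beta> * t)) + (\<gamma> * (2 * \<mu>\<^sup>2) + e * (\<gamma> * \<mu>^4))"
    using h0 h1 h2 b1 b2 g1 g2 by linarith
  moreover have "2 * \<gamma> * \<mu>\<^sup>2 = \<gamma> * (2 * \<mu>\<^sup>2)" by simp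
  ultimately show ?thesis
    using 1 2 3 unfolding phi_sum_def ds s_def[symmetric] p_def[symmetric] t_def[symmetric] Q_def[symmetric] e_def[symmetric]
    by linarith
qed

text \<open>Summing \<open>phi_quadratic_interpolation\<close> over all pairs gives \<open>d/2 - 5/2\<close> plus \<open>c\<close> times the sum of
  squares. The five ranges of \<open>\<mu>\<^sup>2\<close> fix \<open>u\<close>, which bounds the absolute values of the negative scalar
  products.\<close>

lemma phi_sum_bent:
  assumes q: "0 < q" "q < 1" and \<mu>: "1/3 < \<mu>" "\<mu> \<le> 1" and \<nu>: "\<mu>\<^sup>2 + \<nu>\<^sup>2 = 1"
    and low: "pairs_ge \<mu> \<nu> (2 * \<mu>\<^sup>2 - 1)"
  shows "3 * phi q (- (1/2)) + phi q (- 1) < phi_sum q \<mu> \<nu>"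
proof -
  define d where "d = (W1 + 2 * \<mu>)\<^sup>2 + W2\<^sup>2 + Z\<^sup>2"
  have d0: "0 \<le> d" by (simp add: d_def)
  have main: ?thesis if piece: "(u, P, C) \<in> {(7/9, 353/200, 149/100), (3/4, 349/200, 147/100), (2/3, 1711/1000, 71/50),
      (3/5, 421/250, 69/50), (5/9, 833/500, 0)}"
      and m: "1 - u \<le> 2 * \<mu>\<^sup>2" and p: "P < product_squares \<mu> + C * d" for u P C
  proof -
    define c where "c = (phi q (- u) + u) / u\<^sup>2"
    note c = quadratic_coefficient_bounds_pieces[OF q piece, folded c_def]
    have u: "0 < u" using piece by auto
    have x: "x + c * x\<^sup>2 \<le> phi q x" if "2 * \<mu>\<^sup>2 - 1 \<le> x" "x \<le> 1" for x
      unfolding c_def using that m by (intro phi_quadratic_interpolation[OF q u]) auto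
    have xp: "2 * (\<mu> * x) + c * (2 * (\<mu>\<^sup>2 * x\<^sup>2
        + (1 - \<mu>\<^sup>2) * z\<^sup>2)) \<le> phi q (\<mu> * x + \<nu> * z) + phi q (\<mu> * x - \<nu> * z)"
      if "x\<^sup>2 + y\<^sup>2 + z\<^sup>2 = 1" "2 * \<mu>\<^sup>2 - 1 \<le> \<mu> * x + \<nu> * z" "2 * \<mu>\<^sup>2 - 1 \<le> \<mu> * x - \<nu> * z" for x y z
    proof -
      have \<nu>2: "1 - \<mu>\<^sup>2 = \<nu>\<^sup>2" using \<nu> by simp
      have "2 * (\<mu> * x) + c * (2 * (\<mu>\<^sup>2 * x\<^sup>2 + (1 - \<mu>\<^sup>2) * z\<^sup>2))
        = ((\<mu> * x + \<nu> * z) + c * (\<mu> * x + \<nu> * z)\<^sup>2) + ((\<mu> * x - \<nu> * z)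
        + c * (\<mu> * x - \<nu> * z)\<^sup>2)"
        unfolding \<nu>2 by (simp add: power2_eq_square algebra_simps)
      also have "\<dots> \<le> phi q (\<mu> * x + \<nu> * z) + phi q (\<mu> * x - \<nu> * z)"
        using that polar_product_le[OF that(1) \<nu>] by (intro add_mono x) auto
      finally show ?thesis .
    qed
    have lo: "2 * \<mu>\<^sup>2 - 1 \<le> u1 - 1/2" "2 * \<mu>\<^sup>2 - 1 \<le> u2 - 1/2" "2 * \<mu>\<^sup>2 - 1 \<le> u3 - 1/2"
      using low by (auto simp: pairs_ge_def)
    have "\<mu>\<^sup>2 \<le> 1" using \<mu> by (simp add: power_le_one)
    then have "(2 * (\<mu> * X1) + c * (2 * (\<mu>\<^sup>2 * X1\<^sup>2 + (1 - \<mu>\<^sup>2) * z1\<^sup>2)))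
      + (2 * (\<mu> * X2) + c * (2 * (\<mu>\<^sup>2 * X2\<^sup>2 + (1 - \<mu>\<^sup>2) * z2\<^sup>2)))
      + (2 * (\<mu> * X3) + c * (2 * (\<mu>\<^sup>2 * X3\<^sup>2 + (1 - \<mu>\<^sup>2) * z3\<^sup>2)))
      + (((u1 - 1/2) + c * (u1 - 1/2)\<^sup>2) + ((u2 - 1/2) + c * (u2 - 1/2)\<^sup>2) + ((u3 - 1/2) + c * (u3 - 1/2)\<^sup>2))
      + ((2 * \<mu>\<^sup>2 - 1) + c * (2 * \<mu>\<^sup>2 - 1)\<^sup>2) \<le> phi_sum q \<mu> \<nu>"
      unfolding phi_sum_def using low unfolding pairs_ge_def
      by (intro add_mono xp[OF unit(1)] xp[OF unit(2)] xp[OF unit(3)] x lo triangle_product_le) auto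
    also have "(2 * (\<mu> * X1) + c * (2 * (\<mu>\<^sup>2 * X1\<^sup>2 + (1 - \<mu>\<^sup>2) * z1\<^sup>2)))
      + (2 * (\<mu> * X2) + c * (2 * (\<mu>\<^sup>2 * X2\<^sup>2 + (1 - \<mu>\<^sup>2) * z2\<^sup>2)))
      + (2 * (\<mu> * X3) + c * (2 * (\<mu>\<^sup>2 * X3\<^sup>2 + (1 - \<mu>\<^sup>2) * z3\<^sup>2)))
      + (((u1 - 1/2) + c * (u1 - 1/2)\<^sup>2) + ((u2 - 1/2) + c * (u2 - 1/2)\<^sup>2) + ((u3 - 1/2) + c * (u3 - 1/2)\<^sup>2))
      + ((2 * \<mu>\<^sup>2 - 1) + c * (2 * \<mu>\<^sup>2 - 1)\<^sup>2)
      = 2 * (\<mu> * W1) + (u1 + u2 + u3) + 2 * \<mu>\<^sup>2 - 5/2 + c * product_squares \<mu>"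
      unfolding product_squares_def W1_def zeta_def by (simp add: algebra_simps)
    also have "\<dots> = d/2 - 5/2 + c * product_squares \<mu>"
      unfolding u_sum d_def w_squared by (simp add: power2_eq_square field_simps)
    finally have "d/2 - 5/2 + c * product_squares \<mu> \<le> phi_sum q \<mu> \<nu>" .
    moreover have "c * P < c * (product_squares \<mu> + C * d)" using p c(1) by (rule mult_strict_left_mono)
    moreover have "C * c * d \<le> 1/2 * d" using c(2) d0 by (rule mult_right_mono)
    moreover have "c * (product_squares \<mu> + C * d) = c * product_squares \<mu> + C * c * d" by (simp add: algebra_simps)
    ultimately show ?thesis using c(3) by linarith
  qed
  have le: "\<mu> \<le> b" if "\<mu>\<^sup>2 \<le> a" "a \<le> b\<^sup>2" "0 \<le> b" for a b
    using that by (intro power2_le_imp_le[of \<mu> b]) auto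
  have ge: "a \<le> \<mu>" if "b \<le> \<mu>\<^sup>2" "a\<^sup>2 \<le> b" for a b
    using that \<mu> by (intro power2_le_imp_le[of a \<mu>]) auto
  have "(1/3)\<^sup>2 \<le> \<mu>\<^sup>2" using \<mu> by (intro power_mono) auto
  then have \<mu>9: "1/9 \<le> \<mu>\<^sup>2" by (simp add: power2_eq_square)
  consider "\<mu>\<^sup>2 \<le> 1/8" | "1/8 \<le> \<mu>\<^sup>2" "\<mu>\<^sup>2 \<le> 1/6" | "1/6 \<le> \<mu>\<^sup>2" "\<mu>\<^sup>2 \<le> 1/5" | "1/5 \<le> \<mu>\<^sup>2" "\<mu>\<^sup>2 \<le> 2/9" | "2/9 \<le> \<mu>\<^sup>2"
    by linarith
  then show ?thesis
  proof cases
    case 1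
    have "353/200 < product_squares \<mu> + 149/100 * d" unfolding d_def
      by (rule product_squares_gt[where lo = "1/3" and hi = "221/625"])
        (use \<mu> le[OF 1, of "221/625"] in \<open>simp_all add: power2_eq_square\<close>)
    from main[OF _ _ this, of "7/9"] \<mu>9 show ?thesis by simp
  next
    case 2
    have "349/200 < product_squares \<mu> + 147/100 * d" unfolding d_def
      by (rule product_squares_gt[where lo = "707/2000" and hi = "4083/10000"])
        (use ge[OF 2(1), of "707/2000"] le[OF 2(2), of "4083/10000"] in \<open>simp_all add: power2_eq_square\<close>)
    from main[OF _ _ this, of "3/4"] 2 show ?thesis by simp
  next
    case 3
    have "1711/1000 < product_squares \<mu> + 71/50 * d" unfolding d_def
      by (rule product_squares_gt[where lo = "2041/5000" and hi = "4473/10000"])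
        (use ge[OF 3(1), of "2041/5000"] le[OF 3(2), of "4473/10000"] in \<open>simp_all add: power2_eq_square\<close>)
    from main[OF _ _ this, of "2/3"] 3 show ?thesis by simp
  next
    case 4
    have "421/250 < product_squares \<mu> + 69/50 * d" unfolding d_def
      by (rule product_squares_gt[where lo = "559/1250" and hi = "943/2000"])
        (use ge[OF 4(1), of "559/1250"] le[OF 4(2), of "943/2000"] in \<open>simp_all add: power2_eq_square\<close>)
    from main[OF _ _ this, of "3/5"] 4 show ?thesis by simp
  next
    case 5
    \<comment> \<open>\<open>833/500\<close> instead of \<open>5/3\<close> makes the inequality strict\<close>
    have "0 \<le> 3/4 * (2 * (1 - \<mu>\<^sup>2) + zeta - 5/3)\<^sup>2" by simp
    then have "833/500 < product_squares \<mu> + 0 * d" using product_squares_ge[of \<mu>] by linarith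
    from main[OF _ _ this, of "5/9"] 5 show ?thesis by simp
  qed
qed

end

section \<open>Configurations of five points\<close>

lemma orthonormal_matrix_isometry:
  fixes a b c :: "real^3"
  assumes "norm a = 1" "norm b = 1" "norm c = 1" "a \<bullet> b = 0" "a \<bullet> c = 0" "b \<bullet> c = 0"
  defines "h \<equiv> \<lambda>x. vector [a \<bullet> x, b \<bullet> x, c \<bullet> x] :: real^3"
  shows "dist (h x) (h y) = dist x y" "h x \<bullet> h y = x \<bullet> y"
proof -
  define A :: "real^3^3" where "A = vector [a, b, c]"
  have rows: "row 1 A = a" "row 2 A = b" "row 3 A = c"
    by (simp_all add: A_def row_def vec_eq_iff)
  have "orthogonal_matrix A"
    unfolding orthogonal_matrix_orthonormal_rows
    using assms by (simp add: forall_3 rows orthogonal_def inner_commute)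
  then have ot: "orthogonal_transformation ((*v) A)"
    by (simp add: orthogonal_transformation_matrix)
  have h: "h x = A *v x" for x
    by (simp add: h_def A_def vec_eq_iff forall_3 matrix_vector_mul_component)
  show "h x \<bullet> h y = x \<bullet> y" using ot by (simp add: h orthogonal_transformation_def)
  show "dist (h x) (h y) = dist x y"
    using ot unfolding orthogonal_transformation_isometry by (simp add: h)
qed

text \<open>Complete the directions of \<open>m\<close> and \<open>n\<close> to an orthonormal basis by their cross product; if \<open>m = 0\<close>
  any direction orthogonal to \<open>n\<close> serves as the first axis.\<close>

lemma adapted_coordinates:
  fixes m n :: "real^3"
  assumes mn: "m \<bullet> n = 0" and n: "n \<noteq> 0"
  obtains X Y z :: "real^3 \<Rightarrow> real" where
    "\<And>x y. x \<bullet> y = X x * X y + Y x * Y y + z x * z y"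
    "\<And>x. m \<bullet> x = norm m * X x" "\<And>x. n \<bullet> x = norm n * z x"
proof -
  obtain a where a: "norm a = 1" "n \<bullet> a = 0" "m = norm m *\<^sub>R a"
  proof (cases "m = 0")
    case True
    obtain y where y: "y \<noteq> 0" "orthogonal n y"
      using orthogonal_to_vector_exists[of n] by auto
    show ?thesis
      by (rule that[of "y /\<^sub>R norm y"]) (use y True in \<open>simp_all add: orthogonal_def\<close>)
  next
    case False
    show ?thesis
      by (rule that[of "m /\<^sub>R norm m"]) (use False mn in \<open>simp_all add: inner_commute\<close>)
  qed
  define c where "c = n /\<^sub>R norm n"
  have c: "norm c = 1" "n = norm n *\<^sub>R c" using n by (simp_all add: c_def)
  have ac: "a \<bullet> c = 0" using a(2) by (simp add: c_def inner_commute)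
  define b where "b = cross3 c a"
  have ab: "a \<bullet> b = 0" "b \<bullet> c = 0" by (simp_all add: b_def dot_cross_self)
  have "(norm b)\<^sup>2 = 1"
    using norm_cross_dot[of c a] a c ac unfolding b_def by (simp add: inner_commute)
  then have b: "norm b = 1" by (simp add: power2_eq_1_iff) (smt (verit) norm_ge_zero)
  show ?thesis
  proof (rule that[of "\<lambda>x. a \<bullet> x" "\<lambda>x. b \<bullet> x" "\<lambda>x. c \<bullet> x"])
    fix x y :: "real^3"
    show "x \<bullet> y = (a \<bullet> x) * (a \<bullet> y) + (b \<bullet> x) * (b \<bullet> y)
        + (c \<bullet> x) * (c \<bullet> y)"
      using orthonormal_matrix_isometry(2)[OF a(1) b c(1) ab(1) ac ab(2), of x y]
      by (simp add: inner_vec_def sum_3)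
    show "m \<bullet> x = norm m * (a \<bullet> x)" by (subst a(3)) simp
    show "n \<bullet> x = norm n * (c \<bullet> x)" by (subst c(2)) simp
  qed
qed

text \<open>In the coordinates adapted to \<open>m = (P4 + P5)/2\<close> and \<open>n = (P4 - P5)/2\<close> the points \<open>P4\<close> and \<open>P5\<close> have opposite
  heights, second coordinate zero, and the common first coordinate \<open>\<mu>\<close>. In case of equality
  \<open>w\<close> and \<open>zeta\<close> vanish, hence also \<open>Z\<close>, and all deviations \<open>ui\<close> are zero.\<close>

lemma five_unit_vectors_phi_sum:
  fixes P1 P2 P3 P4 P5 :: "real^3"
  assumes q: "0 < q" "q < 1"
    and norms: "norm P1 = 1" "norm P2 = 1" "norm P3 = 1" "norm P4 = 1" "norm P5 = 1"
    and ne: "P4 \<noteq> P5"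
    and far: "P4 \<bullet> P5 \<le> P1 \<bullet> P4" "P4 \<bullet> P5 \<le> P1 \<bullet> P5" "P4 \<bullet> P5 \<le> P2 \<bullet> P4" "P4 \<bullet> P5 \<le> P2 \<bullet> P5"
      "P4 \<bullet> P5 \<le> P3 \<bullet> P4" "P4 \<bullet> P5 \<le> P3 \<bullet> P5" "P4 \<bullet> P5 \<le> P1 \<bullet> P2" "P4 \<bullet> P5 \<le> P1 \<bullet> P3" "P4 \<bullet> P5 \<le> P2 \<bullet> P3"
  defines "S \<equiv> phi q (P1 \<bullet> P4) + phi q (P1 \<bullet> P5) + phi q (P2 \<bullet> P4)
        + phi q (P2 \<bullet> P5)
    + phi q (P3 \<bullet> P4) + phi q (P3 \<bullet> P5) + phi q (P1 \<bullet> P2) + phi q (P1 \<bullet> P3) + phi q (P2 \<bullet> P3) + phi q (P4 \<bullet> P5)"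
  shows "3 * phi q (- (1/2)) + phi q (- 1) \<le> S"
    and "S \<le> 3 * phi q (- (1/2)) + phi q (- 1) \<Longrightarrow> P5 = - P4 \<and> P1 \<bullet> P4 = 0 \<and> P2 \<bullet> P4 = 0 \<and> P3 \<bullet> P4 = 0
      \<and> P1 \<bullet> P2 = - 1/2 \<and> P1 \<bullet> P3 = - 1/2 \<and> P2 \<bullet> P3 = - 1/2"
proof -
  define m where "m = (1/2) *\<^sub>R (P4 + P5)"
  define n where "n = (1/2) *\<^sub>R (P4 - P5)"
  have P45: "P4 = m + n" "P5 = m - n"
    unfolding m_def n_def by (simp_all add: vec_eq_iff field_simps)
  have n0: "n \<noteq> 0" using ne by (simp add: n_def)
  have sq: "P1 \<bullet> P1 = 1" "P2 \<bullet> P2 = 1" "P3 \<bullet> P3 = 1" "P4 \<bullet> P4 = 1" "P5 \<bullet> P5 = 1"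
    using norms by (simp_all add: norm_eq_1)
  have mn: "m \<bullet> n = 0" using sq by (simp add: m_def n_def inner_simps inner_commute)
  obtain X Y z where coords: "\<And>x y. x \<bullet> y = X x * X y + Y x * Y y + z x * z y"
    "\<And>x. m \<bullet> x = norm m * X x" "\<And>x. n \<bullet> x = norm n * z x"
    using adapted_coordinates[OF mn n0] by blast
  define \<mu> where "\<mu> = norm m"
  define \<nu> where "\<nu> = norm n"
  have mm: "m \<bullet> m = \<mu>\<^sup>2" "n \<bullet> n = \<nu>\<^sup>2" by (simp_all add: \<mu>_def \<nu>_def power2_norm_eq_inner)
  have one: "\<mu>\<^sup>2 + \<nu>\<^sup>2 = 1"
    using sq(4) mn mm unfolding P45 by (simp add: inner_simps inner_commute)
  have pole: "P4 \<bullet> P5 = 2 * \<mu>\<^sup>2 - 1"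
    using mn mm one unfolding P45 by (simp add: inner_simps inner_commute)
  have k4: "x \<bullet> P4 = \<mu> * X x + \<nu> * z x" and k5: "x \<bullet> P5 = \<mu> * X x - \<nu> * z x" for x
    using coords(2)[of x] coords(3)[of x] unfolding P45 \<mu>_def \<nu>_def
    by (simp_all add: inner_simps inner_commute)
  have "x \<bullet> x = (X x)\<^sup>2 + (Y x)\<^sup>2 + (z x)\<^sup>2" for x
    using coords(1)[of x x] by (simp add: power2_eq_square)
  then interpret T: three_unit_vectors "X P1" "X P2" "X P3" "Y P1" "Y P2" "Y P3" "z P1" "z P2" "z P3"
    using sq by unfold_locales metis+
  have tri: "P2 \<bullet> P3 = T.u1 - 1/2" "P1 \<bullet> P3 = T.u2 - 1/2" "P1 \<bullet> P2 = T.u3 - 1/2"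
    by (simp_all add: T.u1_def T.u2_def T.u3_def coords(1))
  have S: "S = T.phi_sum q \<mu> \<nu>"
    unfolding S_def T.phi_sum_def pole tri unfolding k4 k5 by simp
  have low: "T.pairs_ge \<mu> \<nu> (2 * \<mu>\<^sup>2 - 1)"
    using far unfolding T.pairs_ge_def k4[symmetric] k5[symmetric] pole[symmetric] tri[symmetric] by simp
  have \<mu>0: "0 \<le> \<mu>" by (simp add: \<mu>_def)
  have "\<mu>\<^sup>2 \<le> 1\<^sup>2" using one by (simp add: ) (smt (verit) zero_le_power2)
  then have \<mu>1: "\<mu> \<le> 1" by (rule power2_le_imp_le) simp
  consider "\<mu> \<le> 1/3" | "1/3 < \<mu>" by linarith
  then have "3 * phi q (- (1/2)) + phi q (- 1) \<le> S \<and> (S \<le> 3 * phi q (- (1/2)) + phi q (- 1) \<longrightarrow>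
    \<mu> = 0 \<and> T.w = 0 \<and> T.zeta = 0)"
  proof cases
    case 1
    have f: "3 * phi q (- (1/2)) + phi q (- 1) + (1 - q) * ((\<mu>\<^sup>2 + T.w\<^sup>2 + T.zeta)/1000) \<le> S"
      unfolding S by (rule T.phi_sum_antipodal[OF q \<mu>0 1 one low])
    have pos: "0 \<le> \<mu>\<^sup>2" "0 \<le> T.w\<^sup>2" "0 \<le> T.zeta" using T.zeta_nonneg by simp_all
    then have "0 \<le> (1 - q) * ((\<mu>\<^sup>2 + T.w\<^sup>2 + T.zeta)/1000)" using q by simp
    moreover have "\<mu> = 0 \<and> T.w = 0 \<and> T.zeta = 0" if "S \<le> 3 * phi q (- (1/2)) + phi q (- 1)"
    proof -
      have "(1 - q) * ((\<mu>\<^sup>2 + T.w\<^sup>2 + T.zeta)/1000) \<le> 0" using f that by linarith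
      then have "\<mu>\<^sup>2 + T.w\<^sup>2 + T.zeta \<le> 0" using q by (simp add: mult_le_0_iff)
      then have "\<mu>\<^sup>2 = 0" "T.w\<^sup>2 = 0" "T.zeta = 0" using pos by linarith+
      then show ?thesis by simp
    qed
    ultimately show ?thesis using f by auto
  next
    case 2
    then show ?thesis unfolding S using T.phi_sum_bent[OF q 2 \<mu>1 one low] by simp
  qed
  then show "3 * phi q (- (1/2)) + phi q (- 1) \<le> S"
    and "S \<le> 3 * phi q (- (1/2)) + phi q (- 1) \<Longrightarrow> P5 = - P4 \<and> P1 \<bullet> P4 = 0 \<and> P2 \<bullet> P4 = 0 \<and> P3 \<bullet> P4 = 0
      \<and> P1 \<bullet> P2 = - 1/2 \<and> P1 \<bullet> P3 = - 1/2 \<and> P2 \<bullet> P3 = - 1/2"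
  proof -
    assume *: "3 * phi q (- (1/2)) + phi q (- 1) \<le> S \<and> (S \<le> 3 * phi q (- (1/2)) + phi q (- 1) \<longrightarrow>
      \<mu> = 0 \<and> T.w = 0 \<and> T.zeta = 0)"
    then show "3 * phi q (- (1/2)) + phi q (- 1) \<le> S" by simp
    assume "S \<le> 3 * phi q (- (1/2)) + phi q (- 1)"
    with * have 0: "\<mu> = 0" "T.w = 0" "T.zeta = 0" by auto
    have z0: "z P1 = 0" "z P2 = 0" "z P3 = 0"
      using 0(3) unfolding T.zeta_def by (simp_all add: add_nonneg_eq_0_iff)
    have W0: "T.W1 = 0" "T.W2 = 0" using T.w_squared 0(2) by (simp_all add: add_nonneg_eq_0_iff)
    have "T.Z = z P1 + z P2 + z P3" by (rule T.Z_def)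
    then have Z0: "T.Z = 0" using z0 by linarith
    have "m = 0" using 0(1) by (simp add: \<mu>_def)
    then have "P5 = - P4" unfolding P45 by simp
    moreover have "T.u1 = 0" "T.u2 = 0" "T.u3 = 0"
      unfolding T.u_dot W0 Z0 0(2) by simp_all
    then have "P1 \<bullet> P2 = - 1/2" "P1 \<bullet> P3 = - 1/2" "P2 \<bullet> P3 = - 1/2"
      unfolding tri by linarith+
    moreover have "P1 \<bullet> P4 = 0" "P2 \<bullet> P4 = 0" "P3 \<bullet> P4 = 0"
      unfolding k4 by (simp_all add: 0(1) z0)
    ultimately show "P5 = - P4 \<and> P1 \<bullet> P4 = 0 \<and> P2 \<bullet> P4 = 0 \<and> P3 \<bullet> P4 = 0
      \<and> P1 \<bullet> P2 = - 1/2 \<and> P1 \<bullet> P3 = - 1/2 \<and> P2 \<bullet> P3 = - 1/2" by blast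
  qed
qed

lemma R_dist_unit:
  fixes x y :: "real^3"
  assumes s: "- 2 < s" "s < 0" and n: "norm x = 1" "norm y = 1" and q: "q = - s/2"
  shows "R s (dist x y) = q * 2 powr q * phi q (x \<bullet> y) - 2 powr q"
proof -
  have q0: "0 < q" using s q by simp
  have d2: "(dist x y)\<^sup>2 = 2 * (1 - x \<bullet> y)"
    using n by (simp add: dist_norm power2_norm_eq_inner inner_simps norm_eq_1 inner_commute)
  have "0 \<le> (dist x y)\<^sup>2" by simp
  then have le: "0 \<le> 1 - x \<bullet> y" unfolding d2 by simp
  have "- s = 2 * q" using q by simp
  then have "dist x y powr (- s) = ((dist x y) powr 2) powr q" by (simp only: powr_powr)
  also have "(dist x y) powr 2 = (dist x y)\<^sup>2" by (simp add: powr_numeral)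
  also have "\<dots> powr q = 2 powr q * (1 - x \<bullet> y) powr q" unfolding d2 using le by (subst powr_mult) auto
  finally have "R s (dist x y) = - (2 powr q * (1 - x \<bullet> y) powr q)" using s by (simp add: R_def)
  also have "\<dots> = q * 2 powr q * phi q (x \<bullet> y) - 2 powr q"
    using q0 by (simp add: phi_def field_simps)
  finally show ?thesis .
qed

lemma energy_five:
  fixes P1 P2 P3 P4 P5 :: "real^3"
  assumes s: "- 2 < s" "s < 0" and q: "q = - s/2"
    and norms: "norm P1 = 1" "norm P2 = 1" "norm P3 = 1" "norm P4 = 1" "norm P5 = 1"
    and dis: "distinct [P1, P2, P3, P4, P5]"
  shows "energy (R s) {P1, P2, P3, P4, P5} = q * 2 powr q * (phi q (P1 \<bullet> P4)
        + phi q (P1 \<bullet> P5) + phi q (P2 \<bullet> P4) + phi q (P2 \<bullet> P5)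
    + phi q (P3 \<bullet> P4) + phi q (P3 \<bullet> P5) + phi q (P1 \<bullet> P2) + phi q (P1 \<bullet> P3) + phi q (P2 \<bullet> P3) + phi q (P4 \<bullet> P5)) - 10 * 2 powr q"
proof -
  let ?p = "\<lambda>i. [P1, P2, P3, P4, P5] ! i"
  have set5: "{..<5::nat} = {0, 1, 2, 3, 4}" by auto
  have "inj_on ?p {..<5}" using dis inj_on_nth[of "[P1, P2, P3, P4, P5]" "{..<5}"] by simp
  then have "energy (R s) (?p ` {..<5}) = (\<Sum>j<5. \<Sum>i<j. R s (dist (?p i) (?p j)))"
    by (rule energy_enumeration)
  moreover have "?p ` {..<5} = {P1, P2, P3, P4, P5}" unfolding set5 by auto
  moreover have "(\<Sum>j<5. \<Sum>i<j. R s (dist (?p i) (?p j)))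
    = R s (dist P1 P2) + R s (dist P1 P3) + R s (dist P2 P3) + R s (dist P1 P4) + R s (dist P2 P4) + R s (dist P3 P4)
     + R s (dist P1 P5) + R s (dist P2 P5) + R s (dist P3 P5) + R s (dist P4 P5)"
    by (simp add: eval_nat_numeral)
  ultimately show ?thesis
    using norms by (simp add: R_dist_unit[OF s _ _ q] algebra_simps)
qed

lemma farthest_pair_enumeration:
  fixes P :: "(real^3) set"
  assumes P: "card P = 5"
  obtains P1 P2 P3 P4 P5 where "P = {P1, P2, P3, P4, P5}" "distinct [P1, P2, P3, P4, P5]"
    "\<And>x y. x \<in> P \<Longrightarrow> y \<in> P \<Longrightarrow> x \<noteq> y \<Longrightarrow> P4 \<bullet> P5 \<le> x \<bullet> y"
proof -
  have fin: "finite P" using P by (simp add: card_ge_0_finite)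
  define D where "D = {(x, y). x \<in> P \<and> y \<in> P \<and> x \<noteq> y}"
  have "D \<subseteq> P \<times> P" by (auto simp: D_def)
  then have "finite D" using fin finite_subset by blast
  moreover have "D \<noteq> {}"
  proof
    assume "D = {}"
    then have "\<forall>x\<in>P. \<forall>y\<in>P. x = y" by (auto simp: D_def)
    then have "card P \<le> 1" using fin by (simp add: card_le_Suc0_iff_eq)
    then show False using P by simp
  qed
  ultimately obtain d where d: "d \<in> D" "\<And>e. e \<in> D \<Longrightarrow> fst d \<bullet> snd d \<le> fst e \<bullet> snd e"
    using ex_min_if_finite[of "(\<lambda>e. fst e \<bullet> snd e) ` D"] by (force simp: not_less)
  obtain P4 P5 where d45: "d = (P4, P5)" by fastforce
  have mem: "P4 \<in> P" "P5 \<in> P" "P4 \<noteq> P5" using d(1) by (auto simp: d45 D_def)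
  have "card (P - {P4, P5}) = 3" using P fin mem by (simp add: card_Diff_subset)
  then obtain P1 P2 P3 where r: "P - {P4, P5} = {P1, P2, P3}" "P1 \<noteq> P2" "P1 \<noteq> P3" "P2 \<noteq> P3"
    unfolding card_3_iff by blast
  show ?thesis
  proof (rule that[of P1 P2 P3 P4 P5])
    show "P = {P1, P2, P3, P4, P5}" using r(1) mem by blast
    show "distinct [P1, P2, P3, P4, P5]" using r mem by auto
    show "P4 \<bullet> P5 \<le> x \<bullet> y" if "x \<in> P" "y \<in> P" "x \<noteq> y" for x y
      using d(2)[of "(x, y)"] that by (simp add: d45 D_def)
  qed
qed

lemma TBP_points:
  shows "norm (vector [0, 0, 1] :: real^3) = 1" "norm (vector [0, 0, -1] :: real^3) = 1"
    "norm (vector [1, 0, 0] :: real^3) = 1" "norm (vector [-1/2, sqrt 3 / 2, 0] :: real^3) = 1"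
    "norm (vector [-1/2, - sqrt 3 / 2, 0] :: real^3) = 1"
    "distinct [vector [1, 0, 0] :: real^3, vector [-1/2, sqrt 3 / 2, 0], vector [-1/2, - sqrt 3 / 2, 0],
       vector [0, 0, 1], vector [0, 0, -1]]"
  by (simp_all add: norm_eq_1 inner_vec_def sum_3 vec_eq_iff forall_3 power2_eq_square[symmetric] power_divide)

lemma TBP_configuration: "five_point_configuration TBP"
proof -
  have "TBP = set [vector [1, 0, 0] :: real^3, vector [-1/2, sqrt 3 / 2, 0], vector [-1/2, - sqrt 3 / 2, 0],
       vector [0, 0, 1], vector [0, 0, -1]]" by (auto simp: TBP_def)
  then have "card TBP = 5" using distinct_card[OF TBP_points(6)] by simp
  then show ?thesis using TBP_points unfolding five_point_configuration_def by (auto simp: TBP_def)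
qed

lemma energy_TBP:
  assumes s: "- 2 < s" "s < 0" and q: "q = - s/2"
  shows "energy (R s) TBP = q * 2 powr q * (3 * phi q (- (1/2)) + phi q (- 1)) - 10 * 2 powr q"
proof -
  have "TBP = {vector [1, 0, 0] :: real^3, vector [-1/2, sqrt 3 / 2, 0], vector [-1/2, - sqrt 3 / 2, 0],
       vector [0, 0, 1], vector [0, 0, -1]}" by (auto simp: TBP_def)
  then show ?thesis
    using energy_five[OF s q TBP_points(3,4,5,1,2,6)]
    by (simp add: inner_vec_def sum_3 phi_def[of q 0])
qed

text \<open>The given scalar products are those of the bi-pyramid, so Gram--Schmidt applied to \<open>P1\<close>, \<open>P2\<close>, \<open>P4\<close>
  provides the axes of the bi-pyramid.\<close>

lemma isometric_TBP:
  fixes P1 P2 P3 P4 :: "real^3"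
  assumes norms: "norm P1 = 1" "norm P2 = 1" "norm P3 = 1" "norm P4 = 1"
    and orth: "P1 \<bullet> P4 = 0" "P2 \<bullet> P4 = 0" "P3 \<bullet> P4 = 0"
    and tri: "P1 \<bullet> P2 = - 1/2" "P1 \<bullet> P3 = - 1/2" "P2 \<bullet> P3 = - 1/2"
  shows "isometric {P1, P2, P3, P4, - P4} TBP"
proof -
  define b where "b = (2 / sqrt 3) *\<^sub>R (P2 + (1/2) *\<^sub>R P1)"
  have sq: "P1 \<bullet> P1 = 1" "P2 \<bullet> P2 = 1" "P4 \<bullet> P4 = 1" using norms by (simp_all add: norm_eq_1)
  have "(P2 + (1/2) *\<^sub>R P1) \<bullet> (P2 + (1/2) *\<^sub>R P1) = 3/4"
    using sq tri by (simp add: inner_simps inner_commute)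
  then have "b \<bullet> b = 1" unfolding b_def inner_scaleR_left inner_scaleR_right by simp
  then have "norm b = 1" by (simp only: norm_eq_1)
  moreover have "P1 \<bullet> b = 0" "b \<bullet> P4 = 0"
    using sq orth tri by (simp_all add: b_def inner_simps inner_commute)
  ultimately have b1: "norm b = 1" "P1 \<bullet> b = 0" "b \<bullet> P4 = 0" by blast+
  have bP: "b \<bullet> P2 = sqrt 3 / 2" "b \<bullet> P3 = - sqrt 3 / 2"
    using sq orth tri by (simp_all add: b_def inner_simps inner_commute field_simps)
  define h where "h = (\<lambda>x. vector [P1 \<bullet> x, b \<bullet> x, P4 \<bullet> x] :: real^3)"
  have iso: "dist (h x) (h y) = dist x y" for x y
    unfolding h_def by (rule orthonormal_matrix_isometry(1)) (use norms b1 orth in auto)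
  have dots: "P1 \<bullet> P1 = 1" "b \<bullet> P1 = 0" "P4 \<bullet> P1 = 0" "P1 \<bullet> P2 = - 1/2" "P4 \<bullet> P2 = 0"
    "P1 \<bullet> P3 = - 1/2" "P4 \<bullet> P3 = 0" "P1 \<bullet> P4 = 0" "b \<bullet> P4 = 0" "P4 \<bullet> P4 = 1"
    "b \<bullet> P2 = sqrt 3 / 2" "b \<bullet> P3 = - sqrt 3 / 2"
    using sq b1 bP orth tri by (auto simp only: inner_commute[of b P1] inner_commute[of P4 P1]
      inner_commute[of P4 P2] inner_commute[of P4 P3])
  have "h P1 = vector [1, 0, 0]" "h P2 = vector [-1/2, sqrt 3 / 2, 0]"
    "h P3 = vector [-1/2, - sqrt 3 / 2, 0]" "h P4 = vector [0, 0, 1]" "h (- P4) = vector [0, 0, -1]"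
    by (simp_all only: h_def dots inner_minus_right minus_zero)
  then have "h ` {P1, P2, P3, P4, - P4} = TBP" by (auto simp: TBP_def)
  then show ?thesis using iso unfolding isometric_def by blast
qed

theorem theorem1p2p1:
  fixes s :: real
  assumes "-2 < s" and "s < 0"
  shows "is_minimizer (R s) TBP \<and> (\<forall>P. is_minimizer (R s) P \<longrightarrow> isometric P TBP)"
proof -
  define q where "q = - s/2"
  have q: "0 < q" "q < 1" using assms by (simp_all add: q_def)
  have k: "0 < q * 2 powr q" using q by simp
  have main: "energy (R s) TBP \<le> energy (R s) P \<and> (energy (R s) P \<le> energy (R s) TBP \<longrightarrow> isometric P TBP)"
    if P: "five_point_configuration P" for P
  proof -
    have card: "card P = 5" and sph: "\<And>x. x \<in> P \<Longrightarrow> norm x = 1"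
      using P by (auto simp: five_point_configuration_def)
    obtain P1 P2 P3 P4 P5 where e: "P = {P1, P2, P3, P4, P5}" "distinct [P1, P2, P3, P4, P5]"
      and far: "\<And>x y. x \<in> P \<Longrightarrow> y \<in> P \<Longrightarrow> x \<noteq> y \<Longrightarrow> P4 \<bullet> P5 \<le> x \<bullet> y"
      using farthest_pair_enumeration[OF card] by blast
    have norms: "norm P1 = 1" "norm P2 = 1" "norm P3 = 1" "norm P4 = 1" "norm P5 = 1"
      using sph e(1) by auto
    define S where "S = phi q (P1 \<bullet> P4) + phi q (P1 \<bullet> P5) + phi q (P2 \<bullet> P4)
        + phi q (P2 \<bullet> P5)
      + phi q (P3 \<bullet> P4) + phi q (P3 \<bullet> P5) + phi q (P1 \<bullet> P2) + phi q (P1 \<bullet> P3) + phi q (P2 \<bullet> P3) + phi q (P4 \<bullet> P5)"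
    have en: "energy (R s) P = q * 2 powr q * S - 10 * 2 powr q"
      unfolding e(1) S_def by (rule energy_five[OF assms q_def norms e(2)])
    have ne: "P4 \<noteq> P5" using e(2) by simp
    have far9: "P4 \<bullet> P5 \<le> P1 \<bullet> P4" "P4 \<bullet> P5 \<le> P1 \<bullet> P5" "P4 \<bullet> P5 \<le> P2 \<bullet> P4" "P4 \<bullet> P5 \<le> P2 \<bullet> P5"
      "P4 \<bullet> P5 \<le> P3 \<bullet> P4" "P4 \<bullet> P5 \<le> P3 \<bullet> P5" "P4 \<bullet> P5 \<le> P1 \<bullet> P2" "P4 \<bullet> P5 \<le> P1 \<bullet> P3" "P4 \<bullet> P5 \<le> P2 \<bullet> P3"
      using e by (auto intro!: far)
    note b = five_unit_vectors_phi_sum[OF q norms ne far9, folded S_def]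
    have "isometric P TBP" if "energy (R s) P \<le> energy (R s) TBP"
    proof -
      have "q * 2 powr q * S \<le> q * 2 powr q * (3 * phi q (- (1/2)) + phi q (- 1))"
        using that unfolding en energy_TBP[OF assms q_def] by linarith
      then have "S \<le> 3 * phi q (- (1/2)) + phi q (- 1)" using k by (rule mult_left_le_imp_le)
      from b(2)[OF this] show ?thesis
        unfolding e(1) using isometric_TBP[OF norms(1-4)] by simp
    qed
    moreover have "energy (R s) TBP \<le> energy (R s) P"
      using mult_left_mono[OF b(1), of "q * 2 powr q"] k unfolding en energy_TBP[OF assms q_def] by linarith
    ultimately show ?thesis by blast
  qed
  then show ?thesis using TBP_configuration unfolding is_minimizer_def by blast
qed

end
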